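(* Let $q$ be a non-degenerate quadratic form on an object $U=m\mathbb{1}\oplus nP$ of $\mathrm{Ver}_4^+$. Then $m$ is even and $q$ is equivalent to the quadratic form $\frac m2\mathbb{H}+q_\gamma$, where $\gamma$ is one of the following bilinear forms on $nP$: $\frac n2\beta_{2P}(0)$ (with $2\mid n$); $\beta_{2P}(1)+\frac{n-2}{2}\beta_{2P}(0)$ (with $2\mid n$, $n>0$); $\beta_P(y)+\beta_P(1)$ (with $y\in\mathbb{K}$, $y\neq1$, $n=2$); $\beta_P(y)+\beta_P(1)+(n-2)\beta_P(0)$ (with $y\in\mathbb{K}$, $n\ge3$); $n\beta_P(y)$ (with $y\in\mathbb{K}$, $n>0$); and $q_\gamma$ is the quadratic form on $nP$ associated to $\gamma$.
   Context: $\mathbb{K}$ is an algebraically closed field of characteristic $2$. $\mathrm{Ver}_4^+$ is the symmetric tensor category whose objects are (finite-dimensional) modules over $A=\mathbb{K}[t]/(t^2)$, whose morphisms are linear maps commuting with $t$, with tensor product action $t.(u\otimes u')=(t.u)\otimes u'+u\otimes(t.u')$, unit object $\mathbb{1}=\mathbb{K}$ (with $t$ acting by $0$), and braiding $c_{U,U'}(u\otimes u')=u'\otimes u+(t.u')\otimes(t.u)$. $P$ is the two-dimensional indecomposable module, with basis $w,x$, $t.w=x$, $t.x=0$. Every object is isomorphic to $m\mathbb{1}\oplus nP$ for unique $m,n\ge0$. A bilinear form on $U$ is a morphism $\beta:U\otimes U\to\mathbb{1}$; it is symmetric if $\beta\circ c_{U,U}=\beta$, and non-degenerate if the induced map $U\to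 U^*$ is an isomorphism. Let $\Gamma^2(U)=\ker(1-c_{U,U})\subseteq U\otimes U$. A quadratic form on $U$ is a morphism $q:\Gamma^2(U)\to\mathbb{1}$. Its associated bilinear form $\beta_q$ is $\beta_q=q\circ(1-c_{U,U}):U\otimes U\to\mathbb{1}$ (note $\mathrm{im}(1-c_{U,U})\subseteq\Gamma^2(U)$ in characteristic $2$); $q$ is non-degenerate if $\beta_q$ is. Quadratic forms $q$ on $V$ and $r$ on $W$ are equivalent if there is an isomorphism $\phi:V\to W$ with $q=r\circ\Gamma^2(\phi)$. The sum $q+r$ on $V\oplus W$ is the composition $\Gamma^2(V\oplus W)\cong\Gamma^2(V)\oplus(V\otimes W)\oplus\Gamma^2(W)\to\mathbb{1}$ given by $q$, $0$, $r$ on the three summands (here $V\otimes W$ is embedded by $1+c$). On the object $nP$, one has $\Gamma^2(nP)=\mathrm{im}(1-c)$, and $q\mapsto\beta_q$ is a bijection between quadratic forms and symmetric bilinear forms on $nP$; $q_\gamma$ denotes the unique quadratic form on $nP$ with $\beta_{q_\gamma}=\gamma$. $\mathbb{H}$ is the hyperbolic plane on $2\mathbb{1}$ with basis $v,v'$: $\mathbb{H}(v\otimes v)=\mathbb{H}(v'\otimes v')=0$, $\mathbb{H}(v\otimes v'+v'\otimes v)=1$ (i.e. the classical quadratic form $av+bv'\mapsto ab$). A multiple $k\mathbb{H}$ or $k\beta$ means the sum of $k$ copies; sums of bilinear forms are orthogonal direct sums. For $y\in\mathbb{K}$, $\beta_P(y)$ is the bilinear form on $P$ with Gram matrix $\begin{bmatrix}y&1\\1&0\end{bmatrix}$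 in the basis $w,\,t.w$. For $i\in\{0,1\}$, $\beta_{2P}(i)$ is the bilinear form on $2P$ with Gram matrix $\begin{bmatrix}i&0&0&1\\0&0&1&0\\0&1&0&0\\1&0&0&0\end{bmatrix}$ in a basis $w_1,\,t.w_1,\,w_2,\,t.w_2$. *)

theory Defs
  imports
    "HOL-Computational_Algebra.Polynomial"
    "HOL-Library.Function_Algebras"
begin

section \<open>Objects and morphisms of \<open>Ver\<^sub>4\<^sup>+\<close>\<close>

text \<open>
  Every vector space in this theory is a subspace of a function space \<open>'i \<Rightarrow> 'k\<close> with pointwise
  operations; up to isomorphism this is no restriction.  It allows tensor products to be formed
  inside \<open>'i \<times> 'j \<Rightarrow> 'k\<close> and direct sums inside \<open>'i + 'j \<Rightarrow> 'k\<close>.  Maps between such spaces are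
  total HOL functions of which only the values on the source space matter.
\<close>

definition fscale :: "'k::field \<Rightarrow> ('i \<Rightarrow> 'k) \<Rightarrow> 'i \<Rightarrow> 'k"
  where "fscale a u = (\<lambda>i. a * u i)"

global_interpretation fs: vector_space "fscale :: 'k::field \<Rightarrow> ('i \<Rightarrow> 'k) \<Rightarrow> 'i \<Rightarrow> 'k"
  by standard (auto simp: fscale_def fun_eq_iff algebra_simps)

text \<open>\<open>act\<close> is the action of the generator \<open>t\<close> of \<open>\<bbbK>[t]/(t\<^sup>2)\<close>.\<close>

record ('i, 'k) tmod =
  car :: "('i \<Rightarrow> 'k) set"
  act :: "('i \<Rightarrow> 'k) \<Rightarrow> ('i \<Rightarrow> 'k)"

definition linear_map_on ::
  "('i \<Rightarrow> 'k::field) set \<Rightarrow> ('j \<Rightarrow> 'k) set \<Rightarrow> (('i \<Rightarrow> 'k) \<Rightarrow> ('j \<Rightarrow> 'k)) \<Rightarrow> bool"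
  where "linear_map_on S S' f \<longleftrightarrow>
    (\<forall>u\<in>S. f u \<in> S') \<and>
    (\<forall>u\<in>S. \<forall>v\<in>S. f (u + v) = f u + f v) \<and>
    (\<forall>a. \<forall>u\<in>S. f (fscale a u) = fscale a (f u))"

definition ver4_object :: "('i, 'k::field) tmod \<Rightarrow> bool"
  where "ver4_object U \<longleftrightarrow>
    fs.subspace (car U) \<and> (\<exists>B. finite B \<and> fs.span B = car U) \<and>
    linear_map_on (car U) (car U) (act U) \<and> (\<forall>u\<in>car U. act U (act U u) = 0)"

definition morphism ::
  "('i, 'k::field) tmod \<Rightarrow> ('j, 'k) tmod \<Rightarrow> (('i \<Rightarrow> 'k) \<Rightarrow> ('j \<Rightarrow> 'k)) \<Rightarrow> bool"
  where "morphism U V f \<longleftrightarrow>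
    linear_map_on (car U) (car V) f \<and> (\<forall>u\<in>car U. f (act U u) = act V (f u))"

definition isomorphism ::
  "('i, 'k::field) tmod \<Rightarrow> ('j, 'k) tmod \<Rightarrow> (('i \<Rightarrow> 'k) \<Rightarrow> ('j \<Rightarrow> 'k)) \<Rightarrow> bool"
  where "isomorphism U V f \<longleftrightarrow> morphism U V f \<and> bij_betw f (car U) (car V)"

definition isomorphic :: "('i, 'k::field) tmod \<Rightarrow> ('j, 'k) tmod \<Rightarrow> bool"
  where "isomorphic U V \<longleftrightarrow> (\<exists>f. isomorphism U V f)"


section \<open>Tensor product, braiding, duals\<close>

definition tensor :: "('i \<Rightarrow> 'k::field) \<Rightarrow> ('j \<Rightarrow> 'k) \<Rightarrow> 'i \<times> 'j \<Rightarrow> 'k"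
  where "tensor u v = (\<lambda>(i, j). u i * v j)"

text \<open>
  The linear map \<open>f \<otimes> g\<close> applied to an arbitrary tensor: \<open>f\<close> is applied to every slice in the first
  index, then \<open>g\<close> to every slice in the second.  For \<open>Z \<in> U \<otimes> V\<close> these slices lie in \<open>U\<close> and \<open>V\<close>
  respectively, and on pure tensors one gets \<open>f u \<otimes> g v\<close> (\<open>tensor_map_tensor\<close> below).
\<close>

definition tensor_map ::
  "(('i \<Rightarrow> 'k) \<Rightarrow> ('a \<Rightarrow> 'k)) \<Rightarrow> (('j \<Rightarrow> 'k) \<Rightarrow> ('b \<Rightarrow> 'k)) \<Rightarrow> ('i \<times> 'j \<Rightarrow> 'k) \<Rightarrow> 'a \<times> 'b \<Rightarrow> 'k"
  where "tensor_map f g Z = (\<lambda>(a, b). g (\<lambda>j. f (\<lambda>i. Z (i, j)) a) b)"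

lemma tensor_map_tensor:
  assumes "linear_map_on S S' f" "linear_map_on T T' g" "u \<in> S" "v \<in> T"
  shows "tensor_map f g (tensor u v) = tensor (f u) (g v)"
proof -
  have "f (fscale (v j) u) = fscale (v j) (f u)" for j
    using assms(1,3) by (auto simp: linear_map_on_def)
  then have f: "f (\<lambda>i. u i * v j) = (\<lambda>a. v j * f u a)" for j
    by (simp add: fscale_def mult.commute)
  have "g (fscale (f u a) v) = fscale (f u a) (g v)" for a
    using assms(2,4) by (auto simp: linear_map_on_def)
  then have g: "g (\<lambda>j. v j * f u a) = (\<lambda>b. f u a * g v b)" for a
    by (simp add: fscale_def mult.commute)
  show ?thesis
    by (auto simp: tensor_map_def tensor_def f g fun_eq_iff)
qed

definition tprod :: "('i, 'k::field) tmod \<Rightarrow> ('j, 'k) tmod \<Rightarrow> ('i \<times> 'j, 'k) tmod"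
  where "tprod U V = \<lparr>
    car = fs.span {tensor u v | u v. u \<in> car U \<and> v \<in> car V},
    act = (\<lambda>Z. tensor_map (act U) id Z + tensor_map id (act V) Z)\<rparr>"

definition one_obj :: "(unit, 'k::field) tmod"
  where "one_obj = \<lparr>car = UNIV, act = (\<lambda>_. 0)\<rparr>"

text \<open>\<open>c(u \<otimes> v) = v \<otimes> u + t.v \<otimes> t.u\<close> is the flip applied to \<open>u \<otimes> v + t.u \<otimes> t.v\<close>.\<close>

definition braiding ::
  "('i, 'k::field) tmod \<Rightarrow> ('j, 'k) tmod \<Rightarrow> ('i \<times> 'j \<Rightarrow> 'k) \<Rightarrow> 'j \<times> 'i \<Rightarrow> 'k"
  where "braiding U V Z = (\<lambda>(j, i). (Z + tensor_map (act U) (act V) Z) (i, j))"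

lemma braiding_tensor:
  assumes "ver4_object U" "ver4_object V" "u \<in> car U" "v \<in> car V"
  shows "braiding U V (tensor u v) = tensor v u + tensor (act V v) (act U u)"
  using assms
  by (auto simp: braiding_def ver4_object_def tensor_map_tensor)
     (auto simp: tensor_def fun_eq_iff)

text \<open>
  Functionals are normalised to vanish outside \<open>car U\<close>.  No sign is needed in the action because
  the characteristic is \<open>2\<close>.
\<close>

definition dual :: "('i, 'k::field) tmod \<Rightarrow> ('i \<Rightarrow> 'k, 'k) tmod"
  where "dual U = \<lparr>
    car = {f. (\<forall>u\<in>car U. \<forall>v\<in>car U. f (u + v) = f u + f v) \<and>
              (\<forall>a. \<forall>u\<in>car U. f (fscale a u) = a * f u) \<and>
              (\<forall>u. u \<notin> car U \<longrightarrow> f u = 0)},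
    act = (\<lambda>f u. if u \<in> car U then f (act U u) else 0)\<rparr>"


section \<open>Direct sums and the indecomposable object \<open>P\<close>\<close>

definition dsum :: "('i, 'k::field) tmod \<Rightarrow> ('j, 'k) tmod \<Rightarrow> ('i + 'j, 'k) tmod"
  where "dsum U V = \<lparr>
    car = {z. z \<circ> Inl \<in> car U \<and> z \<circ> Inr \<in> car V},
    act = (\<lambda>z. case_sum (act U (z \<circ> Inl)) (act V (z \<circ> Inr)))\<rparr>"

definition copies :: "nat \<Rightarrow> ('i, 'k::field) tmod \<Rightarrow> (nat \<times> 'i, 'k) tmod"
  where "copies n U = \<lparr>
    car = {z. (\<forall>j<n. (\<lambda>i. z (j, i)) \<in> car U) \<and> (\<forall>j\<ge>n. \<forall>i. z (j, i) = 0)},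
    act = (\<lambda>z (j, i). if j < n then act U (\<lambda>i. z (j, i)) i else 0)\<rparr>"

datatype pidx = Pw | Px

definition P_obj :: "(pidx, 'k::field) tmod"
  where "P_obj = \<lparr>car = UNIV, act = (\<lambda>z p. case p of Pw \<Rightarrow> 0 | Px \<Rightarrow> z Pw)\<rparr>"


section \<open>Bilinear and quadratic forms\<close>

type_synonym ('i, 'k) form = "('i \<times> 'i \<Rightarrow> 'k) \<Rightarrow> unit \<Rightarrow> 'k"

definition bilinear_form :: "('i, 'k::field) tmod \<Rightarrow> ('i, 'k) form \<Rightarrow> bool"
  where "bilinear_form U \<beta> \<longleftrightarrow> morphism (tprod U U) one_obj \<beta>"

definition nondegenerate :: "('i, 'k::field) tmod \<Rightarrow> ('i, 'k) form \<Rightarrow> bool"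
  where "nondegenerate U \<beta> \<longleftrightarrow>
    isomorphism U (dual U) (\<lambda>u v. if v \<in> car U then \<beta> (tensor u v) () else 0)"

definition Gamma2 :: "('i, 'k::field) tmod \<Rightarrow> ('i \<times> 'i, 'k) tmod"
  where "Gamma2 U = \<lparr>
    car = {Z \<in> car (tprod U U). Z - braiding U U Z = 0},
    act = act (tprod U U)\<rparr>"

definition quadratic_form :: "('i, 'k::field) tmod \<Rightarrow> ('i, 'k) form \<Rightarrow> bool"
  where "quadratic_form U q \<longleftrightarrow> morphism (Gamma2 U) one_obj q"

definition assoc_bilinear :: "('i, 'k::field) tmod \<Rightarrow> ('i, 'k) form \<Rightarrow> ('i, 'k) form"
  where "assoc_bilinear U q = (\<lambda>Z. q (Z - braiding U U Z))"

definition nondegenerate_quadratic :: "('i, 'k::field) tmod \<Rightarrow> ('i, 'k) form \<Rightarrow> bool"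
  where "nondegenerate_quadratic U q \<longleftrightarrow> nondegenerate U (assoc_bilinear U q)"

definition quadratic_equiv ::
  "('i, 'k::field) tmod \<Rightarrow> ('i, 'k) form \<Rightarrow> ('j, 'k) tmod \<Rightarrow> ('j, 'k) form \<Rightarrow> bool"
  where "quadratic_equiv V q W r \<longleftrightarrow>
    (\<exists>\<phi>. isomorphism V W \<phi> \<and> (\<forall>Z\<in>car (Gamma2 V). q Z = r (tensor_map \<phi> \<phi> Z)))"

text \<open>
  Sums of forms, both quadratic and bilinear.  A tensor on \<open>V \<oplus> W\<close> is a block matrix; its diagonal
  blocks are its components in \<open>V \<otimes> V\<close> and \<open>W \<otimes> W\<close>.  On \<open>\<Gamma>\<^sup>2(V \<oplus> W)\<close> they are the components in
  \<open>\<Gamma>\<^sup>2(V)\<close> and \<open>\<Gamma>\<^sup>2(W)\<close>, since \<open>(1 + c)(V \<otimes> W)\<close> lies in the off-diagonal blocks.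
\<close>

definition form_sum :: "('i, 'k::field) form \<Rightarrow> ('j, 'k) form \<Rightarrow> ('i + 'j, 'k) form"
  where "form_sum q r = (\<lambda>Z. q (\<lambda>(a, b). Z (Inl a, Inl b)) + r (\<lambda>(a, b). Z (Inr a, Inr b)))"

definition form_copies :: "nat \<Rightarrow> ('i, 'k::field) form \<Rightarrow> (nat \<times> 'i, 'k) form"
  where "form_copies n q = (\<lambda>Z. \<Sum>j<n. q (\<lambda>(a, b). Z ((j, a), (j, b))))"


section \<open>The standard forms\<close>

text \<open>The form with Gram matrix \<open>M\<close> (list of rows) in the basis of unit vectors listed by \<open>bs\<close>.\<close>

definition gram_form :: "'i list \<Rightarrow> 'k::field list list \<Rightarrow> ('i, 'k) form"
  where "gram_form bs M =
    (\<lambda>Z _. \<Sum>a<length bs. \<Sum>b<length bs. M ! a ! b * Z (bs ! a, bs ! b))"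

lemma gram_form_tensor:
  assumes "distinct bs" "a < length bs" "b < length bs"
  shows "gram_form bs M (tensor (\<lambda>i. of_bool (i = bs ! a)) (\<lambda>i. of_bool (i = bs ! b))) () = M ! a ! b"
proof -
  let ?n = "length bs"
  have "gram_form bs M (tensor (\<lambda>i. of_bool (i = bs ! a)) (\<lambda>i. of_bool (i = bs ! b))) ()
      = (\<Sum>x<?n. \<Sum>y<?n. if y = b then if x = a then M ! x ! y else 0 else 0)"
    unfolding gram_form_def tensor_def using assms
    by (intro sum.cong refl) (auto simp: nth_eq_iff_index_eq)
  also have "\<dots> = M ! a ! b"
    using assms by (simp add: sum.delta)
  finally show ?thesis .
qed

definition beta_P :: "'k::field \<Rightarrow> (pidx, 'k) form"
  where "beta_P y = gram_form [Pw, Px]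
    [[y, 1],
     [1, 0]]"

definition beta_2P :: "'k::field \<Rightarrow> (pidx + pidx, 'k) form"
  where "beta_2P i = gram_form [Inl Pw, Inl Px, Inr Pw, Inr Px]
    [[i, 0, 0, 1],
     [0, 0, 1, 0],
     [0, 1, 0, 0],
     [1, 0, 0, 0]]"

text \<open>
  On \<open>\<one> \<oplus> \<one>\<close> the space \<open>\<Gamma>\<^sup>2\<close> consists of the symmetric tensors
  \<open>\<alpha> v\<otimes>v + \<alpha>' v'\<otimes>v' + \<delta> (v\<otimes>v' + v'\<otimes>v)\<close>, on which the hyperbolic plane takes the value \<open>\<delta>\<close>.
\<close>

definition hyperbolic :: "(unit + unit, 'k::field) form"
  where "hyperbolic = (\<lambda>Z _. Z (Inl (), Inr ()))"

text \<open>
  \<open>q\<close> (on \<open>U\<close>) is equivalent to \<open>k\<H> + q\<^sub>\<gamma>\<close>, where \<open>\<gamma>\<close> is a bilinear form on \<open>G\<close> and \<open>q\<^sub>\<gamma>\<close> is the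
  quadratic form associated to it.  In all uses \<open>G\<close> is a direct sum of copies of \<open>P\<close>, so that
  there is exactly one quadratic form \<open>r\<close> on \<open>G\<close> with associated bilinear form \<open>\<gamma>\<close>.
\<close>

definition equiv_to_standard ::
  "('i, 'k::field) tmod \<Rightarrow> ('i, 'k) form \<Rightarrow> nat \<Rightarrow> ('j, 'k) tmod \<Rightarrow> ('j, 'k) form \<Rightarrow> bool"
  where "equiv_to_standard U q k G \<gamma> \<longleftrightarrow>
    (\<exists>r. quadratic_form G r \<and> (\<forall>Z\<in>car (tprod G G). assoc_bilinear G r Z = \<gamma> Z) \<and>
      quadratic_equiv U q
        (dsum (copies k (dsum one_obj one_obj)) G)
        (form_sum (form_copies k hyperbolic) r))"

end

theory Submission
  imports Defs
begin

text \<open>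
  Write \<open>\<beta>\<close> for the bilinear form of \<open>q\<close>.  It is symmetric, \<open>\<beta>(t u, v) = \<beta>(u, t v)\<close>, and \<open>q\<close> is
  determined by \<open>\<beta>\<close> and the values \<open>Q(u) = q(u \<otimes> u)\<close> on \<open>ker t\<close>, where \<open>Q(t u) = \<beta>(u, u)\<close>.  An orthogonal
  family whose span is stable under \<open>t\<close> and nondegenerate splits off, so it suffices to find enough
  standard families.  On the free part the isometry class is governed by two Frobenius-semilinear
  functions, \<open>N(u) = \<beta>(u, u)\<close> and \<open>D(u) = \<beta>(u, t u)\<close>, which are squares of linear functionals
  \<open>\<beta>(\<cdot>, t s)\<close> and \<open>\<beta>(\<cdot>, t d)\<close>.  The cases are: \<open>D = N = 0\<close>; \<open>D = 0 \<noteq> N\<close>, where \<open>s\<close> is used as a basis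
  vector of the exceptional summand; \<open>N = y D\<close>, where an orthonormal basis for \<open>\<beta>(u, t v)\<close> is enough;
  and \<open>N, D\<close> linearly independent, where one first splits off two vectors \<open>e\<^sub>1, e\<^sub>2\<close> with
  \<open>s = c e\<^sub>1 + e\<^sub>2\<close> modulo \<open>ker t\<close>, so that \<open>N\<close> vanishes on the complement.  What remains at the end has
  \<open>t = 0\<close> and is a sum of hyperbolic planes.
\<close>

section \<open>Linear maps and tensors\<close>

text \<open>The obstacle is that in characteristic 2 an alternating form has no orthogonal basis.
  Here this concerns the form \<open>\<beta>(u, t v)\<close>, whose diagonal is \<open>D\<close>:
  splitting off copies of \<open>P\<close> greedily can leave a complement on which \<open>D\<close>
  vanishes but \<open>t\<close> does not. In that event the last choice is altered by a vector
  \<open>u\<close> of that complement with \<open>t u \<noteq> 0\<close>, and a vector with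
  \<open>D \<noteq> 0\<close> in the new complement is written down. In the mixed case the
  alteration must keep \<open>s\<close> in the span of \<open>e1\<close> and \<open>e2\<close>
  modulo \<open>ker t\<close>, so \<open>e1\<close> is recomputed from the new \<open>e2\<close>;
  the vector found has \<open>D\<close> equal to \<open>1/c\<^sup>2 + 1\<close>, which is nonzero
  because \<open>c = 1\<close> would give \<open>N = D\<close>. \<open>N\<close> and
  \<open>D\<close> are additive because their cross terms occur twice. Both vanish on
  \<open>ker t\<close>, so their square roots are functionals that factor through \<open>t\<close>,
  which is why they are represented by vectors \<open>t s\<close> and \<open>t d\<close>. That
  \<open>m\<close> is even comes only at the end, from comparing dimensions and ranks of
  \<open>t\<close>.\<close>

abbreviation unit_vec :: "'j \<Rightarrow> 'j \<Rightarrow> 'k::field"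
  where "unit_vec j \<equiv> (\<lambda>i. of_bool (i = j))"

lemma sum_fun_apply: "sum f A x = (\<Sum>a\<in>A. f a x)"
  by (induction A rule: infinite_finite_induct) auto

lemma fscale_apply [simp]: "fscale a u i = a * u i"
  by (simp add: fscale_def)

lemma linear_map_onD:
  assumes "linear_map_on S S' f"
  shows "u \<in> S \<Longrightarrow> f u \<in> S'" "u \<in> S \<Longrightarrow> v \<in> S \<Longrightarrow> f (u + v) = f u + f v"
    "u \<in> S \<Longrightarrow> f (fscale a u) = fscale a (f u)"
  using assms by (auto simp: linear_map_on_def)

lemma linear_map_on_comp:
  assumes "linear_map_on S S' f" "linear_map_on S' S'' g"
  shows "linear_map_on S S'' (\<lambda>u. g (f u))"
  using assms by (auto simp: linear_map_on_def)

lemma linear_map_on_add: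
  assumes "linear_map_on S UNIV f" "linear_map_on S UNIV g"
  shows "linear_map_on S UNIV (\<lambda>u. f u + g u)"
  using assms by (auto simp: linear_map_on_def fun_eq_iff algebra_simps)

lemma linear_map_on_diff:
  assumes "linear_map_on S UNIV f" "linear_map_on S UNIV g"
  shows "linear_map_on S UNIV (\<lambda>u. f u - g u)"
  using assms by (auto simp: linear_map_on_def fun_eq_iff algebra_simps)

lemma linear_map_on_mono:
  assumes "linear_map_on S S' f" "R \<subseteq> S" "\<And>u. u \<in> R \<Longrightarrow> f u \<in> R'"
  shows "linear_map_on R R' f"
  using assms by (auto simp: linear_map_on_def subset_iff)

lemma linear_map_on_UNIV: "linear_map_on S S' f \<Longrightarrow> linear_map_on S UNIV f"
  by (auto simp: linear_map_on_def)

lemma linear_map_on_0: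
  assumes "linear_map_on S S' f" "fs.subspace S"
  shows "f 0 = 0"
proof -
  have "f (fscale 0 0) = fscale 0 (f 0)"
    using linear_map_onD(3)[OF assms(1) fs.subspace_0[OF assms(2)]] .
  then show ?thesis by simp
qed

lemma linear_map_on_minus:
  assumes "linear_map_on S S' f" "fs.subspace S" "u \<in> S" "v \<in> S"
  shows "f (u - v) = f u - f v"
proof -
  have "f (u - v) + f v = f (u - v + v)"
    using linear_map_onD(2)[OF assms(1) fs.subspace_diff[OF assms(2-4)] assms(4)] by simp
  then show ?thesis by (simp add: algebra_simps)
qed

lemma linear_map_on_sum:
  assumes "linear_map_on S S' f" "fs.subspace S" "\<And>j. j \<in> J \<Longrightarrow> b j \<in> S"
  shows "f (\<Sum>j\<in>J. fscale (z j) (b j)) = (\<Sum>j\<in>J. fscale (z j) (f (b j)))"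
  using assms(3)
proof (induction J rule: infinite_finite_induct)
  case (insert j J)
  have IH: "f (\<Sum>j\<in>J. fscale (z j) (b j)) = (\<Sum>j\<in>J. fscale (z j) (f (b j)))"
    using insert by blast
  have "(\<Sum>j\<in>J. fscale (z j) (b j)) \<in> S"
    using insert assms(2) by (intro fs.subspace_sum) (auto intro: fs.subspace_scale)
  moreover have "b j \<in> S" "fscale (z j) (b j) \<in> S"
    using insert assms(2) by (auto intro: fs.subspace_scale)
  ultimately have "f (fscale (z j) (b j) + (\<Sum>j\<in>J. fscale (z j) (b j)))
      = fscale (z j) (f (b j)) + (\<Sum>j\<in>J. fscale (z j) (f (b j)))"
    using IH linear_map_onD(2,3)[OF assms(1)] by metis
  then show "f (\<Sum>j\<in>insert j J. fscale (z j) (b j)) = (\<Sum>j\<in>insert j J. fscale (z j) (f (b j)))"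
    unfolding sum.insert[OF insert(1,2)] .
qed (use assms linear_map_on_0 in auto)

lemma linear_map_on_span_eq:
  assumes "linear_map_on (fs.span G) UNIV f" "linear_map_on (fs.span G) UNIV g"
    and "\<And>u. u \<in> G \<Longrightarrow> f u = g u" "u \<in> fs.span G"
  shows "f u = g u"
proof -
  have "fs.span G \<subseteq> {u \<in> fs.span G. f u = g u}"
    using assms(3) linear_map_onD[OF assms(1)] linear_map_onD[OF assms(2)]
      linear_map_on_0[OF assms(1) fs.subspace_span] linear_map_on_0[OF assms(2) fs.subspace_span]
    by (intro fs.span_minimal fs.subspaceI)
       (auto intro: fs.span_base fs.span_zero fs.span_add fs.span_scale)
  then show ?thesis using assms(4) by blast
qed

lemma linear_map_on_span_into:
  assumes "linear_map_on (fs.span G) UNIV f" "\<And>u. u \<in> G \<Longrightarrow> f u \<in> T" "fs.subspace T"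
  shows "linear_map_on (fs.span G) T f"
proof (rule linear_map_on_mono[OF assms(1) order_refl])
  have "fs.span G \<subseteq> {u \<in> fs.span G. f u \<in> T}"
    using assms(2) linear_map_onD[OF assms(1)] linear_map_on_0[OF assms(1) fs.subspace_span]
      fs.subspace_0[OF assms(3)] fs.subspace_add[OF assms(3)] fs.subspace_scale[OF assms(3)]
    by (intro fs.span_minimal fs.subspaceI)
       (auto intro: fs.span_base fs.span_zero fs.span_add fs.span_scale)
  then show "f u \<in> T" if "u \<in> fs.span G" for u using that by blast
qed

section \<open>Tensor products as spans of pure tensors\<close>

lemma tensor_add_left: "tensor (u + u') v = tensor u v + tensor u' v"
  and tensor_add_right: "tensor u (v + v') = tensor u v + tensor u v'"
  and tensor_scale_left: "tensor (fscale a u) v = fscale a (tensor u v)"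
  and tensor_scale_right: "tensor u (fscale a v) = fscale a (tensor u v)"
  and tensor_0_left [simp]: "tensor 0 v = 0"
  and tensor_0_right [simp]: "tensor u 0 = 0"
  by (auto simp: tensor_def fun_eq_iff algebra_simps)

lemma subspace_tprod: "fs.subspace (car (tprod U V))"
  by (simp add: tprod_def fs.subspace_span)

lemma tensor_in_tprod: "u \<in> car U \<Longrightarrow> v \<in> car V \<Longrightarrow> tensor u v \<in> car (tprod U V)"
  by (auto simp: tprod_def intro!: fs.span_base)

lemma tprod_ext:
  assumes "linear_map_on (car (tprod U V)) S f" "linear_map_on (car (tprod U V)) S' g"
    and "\<And>u v. u \<in> car U \<Longrightarrow> v \<in> car V \<Longrightarrow> f (tensor u v) = g (tensor u v)"
    and "Z \<in> car (tprod U V)"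
  shows "f Z = g Z"
  using assms(4) unfolding tprod_def tmod.simps
  by (rule linear_map_on_span_eq[rotated 3])
     (use assms(1,2,3) in \<open>auto simp: tprod_def intro: linear_map_on_UNIV\<close>)

lemma tprod_into:
  assumes "linear_map_on (car (tprod U V)) S f" "fs.subspace T"
    and "\<And>u v. u \<in> car U \<Longrightarrow> v \<in> car V \<Longrightarrow> f (tensor u v) \<in> T"
  shows "linear_map_on (car (tprod U V)) T f"
  unfolding tprod_def tmod.simps
  by (rule linear_map_on_span_into)
     (use assms in \<open>auto simp: tprod_def intro: linear_map_on_UNIV\<close>)

text \<open>\<open>tensor_map\<close> applies \<open>f\<close> and \<open>g\<close> to slices, while
  their linearity is available only on the carriers. Linearity of \<open>tensor_map f g\<close>
  therefore needs all slices, before and after \<open>f\<close>, to stay in the carriers.\<close>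

lemma tprod_slices:
  assumes f: "linear_map_on (car U) S' f" and U: "fs.subspace (car U)" and V: "fs.subspace (car V)"
    and "Z \<in> car (tprod U V)"
  shows "(\<forall>j. (\<lambda>i. Z (i, j)) \<in> car U) \<and> (\<forall>a. (\<lambda>j. f (\<lambda>i. Z (i, j)) a) \<in> car V)"
  using assms(4) unfolding tprod_def tmod.simps
proof (induction rule: fs.span_induct_alt)
  case base
  have "(\<lambda>_. 0) \<in> car U" "(\<lambda>_. 0) \<in> car V" "f (\<lambda>_. 0) = (\<lambda>_. 0)"
    using fs.subspace_0[OF U] fs.subspace_0[OF V] linear_map_on_0[OF f U]
    by (auto simp: zero_fun_def)
  then show ?case by auto
next
  case (step c x y)
  then obtain u v where x: "x = tensor u v" "u \<in> car U" "v \<in> car V" by auto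
  have eq: "(\<lambda>i. (fscale c x + y) (i, j)) = fscale (c * v j) u + (\<lambda>i. y (i, j))" for j
    by (auto simp: x tensor_def)
  have sc: "fscale (c * v j) u \<in> car U" for j
    using x U fs.subspace_scale by blast
  have "f (\<lambda>i. (fscale c x + y) (i, j)) = fscale (c * v j) (f u) + f (\<lambda>i. y (i, j))" for j
    unfolding eq using step.IH sc x f by (auto simp: linear_map_on_def)
  then have "(\<lambda>j. f (\<lambda>i. (fscale c x + y) (i, j)) a)
      = fscale (c * f u a) v + (\<lambda>j. f (\<lambda>i. y (i, j)) a)" for a
    by (auto simp: fun_eq_iff)
  then show ?case
    using step.IH sc x fs.subspace_add[OF U] fs.subspace_add[OF V] fs.subspace_scale[OF V]
    unfolding eq by simp
qed

lemma tensor_map_linear: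
  assumes f: "linear_map_on (car U) (car U') f" and g: "linear_map_on (car V) (car V') g"
    and U: "fs.subspace (car U)" and V: "fs.subspace (car V)"
  shows "linear_map_on (car (tprod U V)) (car (tprod U' V')) (tensor_map f g)"
proof (rule tprod_into[OF _ subspace_tprod])
  show "linear_map_on (car (tprod U V)) UNIV (tensor_map f g)"
    unfolding linear_map_on_def
  proof (intro conjI ballI allI)
    fix Y Z assume Y: "Y \<in> car (tprod U V)" and Z: "Z \<in> car (tprod U V)"
    note sY = tprod_slices[OF f U V Y] and sZ = tprod_slices[OF f U V Z]
    have "f (\<lambda>i. (Y + Z) (i, j)) = f (\<lambda>i. Y (i, j)) + f (\<lambda>i. Z (i, j))" for j
      using sY sZ f by (auto simp: linear_map_on_def plus_fun_def)
    then have 1: "(\<lambda>j. f (\<lambda>i. (Y + Z) (i, j)) a)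
        = (\<lambda>j. f (\<lambda>i. Y (i, j)) a) + (\<lambda>j. f (\<lambda>i. Z (i, j)) a)" for a
      by auto
    have "g (\<lambda>j. f (\<lambda>i. (Y + Z) (i, j)) a)
        = g (\<lambda>j. f (\<lambda>i. Y (i, j)) a) + g (\<lambda>j. f (\<lambda>i. Z (i, j)) a)" for a
      unfolding 1 using sY sZ g by (auto simp: linear_map_on_def)
    then show "tensor_map f g (Y + Z) = tensor_map f g Y + tensor_map f g Z"
      by (auto simp: tensor_map_def)
  next
    fix a Y assume Y: "Y \<in> car (tprod U V)"
    note sY = tprod_slices[OF f U V Y]
    have "f (fscale a (\<lambda>i. Y (i, j))) = fscale a (f (\<lambda>i. Y (i, j)))" for j
      using sY f by (auto simp: linear_map_on_def)
    then have 1: "(\<lambda>j. f (\<lambda>i. fscale a Y (i, j)) b) = fscale a (\<lambda>j. f (\<lambda>i. Y (i, j)) b)" for b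
      by (auto simp: fscale_def)
    have "g (\<lambda>j. f (\<lambda>i. fscale a Y (i, j)) b) = fscale a (g (\<lambda>j. f (\<lambda>i. Y (i, j)) b))" for b
      unfolding 1 using sY g by (auto simp: linear_map_on_def)
    then show "tensor_map f g (fscale a Y) = fscale a (tensor_map f g Y)"
      by (auto simp: tensor_map_def fun_eq_iff)
  qed auto
next
  fix u v assume "u \<in> car U" "v \<in> car V"
  then show "tensor_map f g (tensor u v) \<in> car (tprod U' V')"
    using f g by (auto simp: tensor_map_tensor linear_map_on_def intro!: tensor_in_tprod)
qed

lemma linear_map_on_id: "linear_map_on S S id" "linear_map_on S S (\<lambda>u. u)"
  by (auto simp: linear_map_on_def)

lemma ver4_objectD:
  assumes "ver4_object U"
  shows "fs.subspace (car U)" "linear_map_on (car U) (car U) (act U)"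
    "\<And>u. u \<in> car U \<Longrightarrow> act U u \<in> car U" "\<And>u. u \<in> car U \<Longrightarrow> act U (act U u) = 0"
  using assms by (auto simp: ver4_object_def linear_map_on_def)

lemma linear_flip: "linear_map_on S UNIV (\<lambda>Z (j, i). Z (i, j))"
  by (auto simp: linear_map_on_def fun_eq_iff)

lemma braiding_linear:
  assumes "ver4_object U" "ver4_object V"
  shows "linear_map_on (car (tprod U V)) (car (tprod V U)) (braiding U V)"
proof (rule tprod_into[OF _ subspace_tprod])
  note U = ver4_objectD[OF assms(1)] and V = ver4_objectD[OF assms(2)]
  have "linear_map_on (car (tprod U V)) UNIV (\<lambda>Z. Z + tensor_map (act U) (act V) Z)"
    by (intro linear_map_on_add linear_map_on_UNIV[OF linear_map_on_id(2)]
        linear_map_on_UNIV[OF tensor_map_linear[OF U(2) V(2) U(1) V(1)]])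
  then show "linear_map_on (car (tprod U V)) UNIV (braiding U V)"
    unfolding braiding_def by (rule linear_map_on_comp[OF _ linear_flip])
  show "braiding U V (tensor u v) \<in> car (tprod V U)" if "u \<in> car U" "v \<in> car V" for u v
    using that U V
    by (auto simp: braiding_tensor[OF assms] intro!: fs.subspace_add[OF subspace_tprod] tensor_in_tprod)
qed

text \<open>Both maps are linear, so pure tensors suffice; there the term
  \<open>t v \<otimes> t u\<close> is respected because \<open>f\<close> and \<open>g\<close>
  commute with \<open>t\<close>.\<close>

lemma braiding_natural:
  assumes obj: "ver4_object U" "ver4_object V" "ver4_object U'" "ver4_object V'"
    and f: "morphism U U' f" and g: "morphism V V' g" and Z: "Z \<in> car (tprod U V)"
  shows "tensor_map g f (braiding U V Z) = braiding U' V' (tensor_map f g Z)"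
proof (rule tprod_ext[OF _ _ _ Z])
  note sub = obj[THEN ver4_objectD(1)]
  have lf: "linear_map_on (car U) (car U') f" and lg: "linear_map_on (car V) (car V') g"
    using f g by (auto simp: morphism_def)
  show "linear_map_on (car (tprod U V)) (car (tprod V' U')) (\<lambda>Z. tensor_map g f (braiding U V Z))"
    by (rule linear_map_on_comp[OF braiding_linear tensor_map_linear]) (use sub obj lf lg in auto)
  show "linear_map_on (car (tprod U V)) (car (tprod V' U')) (\<lambda>Z. braiding U' V' (tensor_map f g Z))"
    by (rule linear_map_on_comp[OF tensor_map_linear braiding_linear]) (use sub obj lf lg in auto)
  fix u v assume u: "u \<in> car U" and v: "v \<in> car V"
  then have tu: "act U u \<in> car U" and tv: "act V v \<in> car V"
    using obj ver4_objectD by auto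
  have "f u \<in> car U'" "g v \<in> car V'"
    using u v lf lg by (auto simp: linear_map_on_def)
  moreover have "tensor_map g f (braiding U V (tensor u v))
      = tensor_map g f (tensor v u) + tensor_map g f (tensor (act V v) (act U u))"
    using linear_map_onD(2)[OF tensor_map_linear[OF lg lf sub(2,1)]] u v tu tv
    by (simp add: braiding_tensor[OF obj(1,2)] tensor_in_tprod)
  ultimately show "tensor_map g f (braiding U V (tensor u v)) = braiding U' V' (tensor_map f g (tensor u v))"
    using u v tu tv f g
    by (auto simp: tensor_map_tensor[OF lg lf] tensor_map_tensor[OF lf lg] braiding_tensor[OF obj(3,4)] morphism_def)
qed

lemma tensor_map_comp:
  fixes U :: "('i, 'k::field) tmod" and U' :: "('j, 'k) tmod" and U'' :: "('l, 'k) tmod"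
    and V :: "('a, 'k) tmod" and V' :: "('b, 'k) tmod" and V'' :: "('c, 'k) tmod"
  assumes f: "linear_map_on (car U) (car U') f" and f': "linear_map_on (car U') (car U'') f'"
    and g: "linear_map_on (car V) (car V') g" and g': "linear_map_on (car V') (car V'') g'"
    and sub: "fs.subspace (car U)" "fs.subspace (car V)" "fs.subspace (car U')" "fs.subspace (car V')"
    and Z: "Z \<in> car (tprod U V)"
  shows "tensor_map f' g' (tensor_map f g Z) = tensor_map (\<lambda>u. f' (f u)) (\<lambda>v. g' (g v)) Z"
proof (rule tprod_ext[OF _ _ _ Z])
  note ff = linear_map_on_comp[OF f f'] and gg = linear_map_on_comp[OF g g']
  show "linear_map_on (car (tprod U V)) (car (tprod U'' V'')) (\<lambda>Z. tensor_map f' g' (tensor_map f g Z))"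
    by (rule linear_map_on_comp[OF tensor_map_linear tensor_map_linear]) (use assms in auto)
  show "linear_map_on (car (tprod U V)) (car (tprod U'' V'')) (tensor_map (\<lambda>u. f' (f u)) (\<lambda>v. g' (g v)))"
    by (rule tensor_map_linear) (use ff gg sub in auto)
  fix u v assume u: "u \<in> car U" and v: "v \<in> car V"
  then have "f u \<in> car U'" "g v \<in> car V'"
    using f g by (auto simp: linear_map_on_def)
  then show "tensor_map f' g' (tensor_map f g (tensor u v)) = tensor_map (\<lambda>u. f' (f u)) (\<lambda>v. g' (g v)) (tensor u v)"
    using u v by (simp add: tensor_map_tensor[OF f g] tensor_map_tensor[OF f' g'] tensor_map_tensor[OF ff gg])
qed

lemma tensor_map_ident:
  assumes f: "linear_map_on (car U) (car U) f" and sub: "fs.subspace (car U)"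
    and id: "\<And>u. u \<in> car U \<Longrightarrow> f u = u" and Z: "Z \<in> car (tprod U U)"
  shows "tensor_map f f Z = Z"
  by (rule tprod_ext[OF tensor_map_linear[OF f f sub sub] linear_map_on_id(2) _ Z])
     (simp add: tensor_map_tensor[OF f f] id)

lemma Gamma2_iff: "Z \<in> car (Gamma2 U) \<longleftrightarrow> Z \<in> car (tprod U U) \<and> braiding U U Z = Z"
  by (auto simp: Gamma2_def)

lemma subspace_Gamma2:
  assumes "ver4_object U"
  shows "fs.subspace (car (Gamma2 U))"
  unfolding fs.subspace_def
  using fs.subspace_add[OF subspace_tprod] fs.subspace_scale[OF subspace_tprod]
    fs.subspace_0[OF subspace_tprod] linear_map_onD(2,3)[OF braiding_linear[OF assms assms]]
    linear_map_on_0[OF braiding_linear[OF assms assms] subspace_tprod]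
  by (auto simp: Gamma2_iff)

lemma tensor_map_Gamma2:
  assumes "ver4_object U" "ver4_object V" "morphism U V f" "Z \<in> car (Gamma2 U)"
  shows "tensor_map f f Z \<in> car (Gamma2 V)"
proof -
  have "linear_map_on (car (tprod U U)) (car (tprod V V)) (tensor_map f f)"
    using assms ver4_objectD by (intro tensor_map_linear) (auto simp: morphism_def)
  from linear_map_onD(1)[OF this] show ?thesis
    using braiding_natural[OF assms(1,1,2,2) assms(3,3), of Z] assms(4)
    by (simp add: Gamma2_iff)
qed


section \<open>The square \<open>\<Gamma>\<^sup>2\<close> in coordinates\<close>

lemma char2_self_add: "CHAR('k::field) = 2 \<Longrightarrow> x + x = (0::'k)"
  using minus_CHAR_2[of x x] by simp

lemma char2_fun_self_add: "CHAR('k::field) = 2 \<Longrightarrow> f + f = (0 :: 'i \<Rightarrow> 'k)"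
  by (rule ext) (simp only: plus_fun_apply zero_fun_apply char2_self_add)

lemma char2_fun_minus: "CHAR('k::field) = 2 \<Longrightarrow> f - g = (f + g :: 'i \<Rightarrow> 'k)"
  by (auto simp: fun_eq_iff minus_CHAR_2)

text \<open>On \<open>u \<otimes> v\<close> a second application of \<open>c\<close> yields
  \<open>t u \<otimes> t v\<close> twice, which cancels in characteristic 2; the remaining term
  vanishes by \<open>t (t u) = 0\<close>.\<close>

lemma braiding_involutive:
  fixes U :: "('i, 'k::field) tmod"
  assumes char: "CHAR('k) = 2" and U: "ver4_object U" and Z: "Z \<in> car (tprod U U)"
  shows "braiding U U (braiding U U Z) = Z"
proof (rule tprod_ext[OF linear_map_on_comp[OF braiding_linear[OF U U] braiding_linear[OF U U]]
      linear_map_on_id(2) _ Z])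
  fix u v assume u: "u \<in> car U" and v: "v \<in> car U"
  note D = ver4_objectD[OF U]
  have "braiding U U (tensor v u + tensor (act U v) (act U u))
      = braiding U U (tensor v u) + braiding U U (tensor (act U v) (act U u))"
    by (intro linear_map_onD(2)[OF braiding_linear[OF U U]] tensor_in_tprod D u v)
  also have "\<dots> = tensor u v + (tensor (act U u) (act U v) + tensor (act U u) (act U v))"
    using u v D by (simp add: braiding_tensor[OF U U] add.assoc)
  finally show "braiding U U (braiding U U (tensor u v)) = tensor u v"
    unfolding braiding_tensor[OF U U u v] char2_fun_self_add[OF char] by simp
qed

lemma one_minus_braiding_in_Gamma2:
  fixes U :: "('i, 'k::field) tmod"
  assumes char: "CHAR('k) = 2" and U: "ver4_object U" and Z: "Z \<in> car (tprod U U)"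
  shows "Z - braiding U U Z \<in> car (Gamma2 U)"
proof -
  note lin = braiding_linear[OF U U]
  have c: "braiding U U Z \<in> car (tprod U U)"
    using linear_map_onD(1)[OF lin Z] .
  then have "Z - braiding U U Z \<in> car (tprod U U)"
    using fs.subspace_diff[OF subspace_tprod Z] by blast
  moreover have "braiding U U (Z - braiding U U Z) = braiding U U Z - Z"
    using linear_map_on_minus[OF lin subspace_tprod Z c] braiding_involutive[OF char U Z] by simp
  ultimately show ?thesis
    by (simp add: Gamma2_iff char2_fun_minus[OF char] add.commute)
qed

lemma one_minus_braiding_linear:
  fixes U :: "('i, 'k::field) tmod"
  assumes char: "CHAR('k) = 2" and U: "ver4_object U"
  shows "linear_map_on (car (tprod U U)) (car (Gamma2 U)) (\<lambda>Z. Z - braiding U U Z)"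
  by (rule linear_map_on_mono[OF linear_map_on_diff[OF linear_map_on_UNIV[OF linear_map_on_id(2)]
        linear_map_on_UNIV[OF braiding_linear[OF U U]]] order_refl
        one_minus_braiding_in_Gamma2[OF char U]])

text \<open>The coordinate space with basis \<open>S\<close>. A support condition is used because
  index types such as \<open>nat \<times> pidx\<close> are larger than the basis they carry.\<close>

definition supp_space :: "'j set \<Rightarrow> ('j \<Rightarrow> 'k::field) set"
  where "supp_space S = {z. \<forall>j. j \<notin> S \<longrightarrow> z j = 0}"

lemma subspace_supp_space: "fs.subspace (supp_space S)"
  by (auto simp: fs.subspace_def supp_space_def)

lemma unit_vec_in_supp: "j \<in> S \<Longrightarrow> unit_vec j \<in> supp_space S"
  by (auto simp: supp_space_def)

lemma supp_space_expand:
  assumes "finite S" "z \<in> supp_space S"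
  shows "z = (\<Sum>j\<in>S. fscale (z j) (unit_vec j))"
proof
  fix i
  have "(\<Sum>j\<in>S. z j * of_bool (i = j)) = (\<Sum>j\<in>S. if j = i then z j else 0)"
    by (rule sum.cong) auto
  then show "z i = (\<Sum>j\<in>S. fscale (z j) (unit_vec j)) i"
    using assms by (auto simp: sum_fun_apply supp_space_def)
qed

lemma supp_space_span:
  assumes "finite S"
  shows "supp_space S = fs.span (unit_vec ` S :: ('j \<Rightarrow> 'k::field) set)"
proof (intro equalityI subsetI)
  fix z :: "'j \<Rightarrow> 'k" assume "z \<in> supp_space S"
  then have "z = (\<Sum>j\<in>S. fscale (z j) (unit_vec j))"
    by (rule supp_space_expand[OF assms])
  also have "\<dots> \<in> fs.span (unit_vec ` S)"
    by (intro fs.span_sum fs.span_scale fs.span_base) auto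
  finally show "z \<in> fs.span (unit_vec ` S)" .
next
  have "fs.span (unit_vec ` S :: ('j \<Rightarrow> 'k) set) \<subseteq> supp_space S"
    by (rule fs.span_minimal[OF _ subspace_supp_space]) (auto simp: supp_space_def)
  then show "z \<in> supp_space S" if "z \<in> fs.span (unit_vec ` S)" for z :: "'j \<Rightarrow> 'k"
    using that by blast
qed

lemma tensor_unit_vec: "tensor (unit_vec i) (unit_vec j) = unit_vec (i, j)"
  by (auto simp: tensor_def fun_eq_iff)

text \<open>
  \<open>S\<close> indexes the basis, and \<open>t\<close> maps the basis vector \<open>p j\<close> to the basis vector \<open>j\<close> for
  \<open>j \<in> X\<close> and kills all basis vectors outside \<open>p ` X\<close>.
\<close>

definition coord :: "('j, 'k::field) tmod \<Rightarrow> 'j set \<Rightarrow> 'j set \<Rightarrow> ('j \<Rightarrow> 'j) \<Rightarrow> bool"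
  where "coord C S X p \<longleftrightarrow> finite S \<and> X \<subseteq> S \<and> p ` X \<subseteq> S - X \<and> inj_on p X \<and>
    car C = supp_space S \<and>
    (\<forall>z\<in>car C. act C z = (\<lambda>j. if j \<in> X then z (p j) else 0))"

lemma coordD:
  assumes "coord C S X p"
  shows "finite S" "X \<subseteq> S" "p ` X \<subseteq> S - X" "inj_on p X" "car C = supp_space S"
    "\<And>z. z \<in> supp_space S \<Longrightarrow> act C z = (\<lambda>j. if j \<in> X then z (p j) else 0)"
  using assms by (auto simp: coord_def)

lemma coord_ver4_object:
  assumes "coord C S X p"
  shows "ver4_object C"
proof -
  note C = coordD[OF assms]
  have "fs.span (unit_vec ` S) = car C"
    using supp_space_span[OF C(1)] C(5) by metis
  moreover have "linear_map_on (car C) (car C) (act C)"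
    using C fs.subspace_add[OF subspace_supp_space, of _ S] fs.subspace_scale[OF subspace_supp_space, of _ S]
    by (auto simp: linear_map_on_def fun_eq_iff) (auto simp: supp_space_def)
  moreover have "act C (act C u) = 0" if "u \<in> car C" for u
  proof -
    have "act C u \<in> car C" using linear_map_onD(1)[OF calculation(2) that] .
    then have "act C (act C u) = (\<lambda>j. if j \<in> X then act C u (p j) else 0)"
      by (rule C(6)[folded C(5)])
    also have "\<dots> = 0"
      unfolding C(6)[folded C(5), OF that] using C(3) by (auto simp: fun_eq_iff)
    finally show ?thesis .
  qed
  moreover have "fs.subspace (car C)"
    by (simp add: C(5) subspace_supp_space)
  moreover have "finite (unit_vec ` S)"
    using C(1) by blast
  ultimately show ?thesis
    unfolding ver4_object_def by blast
qed

lemma car_tprod_coord: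
  assumes "coord C S X p"
  shows "car (tprod C C) = supp_space (S \<times> S)"
proof (intro equalityI subsetI)
  note C = coordD[OF assms]
  fix Z assume "Z \<in> car (tprod C C)"
  moreover have "{tensor u v |u v. u \<in> car C \<and> v \<in> car C} \<subseteq> supp_space (S \<times> S)"
    by (auto simp: C(5) supp_space_def tensor_def)
  ultimately show "Z \<in> supp_space (S \<times> S)"
    using fs.span_minimal[OF _ subspace_supp_space] unfolding tprod_def tmod.simps by blast
next
  note C = coordD[OF assms]
  fix Z :: "'a \<times> 'a \<Rightarrow> 'b" assume "Z \<in> supp_space (S \<times> S)"
  then have "Z = (\<Sum>j\<in>S\<times>S. fscale (Z j) (unit_vec j))"
    by (intro supp_space_expand finite_cartesian_product C(1))
  also have "\<dots> \<in> car (tprod C C)"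
  proof (intro fs.subspace_sum[OF subspace_tprod] fs.subspace_scale[OF subspace_tprod])
    fix j assume "j \<in> S \<times> S"
    then have "tensor (unit_vec (fst j)) (unit_vec (snd j)) \<in> car (tprod C C)"
      by (intro tensor_in_tprod) (auto simp: C(5) supp_space_def)
    then show "(unit_vec j :: _ \<Rightarrow> 'b) \<in> car (tprod C C)"
      by (simp add: tensor_unit_vec)
  qed
  finally show "Z \<in> car (tprod C C)" .
qed

lemma
  assumes "coord C S X p" "Z \<in> supp_space (S \<times> S)"
  shows braiding_coord: "braiding C C Z (a, b) = Z (b, a) + (if a \<in> X \<and> b \<in> X then Z (p b, p a) else 0)"
    and act_tprod_coord: "act (tprod C C) Z (a, b)
      = (if a \<in> X then Z (p a, b) else 0) + (if b \<in> X then Z (a, p b) else 0)"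
proof -
  note C = coordD[OF assms(1)]
  have 1: "act C (\<lambda>i. Z (i, j)) = (\<lambda>i. if i \<in> X then Z (p i, j) else 0)" for j
    by (rule C(6)) (use assms(2) in \<open>auto simp: supp_space_def\<close>)
  have 2: "act C (\<lambda>j. Z (i, j)) = (\<lambda>j. if j \<in> X then Z (i, p j) else 0)" for i
    by (rule C(6)) (use assms(2) in \<open>auto simp: supp_space_def\<close>)
  have 3: "act C (\<lambda>j. if i \<in> X then Z (p i, j) else 0) = (\<lambda>j. if j \<in> X \<and> i \<in> X then Z (p i, p j) else 0)" for i
    by (subst C(6)) (use assms(2) in \<open>auto simp: supp_space_def\<close>)
  show "braiding C C Z (a, b) = Z (b, a) + (if a \<in> X \<and> b \<in> X then Z (p b, p a) else 0)"
    by (simp add: braiding_def tensor_map_def 1 3)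
  show "act (tprod C C) Z (a, b)
      = (if a \<in> X then Z (p a, b) else 0) + (if b \<in> X then Z (a, p b) else 0)"
    by (simp add: tprod_def tensor_map_def 1 2)
qed

text \<open>For \<open>a = b\<close> in \<open>X\<close> the condition reads
  \<open>Z (p a, p a) = 0\<close>. Diagonal entries are thus free only at basis vectors killed by
  \<open>t\<close>.\<close>

lemma Gamma2_coord:
  assumes "coord C S X p"
  shows "Z \<in> car (Gamma2 C) \<longleftrightarrow> Z \<in> supp_space (S \<times> S) \<and>
    (\<forall>a b. Z (b, a) + (if a \<in> X \<and> b \<in> X then Z (p b, p a) else 0) = Z (a, b))"
  (is "_ \<longleftrightarrow> _ \<and> ?sym")
proof -
  have "braiding C C Z = Z \<longleftrightarrow> (\<forall>a b. braiding C C Z (a, b) = Z (a, b))"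
    by (auto simp: fun_eq_iff)
  then have "braiding C C Z = Z \<longleftrightarrow> ?sym" if "Z \<in> supp_space (S \<times> S)"
    by (simp only: braiding_coord[OF assms that])
  then show ?thesis
    unfolding Gamma2_iff car_tprod_coord[OF assms] by blast
qed

text \<open>Number \<open>S\<close> arbitrarily below \<open>N\<close>, then renumber each
  \<open>p i\<close> as \<open>N\<close> plus the number of \<open>i\<close>. The images of
  \<open>p\<close> come after everything else, in the order of their preimages.\<close>

lemma coord_ordering:
  assumes "coord C S X p"
  obtains e :: "'j \<Rightarrow> nat" where "inj_on e S" "\<And>i j. i \<in> X \<Longrightarrow> j \<in> X \<Longrightarrow> e i < e j \<Longrightarrow> e (p i) < e (p j)"
proof -
  note C = coordD[OF assms]
  obtain e0 :: "'j \<Rightarrow> nat" and N where e0: "inj_on e0 S" "e0 ` S = {i. i < N}"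
    using finite_imp_inj_to_nat_seg[OF C(1)] by auto
  define e where "e j = (if j \<in> p ` X then N + e0 (inv_into X p j) else e0 j)" for j
  have less: "e0 j < N" if "j \<in> S" for j
    using e0(2) that by auto
  have 1: "e i = e0 i" "e (p i) = N + e0 i" if "i \<in> X" for i
    using that C(3,4) by (auto simp: e_def)
  have "inj_on e S"
  proof (rule inj_onI)
    fix i j assume ij: "i \<in> S" "j \<in> S" "e i = e j"
    show "i = j"
    proof (cases "i \<in> p ` X")
      case True
      then obtain k where k: "i = p k" "k \<in> X" by auto
      then have "\<not> e j < N" using ij 1 by auto
      then have "j \<in> p ` X" using ij(2) less by (auto simp: e_def split: if_splits)
      then obtain l where l: "j = p l" "l \<in> X" by auto
      then have "e0 k = e0 l" using k ij 1 by simp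
      then show ?thesis using k l inj_onD[OF e0(1)] C(2) by blast
    next
      case False
      then have "e i < N" using less[OF ij(1)] by (simp add: e_def)
      then have "e j < N" using ij(3) by simp
      then have "j \<notin> p ` X" by (auto simp: e_def)
      then show ?thesis using False ij e0(1) by (auto simp: e_def inj_on_def)
    qed
  qed
  then show ?thesis using that[of e] 1 by auto
qed

text \<open>
  Subtracting \<open>(1 - c) Y\<close>, where \<open>Y\<close> is the strictly upper triangular part of \<open>Z\<close>, leaves a
  diagonal tensor.  This uses an ordering of the basis that is compatible with \<open>p\<close>.
\<close>

lemma Gamma2_coord_eq_zero:
  fixes C :: "('j, 'k::field) tmod"
  assumes char: "CHAR('k) = 2" and coord: "coord C S X p"
    and f: "linear_map_on (car (Gamma2 C)) T f"
    and f1: "\<And>i j. i \<in> S \<Longrightarrow> j \<in> S \<Longrightarrow> f (unit_vec (i, j) - braiding C C (unit_vec (i, j))) = 0"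
    and f2: "\<And>j. j \<in> S - p ` X \<Longrightarrow> f (unit_vec (j, j)) = 0"
    and Z: "Z \<in> car (Gamma2 C)"
  shows "f Z = 0"
proof -
  note C = coordD[OF coord] and obj = coord_ver4_object[OF coord]
  note tc = car_tprod_coord[OF coord] and G = Gamma2_coord[OF coord]
  note sub = subspace_Gamma2[OF obj]
  note lin = one_minus_braiding_linear[OF char obj]
  obtain e :: "'j \<Rightarrow> nat" where e: "inj_on e S"
    and emono: "\<And>i j. i \<in> X \<Longrightarrow> j \<in> X \<Longrightarrow> e i < e j \<Longrightarrow> e (p i) < e (p j)"
    using coord_ordering[OF coord] by blast
  define Y where "Y = (\<lambda>(i, j). if e i < e j then Z (i, j) else 0)"
  define D where "D = Z - (Y - braiding C C Y)"
  have Zs: "Z \<in> supp_space (S \<times> S)" using Z G by blast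
  then have Ys: "Y \<in> supp_space (S \<times> S)" by (auto simp: supp_space_def Y_def)
  then have YG: "Y - braiding C C Y \<in> car (Gamma2 C)"
    using linear_map_onD(1)[OF lin] tc by blast
  then have DG: "D \<in> car (Gamma2 C)"
    unfolding D_def using fs.subspace_diff[OF sub Z] by blast
  then have Ds: "D \<in> supp_space (S \<times> S)"
    and Dc: "\<And>a b. D (b, a) + (if a \<in> X \<and> b \<in> X then D (p b, p a) else 0) = D (a, b)"
    using G by blast+
  \<comment> \<open>Besides \<open>Y (i, j)\<close>, the entry of \<open>(1 - c) Y\<close> involves
    only \<open>Y (j, i)\<close> and \<open>Y (p j, p i)\<close>. Both lie below the diagonal, the
    second because \<open>e\<close> is compatible with \<open>p\<close>, so \<open>Y\<close>
    vanishes there.\<close>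
  have upper: "D (i, j) = 0" if "e i < e j" for i j
    using that emono[of j i] emono[of i j] braiding_coord[OF coord Ys, of i j]
      e C(2,3) by (auto simp: D_def Y_def)
  \<comment> \<open>The symmetry of \<open>D\<close> expresses this entry by \<open>D (j, i)\<close>
    and \<open>D (p j, p i)\<close>, which are both above the diagonal.\<close>
  have lower: "D (i, j) = 0" if "e j < e i" for i j
    using Dc[of j i] upper[OF that] that emono[of j i] upper[of "p j" "p i"] by (auto split: if_splits)
  have diag: "D (p i, p i) = 0" if "i \<in> X" for i
    using Dc[of i i] that by simp
  have Ddiag: "D = (\<Sum>j\<in>S - p ` X. fscale (D (j, j)) (unit_vec (j, j)))"
  proof
    fix x :: "'j \<times> 'j"
    obtain a b where x: "x = (a, b)" by force
    have sum: "(\<Sum>j\<in>S - p ` X. D (j, j) * of_bool (x = (j, j)))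
      = (\<Sum>j\<in>S - p ` X. if j = a then (if a = b then D (a, b) else 0) else 0)"
      by (rule sum.cong) (auto simp: x)
    have "D (a, b) = 0" if "a \<noteq> b \<or> a \<notin> S \<or> a \<in> p ` X"
    proof (cases "a \<in> S \<and> b \<in> S")
      case True
      then have "a \<noteq> b \<Longrightarrow> e a \<noteq> e b" using e by (auto simp: inj_on_def)
      then show ?thesis using that True upper lower diag by (metis imageE linorder_neqE_nat)
    next
      case False
      then show ?thesis using Ds by (auto simp: supp_space_def)
    qed
    then show "D x = (\<Sum>j\<in>S - p ` X. fscale (D (j, j)) (unit_vec (j, j))) x"
      using C(1) unfolding sum_fun_apply fscale_apply sum by (auto simp: x)
  qed
  have jj: "(unit_vec (j, j) :: _ \<Rightarrow> 'k) \<in> car (Gamma2 C)" if "j \<in> S - p ` X" for j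
    using that by (auto simp: G supp_space_def of_bool_def)
  have "f D = (\<Sum>j\<in>S - p ` X. fscale (D (j, j)) (f (unit_vec (j, j))))"
    by (subst Ddiag, rule linear_map_on_sum[OF f sub jj])
  then have fD: "f D = 0" using f2 by (auto simp: fun_eq_iff sum_fun_apply)
  let ?E = "\<lambda>ij. unit_vec ij :: _ \<Rightarrow> 'k"
  have "Y = (\<Sum>ij\<in>S \<times> S. fscale (Y ij) (?E ij))"
    using supp_space_expand[OF _ Ys] C(1) by blast
  then have "f (Y - braiding C C Y)
      = f ((\<Sum>ij\<in>S \<times> S. fscale (Y ij) (?E ij)) - braiding C C (\<Sum>ij\<in>S \<times> S. fscale (Y ij) (?E ij)))"
    by simp
  also have "\<dots> = (\<Sum>ij\<in>S \<times> S. fscale (Y ij) (f (?E ij - braiding C C (?E ij))))"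
    by (rule linear_map_on_sum[OF linear_map_on_comp[OF lin f] subspace_tprod])
       (auto simp: tc intro: unit_vec_in_supp)
  also have "\<dots> = 0" using f1 by (auto simp: fun_eq_iff sum_fun_apply intro!: sum.neutral)
  finally have fY: "f (Y - braiding C C Y) = 0" .
  have "Z = D + (Y - braiding C C Y)" by (simp add: D_def)
  then show ?thesis
    using linear_map_onD(2)[OF f DG YG] fD fY by (simp add: D_def)
qed


section \<open>Sums of quadratic forms and the standard forms\<close>

lemma char2_two: "CHAR('k::field) = 2 \<Longrightarrow> (2::'k) = 0"
  using char2_self_add[of 1] by simp

lemma UNIV_pidx: "(UNIV :: pidx set) = {Pw, Px}"
  by (auto intro: pidx.exhaust)

lemma Inl_in_Plus [simp]: "Inl a \<in> A <+> B \<longleftrightarrow> a \<in> A"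
  and Inr_in_Plus [simp]: "Inr b \<in> A <+> B \<longleftrightarrow> b \<in> B"
  by auto

lemma coord_one: "coord one_obj UNIV {} id"
  by (auto simp: coord_def one_obj_def supp_space_def fun_eq_iff)

lemma coord_P: "coord P_obj UNIV {Px} (\<lambda>_. Pw)"
  by (auto simp: coord_def P_obj_def supp_space_def UNIV_pidx fun_eq_iff split: pidx.splits)
     (metis pidx.exhaust)

lemma coord_dsum:
  assumes "coord C1 S1 X1 p1" "coord C2 S2 X2 p2"
  shows "coord (dsum C1 C2) (S1 <+> S2) (X1 <+> X2) (map_sum p1 p2)"
proof -
  note C1 = coordD[OF assms(1)] and C2 = coordD[OF assms(2)]
  have car: "car (dsum C1 C2) = supp_space (S1 <+> S2)"
    by (auto simp: dsum_def C1(5) C2(5) supp_space_def elim!: PlusE) (metis InlI InrI obj_sumE)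
  have "act (dsum C1 C2) z = (\<lambda>j. if j \<in> X1 <+> X2 then z (map_sum p1 p2 j) else 0)"
    if "z \<in> car (dsum C1 C2)" for z
  proof -
    have z: "z \<circ> Inl \<in> supp_space S1" "z \<circ> Inr \<in> supp_space S2"
      using that by (auto simp: dsum_def C1(5) C2(5))
    show ?thesis
    proof
      fix j
      show "act (dsum C1 C2) z j = (if j \<in> X1 <+> X2 then z (map_sum p1 p2 j) else 0)"
        unfolding dsum_def tmod.simps C1(6)[OF z(1)] C2(6)[OF z(2)]
        by (cases j) auto
    qed
  qed
  moreover have "inj_on (map_sum p1 p2) (X1 <+> X2)"
    by (rule inj_onI) (auto dest: inj_onD[OF C1(4)] inj_onD[OF C2(4)])
  moreover have "map_sum p1 p2 ` (X1 <+> X2) \<subseteq> (S1 <+> S2) - (X1 <+> X2)"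
    using C1(3) C2(3) by auto
  ultimately show ?thesis
    using C1(1,2) C2(1,2) car unfolding coord_def by (intro conjI) auto
qed

lemma coord_copies:
  assumes "coord C S X p"
  shows "coord (copies n C) ({..<n} \<times> S) ({..<n} \<times> X) (map_prod id p)"
proof -
  note C = coordD[OF assms]
  have car: "car (copies n C) = supp_space ({..<n} \<times> S)"
    by (auto simp: copies_def C(5) supp_space_def not_less) (meson not_less)
  have "act (copies n C) z = (\<lambda>j. if j \<in> {..<n} \<times> X then z (map_prod id p j) else 0)"
    if "z \<in> car (copies n C)" for z
  proof -
    have "act C (\<lambda>i. z (j, i)) = (\<lambda>i. if i \<in> X then z (j, p i) else 0)" if "j < n" for j
      by (rule C(6)) (use that \<open>z \<in> _\<close> in \<open>auto simp: copies_def C(5)\<close>)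
    then show ?thesis
      by (auto simp: copies_def fun_eq_iff)
  qed
  moreover have "inj_on (map_prod id p) ({..<n} \<times> X)"
    using C(4) by (auto simp: inj_on_def)
  moreover have "map_prod id p ` ({..<n} \<times> X) \<subseteq> ({..<n} \<times> S) - ({..<n} \<times> X)"
    using C(3) by auto
  ultimately show ?thesis
    using C(1,2) car by (auto simp: coord_def)
qed

section \<open>Restriction of tensors to the diagonal blocks of a direct sum\<close>

definition pullback :: "('a \<Rightarrow> 'j) \<Rightarrow> ('j \<times> 'j \<Rightarrow> 'k::field) \<Rightarrow> 'a \<times> 'a \<Rightarrow> 'k"
  where "pullback \<iota> Z = (\<lambda>(a, b). Z (\<iota> a, \<iota> b))"

lemma pullback_apply [simp]: "pullback \<iota> Z (a, b) = Z (\<iota> a, \<iota> b)"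
  by (simp add: pullback_def)

lemma form_sum_pullback: "form_sum q r = (\<lambda>Z. q (pullback Inl Z) + r (pullback Inr Z))"
  by (simp add: form_sum_def pullback_def)

lemma form_copies_pullback: "form_copies n q = (\<lambda>Z. \<Sum>j<n. q (pullback (Pair j) Z))"
  by (simp add: form_copies_def pullback_def)

lemma pullback_add: "pullback \<iota> (Y + Z) = pullback \<iota> Y + pullback \<iota> Z"
  and pullback_diff: "pullback \<iota> (Y - Z) = pullback \<iota> Y - pullback \<iota> Z"
  and pullback_scale: "pullback \<iota> (fscale a Z) = fscale a (pullback \<iota> Z)"
  by (auto simp: pullback_def fun_eq_iff)

text \<open>Common treatment of the index inclusions \<open>Inl\<close>, \<open>Inr\<close> and
  \<open>Pair j\<close>. Since \<open>p\<close> maps the indices of a block into the same block,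
  restricting a tensor to a diagonal block commutes with \<open>c\<close> and with the action of
  \<open>t\<close>.\<close>

locale summand =
  fixes C :: "('j, 'k::field) tmod" and S X p
    and C1 :: "('a, 'k) tmod" and S1 X1 p1 and \<iota> :: "'a \<Rightarrow> 'j"
  assumes coord: "coord C S X p" and coord1: "coord C1 S1 X1 p1"
    and \<iota>_S: "\<iota> a \<in> S \<longleftrightarrow> a \<in> S1" and \<iota>_X: "\<iota> a \<in> X \<longleftrightarrow> a \<in> X1"
    and \<iota>_p: "a \<in> X1 \<Longrightarrow> \<iota> (p1 a) = p (\<iota> a)"
begin

lemma pullback_supp: "Z \<in> supp_space (S \<times> S) \<Longrightarrow> pullback \<iota> Z \<in> supp_space (S1 \<times> S1)"
  using \<iota>_S by (auto simp: supp_space_def)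

lemma pullback_braiding:
  assumes "Z \<in> supp_space (S \<times> S)"
  shows "pullback \<iota> (braiding C C Z) = braiding C1 C1 (pullback \<iota> Z)"
proof -
  have "pullback \<iota> (braiding C C Z) (a, b) = braiding C1 C1 (pullback \<iota> Z) (a, b)" for a b
    unfolding pullback_apply braiding_coord[OF coord assms] braiding_coord[OF coord1 pullback_supp[OF assms]]
    by (simp add: \<iota>_X \<iota>_p)
  then show ?thesis by (simp add: fun_eq_iff)
qed

lemma pullback_act:
  assumes "Z \<in> supp_space (S \<times> S)"
  shows "pullback \<iota> (act (tprod C C) Z) = act (tprod C1 C1) (pullback \<iota> Z)"
proof -
  have "pullback \<iota> (act (tprod C C) Z) (a, b) = act (tprod C1 C1) (pullback \<iota> Z) (a, b)" for a b
    unfolding pullback_apply act_tprod_coord[OF coord assms] act_tprod_coord[OF coord1 pullback_supp[OF assms]]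
    by (simp add: \<iota>_X \<iota>_p)
  then show ?thesis by (simp add: fun_eq_iff)
qed

lemma pullback_Gamma2:
  assumes "Z \<in> car (Gamma2 C)"
  shows "pullback \<iota> Z \<in> car (Gamma2 C1)"
  using assms pullback_supp[of Z] pullback_braiding[of Z]
  by (simp add: Gamma2_iff car_tprod_coord[OF coord] car_tprod_coord[OF coord1])

lemma quadratic_form_pullback:
  assumes "quadratic_form C1 r"
  shows "quadratic_form C (\<lambda>Z. r (pullback \<iota> Z))"
proof -
  have r: "linear_map_on (car (Gamma2 C1)) UNIV r" "\<And>Z. Z \<in> car (Gamma2 C1) \<Longrightarrow> r (act (tprod C1 C1) Z) = 0"
    using assms by (auto simp: quadratic_form_def morphism_def one_obj_def Gamma2_def)
  have "linear_map_on (car (Gamma2 C)) UNIV (\<lambda>Z. r (pullback \<iota> Z))"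
    by (rule linear_map_on_comp[OF _ r(1)])
       (auto simp: linear_map_on_def pullback_add pullback_scale pullback_Gamma2)
  moreover have "r (pullback \<iota> (act (tprod C C) Z)) = 0" if "Z \<in> car (Gamma2 C)" for Z
    using that r(2)[OF pullback_Gamma2[OF that]] pullback_act[of Z] Gamma2_coord[OF coord] by auto
  ultimately show ?thesis
    by (auto simp: quadratic_form_def morphism_def one_obj_def Gamma2_def)
qed

lemma assoc_bilinear_pullback:
  assumes "Z \<in> supp_space (S \<times> S)"
  shows "assoc_bilinear C (\<lambda>Z. r (pullback \<iota> Z)) Z = assoc_bilinear C1 r (pullback \<iota> Z)"
  by (simp add: assoc_bilinear_def pullback_diff pullback_braiding[OF assms])

end

lemma quadratic_form_add:
  assumes "quadratic_form C q" "quadratic_form C r"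
  shows "quadratic_form C (\<lambda>Z. q Z + r Z)"
  using assms linear_map_on_add[of "car (Gamma2 C)" q r]
  by (auto simp: quadratic_form_def morphism_def one_obj_def)

lemma quadratic_form_sum:
  fixes n :: nat
  assumes "\<And>j. j < n \<Longrightarrow> quadratic_form C (q j)"
  shows "quadratic_form C (\<lambda>Z. \<Sum>j<n. q j Z)"
  using assms
proof (induction n)
  case 0
  then show ?case
    by (auto simp: quadratic_form_def morphism_def one_obj_def linear_map_on_def fun_eq_iff)
next
  case (Suc n)
  then have "quadratic_form C (\<lambda>Z. (\<Sum>j<n. q j Z) + q n Z)"
    by (intro quadratic_form_add) auto
  then show ?case
    by (simp only: sum.lessThan_Suc)
qed

lemma summand_dsum:
  assumes "coord C1 S1 X1 p1" "coord C2 S2 X2 p2"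
  shows "summand (dsum C1 C2) (S1 <+> S2) (X1 <+> X2) (map_sum p1 p2) C1 S1 X1 p1 Inl"
    "summand (dsum C1 C2) (S1 <+> S2) (X1 <+> X2) (map_sum p1 p2) C2 S2 X2 p2 Inr"
  using assms coord_dsum[OF assms] by (auto simp: summand_def)

lemma summand_copies:
  assumes "coord C S X p" "j < n"
  shows "summand (copies n C) ({..<n} \<times> S) ({..<n} \<times> X) (map_prod id p) C S X p (Pair j)"
  using assms coord_copies[OF assms(1)] by (auto simp: summand_def)

definition quadratic_coord where
  "quadratic_coord C S X p r \<longleftrightarrow> coord C S X p \<and> quadratic_form C r"

lemma quadratic_coord_dsum:
  assumes "quadratic_coord C1 S1 X1 p1 r1" "quadratic_coord C2 S2 X2 p2 r2"
  shows "quadratic_coord (dsum C1 C2) (S1 <+> S2) (X1 <+> X2) (map_sum p1 p2) (form_sum r1 r2)"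
  using assms summand_dsum[of C1 S1 X1 p1 C2 S2 X2 p2]
  by (auto simp: quadratic_coord_def form_sum_pullback intro!: coord_dsum quadratic_form_add intro: summand.quadratic_form_pullback)

lemma quadratic_coord_copies:
  assumes "quadratic_coord C S X p r"
  shows "quadratic_coord (copies n C) ({..<n} \<times> S) ({..<n} \<times> X) (map_prod id p) (form_copies n r)"
  using assms summand_copies[of C S X p]
  by (auto simp: quadratic_coord_def form_copies_pullback intro!: coord_copies quadratic_form_sum intro: summand.quadratic_form_pullback)

lemma assoc_bilinear_form_sum:
  assumes "coord C1 S1 X1 p1" "coord C2 S2 X2 p2" "Z \<in> supp_space ((S1 <+> S2) \<times> (S1 <+> S2))"
  shows "assoc_bilinear (dsum C1 C2) (form_sum r1 r2) Z
    = assoc_bilinear C1 r1 (pullback Inl Z) + assoc_bilinear C2 r2 (pullback Inr Z)"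
  using summand.assoc_bilinear_pullback[OF summand_dsum(1)[OF assms(1,2)] assms(3), of r1]
    summand.assoc_bilinear_pullback[OF summand_dsum(2)[OF assms(1,2)] assms(3), of r2]
  by (simp only: assoc_bilinear_def form_sum_pullback)

lemma assoc_bilinear_form_copies:
  assumes "coord C S X p" "Z \<in> supp_space (({..<n} \<times> S) \<times> ({..<n} \<times> S))"
  shows "assoc_bilinear (copies n C) (form_copies n r) Z = (\<Sum>j<n. assoc_bilinear C r (pullback (Pair j) Z))"
  using summand.assoc_bilinear_pullback[OF summand_copies[OF assms(1)] assms(2), of _ r]
  by (auto simp: assoc_bilinear_def form_copies_pullback intro!: sum.cong)

definition assoc_is :: "('j, 'k::field) tmod \<Rightarrow> ('j, 'k) form \<Rightarrow> ('j, 'k) form \<Rightarrow> bool"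
  where "assoc_is G r \<gamma> \<longleftrightarrow> (\<forall>Z\<in>car (tprod G G). assoc_bilinear G r Z = \<gamma> Z)"

lemma assoc_is_form_sum:
  assumes "coord C1 S1 X1 p1" "coord C2 S2 X2 p2" "assoc_is C1 r1 \<gamma>1" "assoc_is C2 r2 \<gamma>2"
  shows "assoc_is (dsum C1 C2) (form_sum r1 r2) (form_sum \<gamma>1 \<gamma>2)"
  unfolding assoc_is_def car_tprod_coord[OF coord_dsum[OF assms(1,2)]]
proof
  fix Z :: "('a + 'c) \<times> ('a + 'c) \<Rightarrow> 'b" assume Z: "Z \<in> supp_space ((S1 <+> S2) \<times> (S1 <+> S2))"
  show "assoc_bilinear (dsum C1 C2) (form_sum r1 r2) Z = form_sum \<gamma>1 \<gamma>2 Z"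
    using assms(3,4) assoc_bilinear_form_sum[OF assms(1,2) Z]
      summand.pullback_supp[OF summand_dsum(1)[OF assms(1,2)] Z] summand.pullback_supp[OF summand_dsum(2)[OF assms(1,2)] Z]
    by (simp add: assoc_is_def car_tprod_coord[OF assms(1)] car_tprod_coord[OF assms(2)] form_sum_pullback)
qed

lemma assoc_is_form_copies:
  assumes "coord C S X p" "assoc_is C r \<gamma>"
  shows "assoc_is (copies n C) (form_copies n r) (form_copies n \<gamma>)"
  unfolding assoc_is_def car_tprod_coord[OF coord_copies[OF assms(1)]]
proof
  fix Z :: "(nat \<times> 'a) \<times> (nat \<times> 'a) \<Rightarrow> 'b" assume Z: "Z \<in> supp_space (({..<n} \<times> S) \<times> ({..<n} \<times> S))"
  show "assoc_bilinear (copies n C) (form_copies n r) Z = form_copies n \<gamma> Z"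
    using assms(2) assoc_bilinear_form_copies[OF assms(1) Z]
      summand.pullback_supp[OF summand_copies[OF assms(1)] Z]
    by (auto simp: assoc_is_def car_tprod_coord[OF assms(1)] form_copies_pullback intro!: sum.cong)
qed

text \<open>The quadratic form belonging to \<open>beta_P y\<close>. The space
  \<open>\<Gamma>\<^sup>2(P)\<close> is spanned by
  \<open>(1 - c)(w \<otimes> x) = w \<otimes> x + x \<otimes> w\<close> and
  \<open>(1 - c)(w \<otimes> w) = x \<otimes> x\<close>, which must go to
  \<open>\<beta>(w, x) = 1\<close> and \<open>\<beta>(w, w) = y\<close>.\<close>

definition quad_P :: "'k::field \<Rightarrow> (pidx, 'k) form"
  where "quad_P y = (\<lambda>Z _. Z (Pw, Px) + y * Z (Px, Px))"

text \<open>The quadratic form belonging to \<open>beta_2P y\<close>. One entry from each of the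
  pairs \<open>w1, x2\<close> and \<open>w2, x1\<close> suffices, because tensors in
  \<Gamma>\<open>\<^sup>2\<close> are symmetric in these positions;
  \<open>x1 \<otimes> x1 = (1 - c)(w1 \<otimes> w1)\<close> carries the value
  \<open>y\<close>.\<close>

definition quad_2P :: "'k::field \<Rightarrow> (pidx + pidx, 'k) form"
  where "quad_2P y = (\<lambda>Z _. Z (Inl Pw, Inr Px) + Z (Inr Pw, Inl Px) + y * Z (Inl Px, Inl Px))"

lemma Gamma2_coord_sym:
  assumes "coord C S X p" "Z \<in> car (Gamma2 C)"
  shows "Z (b, a) + (if a \<in> X \<and> b \<in> X then Z (p b, p a) else 0) = Z (a, b)" "Z \<in> supp_space (S \<times> S)"
  using Gamma2_coord[OF assms(1)] assms(2) by auto

lemma quadratic_form_coordI: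
  assumes "coord C S X p" "linear_map_on (car (Gamma2 C)) UNIV r"
    and "\<And>Z. Z \<in> car (Gamma2 C) \<Longrightarrow> r (act (tprod C C) Z) = 0"
  shows "quadratic_form C r"
  using assms by (simp add: quadratic_form_def morphism_def one_obj_def Gamma2_def)

lemma quadratic_coord_P:
  assumes "CHAR('k::field) = 2"
  shows "quadratic_coord P_obj UNIV {Px} (\<lambda>_. Pw) (quad_P (y::'k))"
  unfolding quadratic_coord_def
proof (intro conjI coord_P quadratic_form_coordI[OF coord_P])
  show "linear_map_on (car (Gamma2 P_obj)) UNIV (quad_P y)"
    by (auto simp: linear_map_on_def quad_P_def fun_eq_iff algebra_simps)
  fix Z :: "pidx \<times> pidx \<Rightarrow> 'k" assume Z: "Z \<in> car (Gamma2 P_obj)"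
  note sym = Gamma2_coord_sym[OF coord_P Z]
  have "Z (Pw, Px) = Z (Px, Pw)" "Z (Pw, Pw) = 0"
    using sym(1)[of Px Pw] sym(1)[of Px Px] by auto
  then show "quad_P y (act (tprod P_obj P_obj) Z) = 0"
    by (auto simp: quad_P_def fun_eq_iff act_tprod_coord[OF coord_P sym(2)] char2_self_add[OF assms])
qed

lemma quadratic_coord_2P:
  assumes "CHAR('k::field) = 2"
  shows "quadratic_coord (dsum P_obj P_obj) (UNIV <+> UNIV) ({Px} <+> {Px}) (map_sum (\<lambda>_. Pw) (\<lambda>_. Pw)) (quad_2P (y::'k))"
  unfolding quadratic_coord_def
proof (intro conjI coord_dsum coord_P quadratic_form_coordI[OF coord_dsum[OF coord_P coord_P]])
  let ?C = "dsum P_obj P_obj :: (pidx + pidx, 'k) tmod"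
  note co = coord_dsum[OF coord_P coord_P]
  show "linear_map_on (car (Gamma2 ?C)) UNIV (quad_2P y)"
    by (auto simp: linear_map_on_def quad_2P_def fun_eq_iff algebra_simps)
  fix Z :: "(pidx + pidx) \<times> (pidx + pidx) \<Rightarrow> 'k" assume Z: "Z \<in> car (Gamma2 ?C)"
  note sym = Gamma2_coord_sym[OF co Z]
  have "Z (Inl Pw, Inr Pw) = Z (Inr Pw, Inl Pw)" "Z (Inl Pw, Inl Px) = Z (Inl Px, Inl Pw)"
    using sym(1)[of "Inr Pw" "Inl Pw"] sym(1)[of "Inl Px" "Inl Pw"] by simp_all
  then show "quad_2P y (act (tprod ?C ?C) Z) = 0"
    by (auto simp: quad_2P_def fun_eq_iff act_tprod_coord[OF co sym(2)] char2_self_add[OF assms])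
qed

lemma quadratic_coord_hyperbolic:
  "quadratic_coord (dsum one_obj one_obj) (UNIV <+> UNIV) ({} <+> {}) (map_sum id id)
    (hyperbolic :: (unit + unit, 'k::field) form)"
  unfolding quadratic_coord_def
proof (intro conjI coord_dsum coord_one quadratic_form_coordI[OF coord_dsum[OF coord_one coord_one]])
  let ?C = "dsum one_obj one_obj :: (unit + unit, 'k) tmod"
  note co = coord_dsum[OF coord_one coord_one]
  show "linear_map_on (car (Gamma2 ?C)) UNIV hyperbolic"
    by (auto simp: linear_map_on_def hyperbolic_def fun_eq_iff algebra_simps)
  fix Z :: "(unit + unit) \<times> (unit + unit) \<Rightarrow> 'k" assume Z: "Z \<in> car (Gamma2 ?C)"
  note sym = Gamma2_coord_sym[OF co Z]
  show "hyperbolic (act (tprod ?C ?C) Z) = 0"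
    by (auto simp: hyperbolic_def fun_eq_iff act_tprod_coord[OF co sym(2)])
qed

lemma assoc_is_P:
  assumes "CHAR('k::field) = 2"
  shows "assoc_is P_obj (quad_P y) (beta_P (y::'k))"
  unfolding assoc_is_def car_tprod_coord[OF coord_P]
proof
  fix Z :: "pidx \<times> pidx \<Rightarrow> 'k" assume Z: "Z \<in> supp_space (UNIV \<times> UNIV)"
  show "assoc_bilinear P_obj (quad_P y) Z = beta_P y Z"
    by (auto simp: assoc_bilinear_def quad_P_def beta_P_def gram_form_def numeral_2_eq_2 lessThan_Suc
        braiding_coord[OF coord_P Z] minus_CHAR_2[OF assms] uminus_CHAR_2[OF assms] char2_two[OF assms] fun_eq_iff algebra_simps)
qed

lemma assoc_is_2P:
  assumes "CHAR('k::field) = 2"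
  shows "assoc_is (dsum P_obj P_obj) (quad_2P y) (beta_2P (y::'k))"
  unfolding assoc_is_def car_tprod_coord[OF coord_dsum[OF coord_P coord_P]]
proof
  let ?C = "dsum P_obj P_obj :: (pidx + pidx, 'k) tmod"
  fix Z :: "(pidx + pidx) \<times> (pidx + pidx) \<Rightarrow> 'k"
  assume Z: "Z \<in> supp_space ((UNIV <+> UNIV) \<times> (UNIV <+> UNIV))"
  show "assoc_bilinear ?C (quad_2P y) Z = beta_2P y Z"
    by (auto simp: assoc_bilinear_def quad_2P_def beta_2P_def gram_form_def lessThan_Suc numeral_eq_Suc
        braiding_coord[OF coord_dsum[OF coord_P coord_P] Z] minus_CHAR_2[OF assms] uminus_CHAR_2[OF assms]
        char2_two[OF assms] fun_eq_iff algebra_simps)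
qed

section \<open>Inverse isomorphisms and invertible Gram matrices\<close>

lemma isomorphism_inv_into:
  assumes "ver4_object U" "ver4_object V" "isomorphism U V f"
  shows "isomorphism V U (inv_into (car U) f)"
proof -
  note U = ver4_objectD[OF assms(1)] and V = ver4_objectD[OF assms(2)]
  have lin: "linear_map_on (car U) (car V) f" and bij: "bij_betw f (car U) (car V)"
    and com: "\<And>u. u \<in> car U \<Longrightarrow> f (act U u) = act V (f u)"
    using assms(3) by (auto simp: isomorphism_def morphism_def)
  let ?g = "inv_into (car U) f"
  have g: "?g v \<in> car U" "f (?g v) = v" if "v \<in> car V" for v
    using bij that by (auto simp: bij_betw_def inv_into_into f_inv_into_f)
  have gf: "?g (f u) = u" if "u \<in> car U" for u
    using bij that by (auto simp: bij_betw_def)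
  have "linear_map_on (car V) (car U) ?g"
    unfolding linear_map_on_def
  proof (intro conjI ballI allI)
    fix u v assume uv: "u \<in> car V" "v \<in> car V"
    have "f (?g u + ?g v) = u + v"
      using linear_map_onD(2)[OF lin] g uv by simp
    then show "?g (u + v) = ?g u + ?g v"
      using gf[of "?g u + ?g v"] fs.subspace_add[OF U(1) g(1) g(1)] uv by metis
  next
    fix a u assume u: "u \<in> car V"
    have "f (fscale a (?g u)) = fscale a u"
      using linear_map_onD(3)[OF lin] g u by simp
    then show "?g (fscale a u) = fscale a (?g u)"
      using gf[of "fscale a (?g u)"] fs.subspace_scale[OF U(1) g(1)] u by metis
  qed (use g in blast)
  moreover have "?g (act V v) = act U (?g v)" if "v \<in> car V" for v
    using com[OF g(1)[OF that]] g(2)[OF that] gf[OF U(3)[OF g(1)[OF that]]] by simp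
  ultimately show ?thesis
    using bij_betw_inv_into[OF bij] by (simp add: isomorphism_def morphism_def)
qed

text \<open>Invertibility of the matrix \<open>g\<close>, split into the two forms in which it is
  applied: solvability yields orthogonal projections, uniqueness yields linear independence.\<close>

definition unimodular :: "'j set \<Rightarrow> ('j \<Rightarrow> 'j \<Rightarrow> 'k::field) \<Rightarrow> bool"
  where "unimodular S g \<longleftrightarrow>
    (\<forall>c. \<exists>z. \<forall>l\<in>S. (\<Sum>j\<in>S. z j * g j l) = c l) \<and>
    (\<forall>z. (\<forall>l\<in>S. (\<Sum>j\<in>S. z j * g j l) = 0) \<longrightarrow> (\<forall>j\<in>S. z j = 0))"

lemma unimodular_surj: "unimodular S g \<Longrightarrow> \<exists>z. \<forall>l\<in>S. (\<Sum>j\<in>S. z j * g j l) = c l"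
  and unimodular_inj: "unimodular S g \<Longrightarrow> \<forall>l\<in>S. (\<Sum>j\<in>S. z j * g j l) = 0 \<Longrightarrow> j \<in> S \<Longrightarrow> z j = 0"
  by (simp_all add: unimodular_def)

lemma unimodular_Plus:
  assumes fin: "finite S1" "finite S2" and u1: "unimodular S1 g1" and u2: "unimodular S2 g2"
    and g: "\<And>i j. i \<in> S1 \<Longrightarrow> j \<in> S1 \<Longrightarrow> g (Inl i) (Inl j) = g1 i j"
      "\<And>i j. i \<in> S2 \<Longrightarrow> j \<in> S2 \<Longrightarrow> g (Inr i) (Inr j) = g2 i j"
      "\<And>i j. i \<in> S1 \<Longrightarrow> j \<in> S2 \<Longrightarrow> g (Inl i) (Inr j) = 0"
      "\<And>i j. i \<in> S2 \<Longrightarrow> j \<in> S1 \<Longrightarrow> g (Inr i) (Inl j) = 0"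
  shows "unimodular (S1 <+> S2) g"
proof -
  have 1: "(\<Sum>j\<in>S1 <+> S2. z j * g j (Inl l)) = (\<Sum>j\<in>S1. z (Inl j) * g1 j l)" if "l \<in> S1" for z l
    using that fin by (simp add: sum.Plus g)
  have 2: "(\<Sum>j\<in>S1 <+> S2. z j * g j (Inr l)) = (\<Sum>j\<in>S2. z (Inr j) * g2 j l)" if "l \<in> S2" for z l
    using that fin by (simp add: sum.Plus g)
  have "\<exists>z. \<forall>l\<in>S1 <+> S2. (\<Sum>j\<in>S1 <+> S2. z j * g j l) = c l" for c
  proof -
    obtain z1 z2 where "\<forall>l\<in>S1. (\<Sum>j\<in>S1. z1 j * g1 j l) = c (Inl l)"
      "\<forall>l\<in>S2. (\<Sum>j\<in>S2. z2 j * g2 j l) = c (Inr l)"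
      using unimodular_surj[OF u1, of "\<lambda>l. c (Inl l)"] unimodular_surj[OF u2, of "\<lambda>l. c (Inr l)"]
      by blast
    then have "\<forall>l\<in>S1 <+> S2. (\<Sum>j\<in>S1 <+> S2. case_sum z1 z2 j * g j l) = c l"
      by (auto simp: 1 2)
    then show ?thesis by blast
  qed
  moreover have "\<forall>j\<in>S1 <+> S2. z j = 0" if "\<forall>l\<in>S1 <+> S2. (\<Sum>j\<in>S1 <+> S2. z j * g j l) = 0" for z
  proof -
    have "(\<Sum>j\<in>S1. z (Inl j) * g1 j l) = 0" if "l \<in> S1" for l
      using bspec[OF \<open>\<forall>l\<in>S1 <+> S2. _\<close> InlI[OF that]] unfolding 1[OF that] .
    moreover have "(\<Sum>j\<in>S2. z (Inr j) * g2 j l) = 0" if "l \<in> S2" for l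
      using bspec[OF \<open>\<forall>l\<in>S1 <+> S2. _\<close> InrI[OF that]] unfolding 2[OF that] .
    ultimately have "\<forall>j\<in>S1. z (Inl j) = 0" "\<forall>j\<in>S2. z (Inr j) = 0"
      using u1 u2 unfolding unimodular_def by meson+
    then show ?thesis by auto
  qed
  ultimately show ?thesis by (simp add: unimodular_def)
qed

lemma unimodular_Times:
  fixes g1 :: "'j \<Rightarrow> 'j \<Rightarrow> 'k::field"
  assumes fin: "finite S" and u: "unimodular S g1"
    and g: "\<And>a b i j. a < n \<Longrightarrow> b < n \<Longrightarrow> i \<in> S \<Longrightarrow> j \<in> S \<Longrightarrow>
      g (a, i) (b, j) = (if a = b then g1 i j else 0)"
  shows "unimodular ({..<n::nat} \<times> S) g"
proof -
  have 1: "(\<Sum>j\<in>{..<n} \<times> S. z j * g j (b, l)) = (\<Sum>j\<in>S. z (b, j) * g1 j l)"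
    if "b < n" "l \<in> S" for z :: "nat \<times> 'j \<Rightarrow> 'k" and b l
  proof -
    have "(\<Sum>j\<in>{..<n} \<times> S. z j * g j (b, l)) = (\<Sum>a<n. \<Sum>j\<in>S. z (a, j) * g (a, j) (b, l))"
      by (simp add: sum.cartesian_product case_prod_beta')
    also have "\<dots> = (\<Sum>a<n. if a = b then (\<Sum>j\<in>S. z (b, j) * g1 j l) else 0)"
      using that by (intro sum.cong refl) (simp add: g)
    also have "\<dots> = (\<Sum>j\<in>S. z (b, j) * g1 j l)"
      using that by simp
    finally show ?thesis .
  qed
  have "\<exists>z. \<forall>l\<in>{..<n} \<times> S. (\<Sum>j\<in>{..<n} \<times> S. z j * g j l) = c l" for c
  proof -
    have "\<forall>b. \<exists>z. \<forall>l\<in>S. (\<Sum>j\<in>S. z j * g1 j l) = c (b, l)"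
      by (intro allI unimodular_surj[OF u])
    from choice[OF this] obtain z where "\<forall>b. \<forall>l\<in>S. (\<Sum>j\<in>S. z b j * g1 j l) = c (b, l)"
      by blast
    then have "\<forall>l\<in>{..<n} \<times> S. (\<Sum>j\<in>{..<n} \<times> S. (\<lambda>(b, j). z b j) j * g j l) = c l"
      using 1[of _ _ "\<lambda>(b, j). z b j"] by simp
    then show ?thesis by blast
  qed
  moreover have "\<forall>j\<in>{..<n} \<times> S. z j = 0"
    if z: "\<forall>l\<in>{..<n} \<times> S. (\<Sum>j\<in>{..<n} \<times> S. z j * g j l) = 0" for z
  proof -
    have "\<forall>j\<in>S. z (b, j) = 0" if "b < n" for b
    proof -
      have "\<forall>l\<in>S. (\<Sum>j\<in>S. z (b, j) * g1 j l) = 0"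
      proof
        fix l assume "l \<in> S"
        then show "(\<Sum>j\<in>S. z (b, j) * g1 j l) = 0"
          using 1[OF \<open>b < n\<close>, of l z] z \<open>b < n\<close> by auto
      qed
      from unimodular_inj[OF u this] show ?thesis by blast
    qed
    then show ?thesis by auto
  qed
  ultimately show ?thesis by (simp add: unimodular_def)
qed

definition gram :: "('j, 'k::field) tmod \<Rightarrow> ('j, 'k) form \<Rightarrow> 'j \<Rightarrow> 'j \<Rightarrow> 'k"
  where "gram C r i j = assoc_bilinear C r (unit_vec (i, j)) ()"

lemma quadratic_form_0:
  assumes "coord C S X p" "quadratic_form C r"
  shows "r 0 = 0"
  using assms subspace_Gamma2[OF coord_ver4_object[OF assms(1)]]
  by (auto simp: quadratic_form_def morphism_def elim: linear_map_on_0)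

lemma gram_assoc_is:
  assumes "coord C S X p" "assoc_is C r \<gamma>" "i \<in> S" "j \<in> S"
  shows "gram C r i j = \<gamma> (unit_vec (i, j)) ()"
  using assms(2-4) unit_vec_in_supp[of "(i, j)" "S \<times> S"]
  by (auto simp: gram_def assoc_is_def car_tprod_coord[OF assms(1)])

lemma quadratic_coord_assoc_bilinear_0:
  assumes "coord C S X p" "quadratic_form C r"
  shows "assoc_bilinear C r 0 = 0"
proof -
  have "braiding C C 0 = 0"
    using linear_map_on_0[OF braiding_linear subspace_tprod] coord_ver4_object[OF assms(1)] by blast
  then show ?thesis using quadratic_form_0[OF assms] by (simp add: assoc_bilinear_def)
qed

lemma pullback_unit_vec:
  "pullback Inl (unit_vec (Inl i, Inl j)) = unit_vec (i, j)" "pullback Inr (unit_vec (Inr i', Inr j')) = unit_vec (i', j')"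
  "pullback Inl (unit_vec (Inr i', y)) = 0" "pullback Inl (unit_vec (x, Inr j')) = 0"
  "pullback Inr (unit_vec (Inl i, y)) = 0" "pullback Inr (unit_vec (x, Inl j)) = 0"
  "pullback (Pair a) (unit_vec ((b, k), (c, l))) = (if a = b \<and> a = c then unit_vec (k, l) else 0)"
  by (auto simp: pullback_def fun_eq_iff)

lemma gram_dsum:
  assumes "quadratic_coord C1 S1 X1 p1 r1" "quadratic_coord C2 S2 X2 p2 r2" and "x \<in> S1 <+> S2" "y \<in> S1 <+> S2"
  shows "gram (dsum C1 C2) (form_sum r1 r2) x y = (case x of
      Inl i \<Rightarrow> (case y of Inl j \<Rightarrow> gram C1 r1 i j | Inr j \<Rightarrow> 0)
    | Inr i \<Rightarrow> (case y of Inl j \<Rightarrow> 0 | Inr j \<Rightarrow> gram C2 r2 i j))"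
proof -
  have co: "coord C1 S1 X1 p1" "coord C2 S2 X2 p2" "quadratic_form C1 r1" "quadratic_form C2 r2"
    using assms(1,2) by (auto simp: quadratic_coord_def)
  have "(unit_vec (x, y) :: _ \<Rightarrow> 'b) \<in> supp_space ((S1 <+> S2) \<times> (S1 <+> S2))"
    using assms(3,4) by (intro unit_vec_in_supp) blast
  from assoc_bilinear_form_sum[OF co(1,2) this] show ?thesis
    by (auto simp: gram_def pullback_unit_vec quadratic_coord_assoc_bilinear_0[OF co(1,3)] quadratic_coord_assoc_bilinear_0[OF co(2,4)]
        split: sum.splits)
qed

lemma gram_copies:
  assumes "quadratic_coord C S X p r" and "a < n" "b < n" "i \<in> S" "j \<in> S"
  shows "gram (copies n C) (form_copies n r) (a, i) (b, j) = (if a = b then gram C r i j else 0)"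
proof -
  have co: "coord C S X p" "quadratic_form C r"
    using assms(1) by (auto simp: quadratic_coord_def)
  have "(unit_vec ((a, i), (b, j)) :: _ \<Rightarrow> 'b) \<in> supp_space (({..<n} \<times> S) \<times> ({..<n} \<times> S))"
    using assms(2-) by (intro unit_vec_in_supp) blast
  then have "gram (copies n C) (form_copies n r) (a, i) (b, j)
    = (\<Sum>k<n. assoc_bilinear C r (pullback (Pair k) (unit_vec ((a, i), b, j))) ())"
    unfolding gram_def by (subst assoc_bilinear_form_copies[OF co(1)]) (auto simp: sum_fun_apply)
  also have "\<dots> = (\<Sum>k<n. if k = a then (if a = b then gram C r i j else 0) else 0)"
    by (intro sum.cong refl) (auto simp: gram_def pullback_unit_vec quadratic_coord_assoc_bilinear_0[OF co])
  also have "\<dots> = (if a = b then gram C r i j else 0)"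
    using assms(2) by simp
  finally show ?thesis .
qed

definition unimodular_coord where
  "unimodular_coord C S X p r \<longleftrightarrow> quadratic_coord C S X p r \<and> unimodular S (gram C r)"

lemma unimodular_coord_dsum:
  assumes "unimodular_coord C1 S1 X1 p1 r1" "unimodular_coord C2 S2 X2 p2 r2"
  shows "unimodular_coord (dsum C1 C2) (S1 <+> S2) (X1 <+> X2) (map_sum p1 p2) (form_sum r1 r2)"
proof -
  have s: "quadratic_coord C1 S1 X1 p1 r1" "quadratic_coord C2 S2 X2 p2 r2" using assms by (auto simp: unimodular_coord_def)
  have "finite S1" "finite S2" using s by (auto simp: quadratic_coord_def coord_def)
  then have "unimodular (S1 <+> S2) (gram (dsum C1 C2) (form_sum r1 r2))"
    by (rule unimodular_Plus[where ?g1.0 = "gram C1 r1" and ?g2.0 = "gram C2 r2"])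
      (use assms in \<open>auto simp: unimodular_coord_def gram_dsum[OF s]\<close>)
  then show ?thesis using quadratic_coord_dsum[OF s] by (simp add: unimodular_coord_def)
qed

lemma unimodular_coord_copies:
  assumes "unimodular_coord C S X p r"
  shows "unimodular_coord (copies n C) ({..<n} \<times> S) ({..<n} \<times> X) (map_prod id p) (form_copies n r)"
proof -
  have s: "quadratic_coord C S X p r" using assms by (auto simp: unimodular_coord_def)
  have "finite S" using s by (auto simp: quadratic_coord_def coord_def)
  then have "unimodular ({..<n} \<times> S) (gram (copies n C) (form_copies n r))"
    by (rule unimodular_Times[where ?g1.0 = "gram C r"])
      (use assms in \<open>auto simp: unimodular_coord_def gram_copies[OF s]\<close>)
  then show ?thesis using quadratic_coord_copies[OF s] by (simp add: unimodular_coord_def)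
qed

lemma gram_P:
  assumes "CHAR('k::field) = 2"
  shows "gram P_obj (quad_P (y::'k)) i j = (case i of
    Pw \<Rightarrow> (case j of Pw \<Rightarrow> y | Px \<Rightarrow> 1) | Px \<Rightarrow> (case j of Pw \<Rightarrow> 1 | Px \<Rightarrow> 0))"
  unfolding gram_assoc_is[OF coord_P assoc_is_P[OF assms] UNIV_I UNIV_I]
  by (cases i; cases j) (auto simp: beta_P_def gram_form_def numeral_2_eq_2 lessThan_Suc)

lemma UNIV_sum_pidx: "(UNIV :: (pidx + pidx) set) = {Inl Pw, Inl Px, Inr Pw, Inr Px}"
  by (auto simp: UNIV_sum UNIV_pidx)

lemma gram_2P:
  assumes "CHAR('k::field) = 2"
  shows "gram (dsum P_obj P_obj) (quad_2P (y::'k)) i j = (case (i, j) of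
    (Inl Pw, Inl Pw) \<Rightarrow> y | (Inl Pw, Inr Px) \<Rightarrow> 1 | (Inl Px, Inr Pw) \<Rightarrow> 1
    | (Inr Pw, Inl Px) \<Rightarrow> 1 | (Inr Px, Inl Pw) \<Rightarrow> 1 | _ \<Rightarrow> 0)"
proof -
  have "i \<in> UNIV <+> UNIV" "j \<in> UNIV <+> UNIV" by auto
  from gram_assoc_is[OF coord_dsum[OF coord_P coord_P] assoc_is_2P[OF assms] this]
  moreover have "i \<in> {Inl Pw, Inl Px, Inr Pw, Inr Px}" "j \<in> {Inl Pw, Inl Px, Inr Pw, Inr Px}"
    using UNIV_sum_pidx by blast+
  ultimately show ?thesis
    by (elim insertE emptyE) (simp_all add: beta_2P_def gram_form_def numeral_eq_Suc lessThan_Suc)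
qed

lemma gram_hyperbolic:
  assumes "CHAR('k::field) = 2"
  shows "gram (dsum one_obj one_obj) (hyperbolic :: (_, 'k) form) i j =
    (if i = j then 0 else 1)"
proof -
  have "(unit_vec (i, j) :: _ \<Rightarrow> 'k) \<in> supp_space ((UNIV <+> UNIV) \<times> (UNIV <+> UNIV))"
    by (auto simp: supp_space_def)
  from braiding_coord[OF coord_dsum[OF coord_one coord_one] this] show ?thesis
    by (cases i; cases j) (auto simp: gram_def assoc_bilinear_def hyperbolic_def uminus_CHAR_2[OF assms])
qed

lemma unimodular_doubleton:
  fixes y :: "'k::field"
  assumes "a \<noteq> b" "g a b = 1" "g b a = 1" "g b b = 0" "g a a = y"
  shows "unimodular {a, b} g"
proof -
  have "\<exists>z. \<forall>l\<in>{a, b}. (\<Sum>j\<in>{a, b}. z j * g j l) = c l" for c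
    using assms
    \<comment> \<open>The system is \<open>z a * y + z b = c a\<close> and
      \<open>z a = c b\<close>.\<close>
    by (intro exI[of _ "\<lambda>j. if j = a then c b else c a - c b * y"]) auto
  moreover have "\<forall>j\<in>{a, b}. z j = 0" if "\<forall>l\<in>{a, b}. (\<Sum>j\<in>{a, b}. z j * g j l) = 0" for z
    using that assms by auto
  ultimately show ?thesis by (simp add: unimodular_def)
qed

lemma unimodular_coord_P:
  assumes "CHAR('k::field) = 2"
  shows "unimodular_coord P_obj UNIV {Px} (\<lambda>_. Pw) (quad_P (y::'k))"
  using quadratic_coord_P[OF assms] unimodular_doubleton[of Pw Px "gram P_obj (quad_P y)" y]
  by (simp add: unimodular_coord_def UNIV_pidx gram_P[OF assms])

lemma UNIV_sum_unit: "(UNIV :: (unit + unit) set) = {Inl (), Inr ()}"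
  by (auto simp: UNIV_unit UNIV_sum)

lemma unimodular_coord_hyperbolic:
  assumes "CHAR('k::field) = 2"
  shows "unimodular_coord (dsum one_obj one_obj) (UNIV <+> UNIV) ({} <+> {}) (map_sum id id)
    (hyperbolic :: (unit + unit, 'k) form)"
  using quadratic_coord_hyperbolic unimodular_doubleton[of "Inl ()" "Inr ()" "gram (dsum one_obj one_obj) (hyperbolic :: (unit + unit, 'k) form)"]
  by (simp add: unimodular_coord_def UNIV_sum_unit gram_hyperbolic[OF assms])

lemma unimodular_coord_2P:
  assumes "CHAR('k::field) = 2"
  shows "unimodular_coord (dsum P_obj P_obj) (UNIV <+> UNIV) ({Px} <+> {Px}) (map_sum (\<lambda>_. Pw) (\<lambda>_. Pw)) (quad_2P (y::'k))"
proof -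
  let ?g = "gram (dsum P_obj P_obj) (quad_2P y)"
  have "\<exists>z. \<forall>l\<in>UNIV. (\<Sum>j\<in>UNIV. z j * ?g j l) = c l" for c
  \<comment> \<open>The matrix is antidiagonal apart from the corner \<open>y\<close>, so the
    coordinates of \<open>c\<close> are reversed and only the last one needs a correction by
    \<open>y\<close>.\<close>
  proof (rule exI[of _ "case_sum (case_pidx (c (Inr Px)) (c (Inr Pw)))
        (case_pidx (c (Inl Px)) (c (Inl Pw) - c (Inr Px) * y))"])
  qed (auto simp: UNIV_sum_pidx gram_2P[OF assms])
  moreover have "\<forall>j\<in>UNIV. z j = 0" if "\<forall>l\<in>UNIV. (\<Sum>j\<in>UNIV. z j * ?g j l) = 0" for z
    using that by (auto simp: UNIV_sum_pidx gram_2P[OF assms])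
  ultimately have "unimodular UNIV ?g" by (simp add: unimodular_def)
  then show ?thesis using quadratic_coord_2P[OF assms] by (simp add: unimodular_coord_def)
qed


section \<open>Orthogonal families\<close>

lemma all_pidx: "(\<forall>j. R j) \<longleftrightarrow> R Pw \<and> R Px"
  by (metis pidx.exhaust)

lemma all_sum: "(\<forall>j. R j) \<longleftrightarrow> (\<forall>j. R (Inl j)) \<and> (\<forall>j. R (Inr j))"
  by (metis sum.exhaust)

section \<open>The bilinear form and the values on squares\<close>

locale nondegenerate_form =
  fixes U :: "('i, 'k::alg_closed_field) tmod" and q :: "('i, 'k) form"
  assumes char: "CHAR('k) = 2" and obj: "ver4_object U"
    and quad: "quadratic_form U q" and nondeg: "nondegenerate_quadratic U q"
begin

abbreviation "M \<equiv> car U"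
abbreviation "t \<equiv> act U"

definition \<beta> :: "('i \<Rightarrow> 'k) \<Rightarrow> ('i \<Rightarrow> 'k) \<Rightarrow> 'k"
  where "\<beta> u v = assoc_bilinear U q (tensor u v) ()"

definition Q :: "('i \<Rightarrow> 'k) \<Rightarrow> 'k"
  where "Q u = q (tensor u u) ()"

lemmas subsp = ver4_objectD(1)[OF obj]
lemmas t_linear = ver4_objectD(2)[OF obj]
lemmas t_in = ver4_objectD(3)[OF obj]
lemmas tt = ver4_objectD(4)[OF obj]
lemmas t_add = linear_map_onD(2)[OF t_linear]
lemmas t_scale = linear_map_onD(3)[OF t_linear]
lemmas t_0 = linear_map_on_0[OF t_linear subsp]
lemmas M_add = fs.subspace_add[OF subsp]
lemmas M_scale = fs.subspace_scale[OF subsp]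
lemmas M_0 = fs.subspace_0[OF subsp]
lemmas M_sum = fs.subspace_sum[OF subsp]

lemma self_add: "x + x = (0::'k)"
  using char2_self_add[OF char] .

lemma add_eq_0_iff: "a + b = (0::'k) \<longleftrightarrow> a = b"
  using minus_CHAR_2[OF char, of a b] by (metis eq_iff_diff_eq_0)

lemma q_linear: "linear_map_on (car (Gamma2 U)) UNIV q"
  and q_act: "Z \<in> car (Gamma2 U) \<Longrightarrow> q (act (tprod U U) Z) = 0"
  using quad by (auto simp: quadratic_form_def morphism_def one_obj_def Gamma2_def)

lemma assoc_linear: "linear_map_on (car (tprod U U)) UNIV (assoc_bilinear U q)"
  unfolding assoc_bilinear_def
  by (rule linear_map_on_comp[OF one_minus_braiding_linear[OF char obj] q_linear])

lemma \<beta>_add_left: "u \<in> M \<Longrightarrow> u' \<in> M \<Longrightarrow> v \<in> M \<Longrightarrow> \<beta> (u + u') v = \<beta> u v + \<beta> u' v"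
  by (simp add: \<beta>_def tensor_add_left linear_map_onD(2)[OF assoc_linear] tensor_in_tprod)

lemma \<beta>_add_right: "u \<in> M \<Longrightarrow> v \<in> M \<Longrightarrow> v' \<in> M \<Longrightarrow> \<beta> u (v + v') = \<beta> u v + \<beta> u v'"
  by (simp add: \<beta>_def tensor_add_right linear_map_onD(2)[OF assoc_linear] tensor_in_tprod)

lemma \<beta>_scale_left: "u \<in> M \<Longrightarrow> v \<in> M \<Longrightarrow> \<beta> (fscale a u) v = a * \<beta> u v"
  by (simp add: \<beta>_def tensor_scale_left linear_map_onD(3)[OF assoc_linear] tensor_in_tprod)

lemma \<beta>_scale_right: "u \<in> M \<Longrightarrow> v \<in> M \<Longrightarrow> \<beta> u (fscale a v) = a * \<beta> u v"
  by (simp add: \<beta>_def tensor_scale_right linear_map_onD(3)[OF assoc_linear] tensor_in_tprod)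

lemma assoc_0: "assoc_bilinear U q 0 = 0"
  using linear_map_on_0[OF assoc_linear subspace_tprod] .

lemma \<beta>_0 [simp]: "\<beta> 0 v = 0" "\<beta> u 0 = 0"
  by (simp_all add: \<beta>_def assoc_0)

lemmas \<beta>_bilin = \<beta>_add_left \<beta>_add_right \<beta>_scale_left \<beta>_scale_right

lemma \<beta>_sum_left:
  assumes "\<And>j. j \<in> S \<Longrightarrow> b j \<in> M" "v \<in> M"
  shows "\<beta> (\<Sum>j\<in>S. fscale (z j) (b j)) v = (\<Sum>j\<in>S. z j * \<beta> (b j) v)"
  using assms(1)
proof (induction S rule: infinite_finite_induct)
  case (insert x F)
  have "(\<Sum>j\<in>F. fscale (z j) (b j)) \<in> M" "fscale (z x) (b x) \<in> M" "b x \<in> M"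
    using insert by (auto intro!: M_sum M_scale)
  then have "\<beta> (fscale (z x) (b x) + (\<Sum>j\<in>F. fscale (z j) (b j))) v
      = z x * \<beta> (b x) v + \<beta> (\<Sum>j\<in>F. fscale (z j) (b j)) v"
    using assms(2) by (simp add: \<beta>_add_left \<beta>_scale_left)
  moreover have "\<beta> (\<Sum>j\<in>F. fscale (z j) (b j)) v = (\<Sum>j\<in>F. z j * \<beta> (b j) v)"
    using insert by blast
  ultimately show "\<beta> (\<Sum>j\<in>insert x F. fscale (z j) (b j)) v = (\<Sum>j\<in>insert x F. z j * \<beta> (b j) v)"
    unfolding sum.insert[OF insert(1,2)] by simp
qed auto

definition one_minus_c :: "('i \<Rightarrow> 'k) \<Rightarrow> ('i \<Rightarrow> 'k) \<Rightarrow> 'i \<times> 'i \<Rightarrow> 'k"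
  where "one_minus_c u v = tensor u v + tensor v u + tensor (t v) (t u)"

lemma one_minus_c_eq: "u \<in> M \<Longrightarrow> v \<in> M \<Longrightarrow> one_minus_c u v = tensor u v - braiding U U (tensor u v)"
  by (simp add: one_minus_c_def braiding_tensor[OF obj obj] char2_fun_minus[OF char] add.assoc)

lemma one_minus_c_Gamma2: "u \<in> M \<Longrightarrow> v \<in> M \<Longrightarrow> one_minus_c u v \<in> car (Gamma2 U)"
  by (simp add: one_minus_c_eq one_minus_braiding_in_Gamma2[OF char obj] tensor_in_tprod)

lemma \<beta>_one_minus_c: "u \<in> M \<Longrightarrow> v \<in> M \<Longrightarrow> \<beta> u v = q (one_minus_c u v) ()"
  by (simp add: \<beta>_def assoc_bilinear_def one_minus_c_eq)

lemma act_tprod_linear: "linear_map_on (car (tprod U U)) UNIV (act (tprod U U))"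
proof -
  have "linear_map_on M M id" by (rule linear_map_on_id)
  then have "linear_map_on (car (tprod U U)) UNIV (tensor_map t id)"
    "linear_map_on (car (tprod U U)) UNIV (tensor_map id t)"
    using tensor_map_linear t_linear subsp linear_map_on_UNIV by blast+
  from linear_map_on_add[OF this] show ?thesis by (simp add: tprod_def)
qed

lemma act_tensor: "u \<in> M \<Longrightarrow> v \<in> M \<Longrightarrow> act (tprod U U) (tensor u v) = tensor (t u) v + tensor u (t v)"
  by (simp add: tprod_def tensor_map_tensor[OF t_linear linear_map_on_id(1)]
      tensor_map_tensor[OF linear_map_on_id(1) t_linear])

lemma act_one_minus_c:
  assumes "u \<in> M" "v \<in> M"
  shows "act (tprod U U) (one_minus_c u v) = one_minus_c (t u) v + one_minus_c u (t v)"
proof -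
  have "act (tprod U U) (one_minus_c u v) = act (tprod U U) (tensor u v) + act (tprod U U) (tensor v u)
      + act (tprod U U) (tensor (t v) (t u))"
    unfolding one_minus_c_def using assms
    by (simp add: linear_map_onD(2)[OF act_tprod_linear] fs.subspace_add[OF subspace_tprod] tensor_in_tprod t_in)
  also have "\<dots> = one_minus_c (t u) v + one_minus_c u (t v)"
    using assms by (simp add: act_tensor t_in tt one_minus_c_def add_ac)
  finally show ?thesis .
qed

text \<open>As a morphism to the unit object, \<open>q\<close> kills
  \<open>t.(1 - c)(u \<otimes> v)\<close>, which is
  \<open>(1 - c)(t u \<otimes> v + u \<otimes> t v)\<close>.\<close>

lemma \<beta>_t: assumes "u \<in> M" "v \<in> M" shows "\<beta> (t u) v = \<beta> u (t v)"
proof -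
  have "q (one_minus_c (t u) v + one_minus_c u (t v)) = 0"
    using q_act[OF one_minus_c_Gamma2[OF assms]] act_one_minus_c[OF assms] by simp
  then have "\<beta> (t u) v + \<beta> u (t v) = 0"
    using assms by (simp add: \<beta>_one_minus_c t_in linear_map_onD(2)[OF q_linear] one_minus_c_Gamma2 fun_eq_iff)
  then show ?thesis by (simp add: add_eq_0_iff)
qed

text \<open>The tensors \<open>(1 - c)(u \<otimes> v)\<close> and
  \<open>(1 - c)(v \<otimes> u)\<close> differ by
  \<open>t u \<otimes> t v + t v \<otimes> t u\<close>. This equals
  \<open>t.(1 - c)(u \<otimes> t v)\<close>, so \<open>q\<close> kills it.\<close>

lemma \<beta>_sym: assumes "u \<in> M" "v \<in> M" shows "\<beta> u v = \<beta> v u"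
proof -
  have "one_minus_c u v + one_minus_c v u = tensor (t u) (t v) + tensor (t v) (t u)
      + (tensor u v + tensor u v) + (tensor v u + tensor v u)"
    by (simp add: one_minus_c_def add_ac)
  also have "\<dots> = one_minus_c (t u) (t v) + one_minus_c u (t (t v))"
    unfolding char2_fun_self_add[OF char] using assms by (simp add: one_minus_c_def tt t_in t_0)
  also have "\<dots> = act (tprod U U) (one_minus_c u (t v))"
    using act_one_minus_c[of u "t v"] assms t_in by simp
  finally have "q (one_minus_c u v + one_minus_c v u) = 0"
    using q_act[OF one_minus_c_Gamma2] assms t_in by simp
  then have "\<beta> u v + \<beta> v u = 0"
    using assms by (simp add: \<beta>_one_minus_c linear_map_onD(2)[OF q_linear] one_minus_c_Gamma2 fun_eq_iff)
  then show ?thesis by (simp add: add_eq_0_iff)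
qed

lemma \<beta>_tt: "u \<in> M \<Longrightarrow> v \<in> M \<Longrightarrow> \<beta> (t u) (t v) = 0"
  using \<beta>_t[of u "t v"] t_in tt by simp

lemma one_minus_c_diag: "u \<in> M \<Longrightarrow> one_minus_c u u = tensor (t u) (t u)"
  by (simp add: one_minus_c_def char2_fun_self_add[OF char])

lemma \<beta>_diag: "u \<in> M \<Longrightarrow> \<beta> u u = Q (t u)"
  by (simp add: \<beta>_one_minus_c one_minus_c_diag Q_def)

lemma Q_0: "Q 0 = 0"
  using \<beta>_diag[OF M_0] by (simp add: t_0)

lemma \<beta>_diag_ker: "u \<in> M \<Longrightarrow> t u = 0 \<Longrightarrow> \<beta> u u = 0"
  by (simp add: \<beta>_diag Q_0)

lemma square_Gamma2: "u \<in> M \<Longrightarrow> t u = 0 \<Longrightarrow> tensor u u \<in> car (Gamma2 U)"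
  by (simp add: Gamma2_iff tensor_in_tprod braiding_tensor[OF obj obj])

text \<open>On \<open>ker t\<close> the braiding is the plain flip, so \<open>Q\<close> is there a
  classical quadratic form with polar form \<open>\<beta>\<close>.\<close>

lemma Q_add:
  assumes "u \<in> M" "v \<in> M" "t u = 0" "t v = 0"
  shows "Q (u + v) = Q u + Q v + \<beta> u v"
proof -
  have "tensor (u + v) (u + v) = tensor u u + tensor v v + one_minus_c u v"
    using assms by (simp add: one_minus_c_def tensor_add_left tensor_add_right)
  then show ?thesis
    using assms square_Gamma2[of u] square_Gamma2[of v] one_minus_c_Gamma2[of u v] subspace_Gamma2[OF obj]
    by (simp add: Q_def \<beta>_one_minus_c linear_map_onD(2)[OF q_linear] fs.subspace_add)
qed

lemma Q_scale:
  assumes "u \<in> M" "t u = 0"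
  shows "Q (fscale a u) = a\<^sup>2 * Q u"
proof -
  have "tensor (fscale a u) (fscale a u) = fscale (a\<^sup>2) (tensor u u)"
    by (auto simp: tensor_def fun_eq_iff power2_eq_square)
  then show ?thesis
    using linear_map_onD(3)[OF q_linear square_Gamma2[OF assms]] by (simp add: Q_def)
qed

lemma nondeg_bij: "bij_betw (\<lambda>u v. if v \<in> M then \<beta> u v else 0) M (car (dual U))"
  unfolding \<beta>_def using nondeg
  by (simp add: nondegenerate_quadratic_def nondegenerate_def isomorphism_def)

lemma nondegD:
  assumes "u \<in> M" "\<And>v. v \<in> M \<Longrightarrow> \<beta> u v = 0"
  shows "u = 0"
proof (rule inj_onD[OF bij_betw_imp_inj_on[OF nondeg_bij] _ assms(1) M_0])
  show "(\<lambda>v. if v \<in> M then \<beta> u v else 0) = (\<lambda>v. if v \<in> M then \<beta> 0 v else 0)"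
    using assms(2) by (auto simp: fun_eq_iff)
qed

lemma functional_represented:
  assumes "\<And>u v. u \<in> M \<Longrightarrow> v \<in> M \<Longrightarrow> F (u + v) = F u + F v"
    and "\<And>a u. u \<in> M \<Longrightarrow> F (fscale a u) = a * F u"
  obtains s where "s \<in> M" "\<And>u. u \<in> M \<Longrightarrow> \<beta> u s = F u"
proof -
  have "(\<lambda>u. if u \<in> M then F u else 0) \<in> car (dual U)"
    using assms M_add M_scale by (auto simp: dual_def)
  then obtain s where s: "s \<in> M" "(\<lambda>v. if v \<in> M then \<beta> s v else 0) = (\<lambda>u. if u \<in> M then F u else 0)"
    using bij_betw_imp_surj_on[OF nondeg_bij] by (metis (no_types, lifting) imageE)
  then have "\<beta> s u = F u" if "u \<in> M" for u
    using that by (metis (mono_tags))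
  then show ?thesis using that[OF s(1)] \<beta>_sym s(1) by simp
qed

text \<open>A copy inside \<open>U\<close> of the basis of a standard form \<open>r\<close> on
  \<open>C\<close>. Values of \<open>Q\<close> are prescribed only outside the image of
  \<open>p\<close>, that is on the basis vectors killed by \<open>t\<close>; by
  \<open>Gamma2_coord_eq_zero\<close> these values and the Gram matrix determine the form.\<close>

definition frame where
  "frame C S X p r b \<longleftrightarrow> unimodular_coord C S X p r \<and> (\<forall>j\<in>S. b j \<in> M) \<and>
    (\<forall>j\<in>X. t (b (p j)) = b j) \<and> (\<forall>j\<in>S - p ` X. t (b j) = 0) \<and>
    (\<forall>i\<in>S. \<forall>j\<in>S. \<beta> (b i) (b j) = gram C r i j) \<and>
    (\<forall>j\<in>S - p ` X. Q (b j) = r (unit_vec (j, j)) ())"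

lemma frameD:
  assumes "frame C S X p r b"
  shows "unimodular_coord C S X p r" "\<And>j. j \<in> S \<Longrightarrow> b j \<in> M" "\<And>j. j \<in> X \<Longrightarrow> t (b (p j)) = b j"
    "\<And>j. j \<in> S - p ` X \<Longrightarrow> t (b j) = 0" "\<And>i j. i \<in> S \<Longrightarrow> j \<in> S \<Longrightarrow> \<beta> (b i) (b j) = gram C r i j"
    "\<And>j. j \<in> S - p ` X \<Longrightarrow> Q (b j) = r (unit_vec (j, j)) ()"
    "coord C S X p" "quadratic_form C r" "unimodular S (gram C r)"
  using assms by (auto simp: frame_def unimodular_coord_def quadratic_coord_def)

lemma frame_dsum:
  assumes f1: "frame C1 S1 X1 p1 r1 b1" and f2: "frame C2 S2 X2 p2 r2 b2"
    and orth: "\<And>i j. i \<in> S1 \<Longrightarrow> j \<in> S2 \<Longrightarrow> \<beta> (b1 i) (b2 j) = 0"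
  shows "frame (dsum C1 C2) (S1 <+> S2) (X1 <+> X2) (map_sum p1 p2) (form_sum r1 r2) (case_sum b1 b2)"
proof -
  note D1 = frameD[OF f1] and D2 = frameD[OF f2]
  have s: "quadratic_coord C1 S1 X1 p1 r1" "quadratic_coord C2 S2 X2 p2 r2"
    using D1(1) D2(1) by (auto simp: unimodular_coord_def)
  have orth': "\<beta> (b2 j) (b1 i) = 0" if "i \<in> S1" "j \<in> S2" for i j
    using orth[OF that] \<beta>_sym D1(2) D2(2) that by metis
  have im: "Inl j \<in> map_sum p1 p2 ` (X1 <+> X2) \<longleftrightarrow> j \<in> p1 ` X1"
    "Inr i \<in> map_sum p1 p2 ` (X1 <+> X2) \<longleftrightarrow> i \<in> p2 ` X2" for i j
    by (auto elim!: PlusE simp: image_iff) (force intro: InlI InrI)+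
  show ?thesis
    unfolding frame_def
  proof (intro conjI unimodular_coord_dsum D1(1) D2(1) ballI)
    fix j assume "j \<in> S1 <+> S2"
    then show "case_sum b1 b2 j \<in> M" using D1(2) D2(2) by auto
  next
    fix j assume "j \<in> X1 <+> X2"
    then show "t (case_sum b1 b2 (map_sum p1 p2 j)) = case_sum b1 b2 j"
      using D1(3) D2(3) by auto
  next
    fix j assume "j \<in> (S1 <+> S2) - map_sum p1 p2 ` (X1 <+> X2)"
    then show "t (case_sum b1 b2 j) = 0" "Q (case_sum b1 b2 j) = form_sum r1 r2 (unit_vec (j, j)) ()"
      using D1(4,6) D2(4,6) quadratic_form_0[OF D1(7,8)] quadratic_form_0[OF D2(7,8)]
      by (cases j; simp add: im form_sum_pullback pullback_unit_vec)+
  next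
    fix i j assume "i \<in> S1 <+> S2" "j \<in> S1 <+> S2"
    then show "\<beta> (case_sum b1 b2 i) (case_sum b1 b2 j) = gram (dsum C1 C2) (form_sum r1 r2) i j"
      unfolding gram_dsum[OF s \<open>i \<in> _\<close> \<open>j \<in> _\<close>]
      using D1(5) D2(5) orth orth' by (cases i; cases j; simp)
  qed
qed

lemma frame_copies:
  assumes n: "unimodular_coord C S X p r" and f: "\<And>a. a < n \<Longrightarrow> frame C S X p r (\<lambda>j. b (a, j))"
    and orth: "\<And>a a' i j. a < n \<Longrightarrow> a' < n \<Longrightarrow> a \<noteq> a' \<Longrightarrow> i \<in> S \<Longrightarrow> j \<in> S \<Longrightarrow> \<beta> (b (a, i)) (b (a', j)) = 0"
  shows "frame (copies n C) ({..<n} \<times> S) ({..<n} \<times> X) (map_prod id p) (form_copies n r) b"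
proof -
  have s: "quadratic_coord C S X p r" and co: "coord C S X p" "quadratic_form C r"
    using n by (auto simp: unimodular_coord_def quadratic_coord_def)
  note D = frameD[OF f]
  show ?thesis
    unfolding frame_def
  proof (intro conjI unimodular_coord_copies n ballI)
    fix j assume "j \<in> {..<n} \<times> S"
    then show "b j \<in> M" using D(2) by auto
  next
    fix j assume "j \<in> {..<n} \<times> X"
    then show "t (b (map_prod id p j)) = b j"
      using D(3) by auto
  next
    fix j assume j: "j \<in> ({..<n} \<times> S) - map_prod id p ` ({..<n} \<times> X)"
    then obtain a i where ai: "j = (a, i)" "a < n" "i \<in> S - p ` X" by (cases j) force
    have "form_copies n r (unit_vec (j, j)) () = (\<Sum>k<n. if k = a then r (unit_vec (i, i)) () else 0)"
      unfolding form_copies_pullback sum_fun_apply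
      by (intro sum.cong refl) (auto simp: ai pullback_unit_vec quadratic_form_0[OF co])
    then show "Q (b j) = form_copies n r (unit_vec (j, j)) ()"
      using D(6)[OF ai(2,3)] ai by simp
    show "t (b j) = 0" using D(4)[OF ai(2,3)] ai by simp
  next
    fix i j assume "i \<in> {..<n} \<times> S" "j \<in> {..<n} \<times> S"
    then show "\<beta> (b i) (b j) = gram (copies n C) (form_copies n r) i j"
      using D(5) orth by (auto simp: gram_copies[OF s])
  qed
qed

text \<open>The only basis vector killed by \<open>t\<close> is \<open>t w\<close>, and its value is
  \<open>Q (t w) = \<beta> w w = y\<close>.\<close>

lemma frame_P:
  assumes "w \<in> M" "\<beta> w (t w) = 1" "\<beta> w w = y"
  shows "frame P_obj UNIV {Px} (\<lambda>_. Pw) (quad_P y) (case_pidx w (t w))"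
proof -
  have "UNIV - (\<lambda>_. Pw) ` {Px} = {Px}" by (auto intro: pidx.exhaust)
  moreover have "quad_P y (unit_vec (Px, Px)) () = y" by (simp add: quad_P_def)
  moreover have "\<beta> (t w) w = 1" "\<beta> (t w) (t w) = 0" "Q (t w) = y"
    using assms \<beta>_t \<beta>_tt \<beta>_diag by auto
  ultimately show ?thesis
    using assms t_in[of w] tt[of w] by (simp add: frame_def unimodular_coord_P[OF char] gram_P[OF char] all_pidx)
qed

lemma frame_2P:
  assumes "w1 \<in> M" "w2 \<in> M" "\<beta> w1 (t w1) = 0" "\<beta> w2 (t w2) = 0" "\<beta> w1 (t w2) = 1"
    "\<beta> w1 w2 = 0" "\<beta> w1 w1 = y" "\<beta> w2 w2 = 0"
  shows "frame (dsum P_obj P_obj) (UNIV <+> UNIV) ({Px} <+> {Px}) (map_sum (\<lambda>_. Pw) (\<lambda>_. Pw)) (quad_2P y)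
    (case_sum (case_pidx w1 (t w1)) (case_pidx w2 (t w2)))"
proof -
  have "map_sum (\<lambda>_. Pw) (\<lambda>_. Pw) ` ({Px} <+> {Px}) = {Inl Pw, Inr Pw}"
    by (auto simp: Plus_def)
  then have "UNIV - map_sum (\<lambda>_. Pw) (\<lambda>_. Pw) ` ({Px} <+> {Px}) = {Inl Px, Inr Px}"
    unfolding UNIV_sum_pidx by auto
  moreover have "{Px} <+> {Px} = {Inl Px, Inr Px}" by auto
  moreover have "quad_2P y (unit_vec (Inl Px, Inl Px)) () = y" "quad_2P y (unit_vec (Inr Px, Inr Px)) () = 0"
    by (simp_all add: quad_2P_def)
  moreover have "\<beta> w2 w1 = 0" "\<beta> w2 (t w1) = 1" "\<beta> (t w1) w1 = 0" "\<beta> (t w1) w2 = 1" "\<beta> (t w2) w1 = 1" "\<beta> (t w2) w2 = 0"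
    using assms \<beta>_sym \<beta>_t t_in by metis+
  moreover have "Q (t w1) = y" "Q (t w2) = 0"
    using assms \<beta>_diag by auto
  moreover have "unimodular_coord (dsum P_obj P_obj) UNIV {Inl Px, Inr Px} (map_sum (\<lambda>_. Pw) (\<lambda>_. Pw)) (quad_2P y)"
    using unimodular_coord_2P[OF char, of y] \<open>{Px} <+> {Px} = _\<close> by simp
  ultimately show ?thesis
    using assms t_in tt \<beta>_tt by (simp add: frame_def gram_2P[OF char] all_pidx all_sum)
qed

lemma frame_hyperbolic:
  assumes "v \<in> M" "v' \<in> M" "t v = 0" "t v' = 0" "\<beta> v v' = 1" "Q v = 0" "Q v' = 0"
  shows "frame (dsum one_obj one_obj) (UNIV <+> UNIV) ({} <+> {}) (map_sum id id) hyperbolic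
    (case_sum (\<lambda>_. v) (\<lambda>_. v'))"
proof -
  have empty: "{} <+> {} = ({} :: ('a + 'b) set)" by simp
  have "hyperbolic (unit_vec (Inl (), Inl ())) () = (0::'k)" "hyperbolic (unit_vec (Inr (), Inr ())) () = (0::'k)"
    by (simp_all add: hyperbolic_def)
  then show ?thesis
    using assms \<beta>_diag_ker[of v] \<beta>_diag_ker[of v'] \<beta>_sym[of v v'] unimodular_coord_hyperbolic[OF char]
    by (simp add: frame_def gram_hyperbolic[OF char] all_sum empty)
qed

text \<open>Orthogonal projection: the coefficients solve the linear system given by the invertible
  Gram matrix.\<close>

lemma frame_complement:
  assumes f: "frame C S X p r b" and u: "u \<in> M"
  obtains z where "\<And>l. l \<in> S \<Longrightarrow> \<beta> (u - (\<Sum>j\<in>S. fscale (z j) (b j))) (b l) = 0"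
proof -
  note D = frameD[OF f]
  obtain z where z: "\<forall>l\<in>S. (\<Sum>j\<in>S. z j * gram C r j l) = \<beta> u (b l)"
    using unimodular_surj[OF D(9), of "\<lambda>l. \<beta> u (b l)"] by blast
  let ?s = "\<Sum>j\<in>S. fscale (z j) (b j)"
  have s: "?s \<in> M" using D(2) by (auto intro!: M_sum M_scale)
  have "\<beta> (u - ?s) (b l) = 0" if l: "l \<in> S" for l
  proof -
    have "\<beta> ?s (b l) = (\<Sum>j\<in>S. z j * \<beta> (b j) (b l))"
      using D(2) l by (intro \<beta>_sum_left) auto
    also have "\<dots> = \<beta> u (b l)"
      using z l D(5) by simp
    finally show ?thesis
      using \<beta>_add_left[OF u s D(2)[OF l]] by (simp add: char2_fun_minus[OF char] self_add)
  qed
  then show ?thesis using that by blast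
qed

lemma frame_independent:
  assumes f: "frame C S X p r b" and z: "(\<Sum>j\<in>S. fscale (z j) (b j)) = 0" and j: "j \<in> S"
  shows "z j = 0"
proof (rule unimodular_inj[OF frameD(9)[OF f] _ j])
  note D = frameD[OF f]
  show "\<forall>l\<in>S. (\<Sum>j\<in>S. z j * gram C r j l) = 0"
  proof
    fix l assume l: "l \<in> S"
    have "\<beta> (\<Sum>j\<in>S. fscale (z j) (b j)) (b l) = (\<Sum>j\<in>S. z j * \<beta> (b j) (b l))"
      using D(2) l by (intro \<beta>_sum_left) auto
    then show "(\<Sum>j\<in>S. z j * gram C r j l) = 0"
      using z l D(5) by simp
  qed
qed

text \<open>A vector minus its projection to the frame is orthogonal to the frame, hence zero by
  \<open>total\<close>; this gives surjectivity. Injectivity is the independence of the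
  frame.\<close>

lemma frame_isomorphism:
  assumes f: "frame C S X p r b" and total: "\<And>u. u \<in> M \<Longrightarrow> (\<And>j. j \<in> S \<Longrightarrow> \<beta> u (b j) = 0) \<Longrightarrow> u = 0"
  shows "isomorphism C U (\<lambda>z. \<Sum>j\<in>S. fscale (z j) (b j))"
proof -
  note D = frameD[OF f] and C = coordD[OF frameD(7)[OF f]]
  let ?\<psi> = "\<lambda>z. \<Sum>j\<in>S. fscale (z j) (b j)"
  have into: "?\<psi> z \<in> M" for z using D(2) by (auto intro!: M_sum M_scale)
  have lin: "linear_map_on (car C) M ?\<psi>"
    unfolding linear_map_on_def
    using into by (auto simp: fs.scale_left_distrib sum.distrib fs.scale_sum_right fs.scale_scale)
  have act: "?\<psi> (act C z) = t (?\<psi> z)" if z: "z \<in> car C" for z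
  proof -
    have "t (?\<psi> z) = (\<Sum>j\<in>S. fscale (z j) (t (b j)))"
      by (rule linear_map_on_sum[OF t_linear subsp]) (use D(2) in auto)
    also have "\<dots> = (\<Sum>j\<in>p ` X. fscale (z j) (t (b j)))"
      using C(1,3) D(4) by (intro sum.mono_neutral_right) auto
    also have "\<dots> = (\<Sum>j\<in>X. fscale (z (p j)) (b j))"
      by (subst sum.reindex[OF C(4)]) (auto intro!: sum.cong simp: D(3))
    also have "\<dots> = (\<Sum>j\<in>S. fscale (if j \<in> X then z (p j) else 0) (b j))"
      using C(1,2) by (intro sum.mono_neutral_cong_left) auto
    also have "\<dots> = ?\<psi> (act C z)"
      using C(6) z by (simp add: C(5))
    finally show ?thesis by simp
  qed
  have "inj_on ?\<psi> (car C)"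
  proof (rule inj_onI)
    fix y z assume yz: "y \<in> car C" "z \<in> car C" "?\<psi> y = ?\<psi> z"
    have "?\<psi> (y - z) = ?\<psi> y - ?\<psi> z"
      by (rule linear_map_on_minus[OF lin _ yz(1,2)]) (simp add: C(5) subspace_supp_space)
    then have "?\<psi> (y - z) = 0"
      unfolding yz(3) by (simp only: diff_self)
    then have "(y - z) j = 0" if "j \<in> S" for j
      using frame_independent[OF f _ that, of "y - z"] by blast
    then show "y = z" using yz(1,2) unfolding C(5) supp_space_def fun_eq_iff
      by (metis (mono_tags, lifting) eq_iff_diff_eq_0 fun_diff_def mem_Collect_eq)
  qed
  moreover have "?\<psi> ` car C = M"
  proof (intro equalityI subsetI)
    fix u assume u: "u \<in> M"
    obtain z where z: "\<And>l. l \<in> S \<Longrightarrow> \<beta> (u - ?\<psi> z) (b l) = 0"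
      using frame_complement[OF f u] by blast
    then have "u - ?\<psi> z = 0"
      by (intro total) (use u into fs.subspace_diff[OF subsp] in auto)
    then have "u = ?\<psi> z" by simp
    also have "\<dots> = ?\<psi> (\<lambda>j. if j \<in> S then z j else 0)"
      by (rule sum.cong) auto
    finally have "u = ?\<psi> (\<lambda>j. if j \<in> S then z j else 0)" .
    moreover have "(\<lambda>j. if j \<in> S then z j else 0) \<in> car C"
      by (auto simp: C(5) supp_space_def)
    ultimately show "u \<in> ?\<psi> ` car C" by (rule image_eqI)
  qed (use into in auto)
  ultimately have "bij_betw ?\<psi> (car C) M" unfolding bij_betw_def by (rule conjI)
  then show ?thesis
    unfolding isomorphism_def morphism_def using lin act by blast
qed

text \<open>Transport \<open>q\<close> to \<open>C\<close> along the basis map and compare with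
  \<open>r\<close>. Equal Gram matrices give agreement on the image of \<open>1 - c\<close>, equal
  values of \<open>Q\<close> give agreement on the squares of basis vectors killed by
  \<open>t\<close>, and \<open>Gamma2_coord_eq_zero\<close> shows that this is enough.\<close>

lemma frame_quadratic_equiv:
  assumes f: "frame C S X p r b" and total: "\<And>u. u \<in> M \<Longrightarrow> (\<And>j. j \<in> S \<Longrightarrow> \<beta> u (b j) = 0) \<Longrightarrow> u = 0"
  shows "quadratic_equiv U q C r"
proof -
  note D = frameD[OF f] and C = coordD[OF frameD(7)[OF f]]
  have objC: "ver4_object C" using coord_ver4_object[OF D(7)] .
  define \<psi> where "\<psi> = (\<lambda>z. \<Sum>j\<in>S. fscale (z j) (b j))"
  define \<phi> where "\<phi> = inv_into (car C) \<psi>"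
  have iso: "isomorphism C U \<psi>" using frame_isomorphism[OF assms] by (simp add: \<psi>_def)
  have iso': "isomorphism U C \<phi>" unfolding \<phi>_def by (rule isomorphism_inv_into[OF objC obj iso])
  have lin: "linear_map_on (car C) M \<psi>" "linear_map_on M (car C) \<phi>"
    and mor: "morphism C U \<psi>" "morphism U C \<phi>"
    using iso iso' by (auto simp: isomorphism_def morphism_def)
  have \<psi>\<phi>: "\<psi> (\<phi> u) = u" if "u \<in> M" for u
    using iso that unfolding \<phi>_def isomorphism_def bij_betw_def by (simp add: f_inv_into_f)
  have subC: "fs.subspace (car C)" using ver4_objectD(1)[OF objC] .
  have \<psi>_unit: "\<psi> (unit_vec j) = b j" if "j \<in> S" for j
  proof -
    have "\<psi> (unit_vec j) = (\<Sum>i\<in>S. if i = j then b j else 0)"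
      unfolding \<psi>_def by (rule sum.cong) (auto simp: fun_eq_iff)
    then show ?thesis using that C(1) by simp
  qed
  have unitC: "(unit_vec j :: _ \<Rightarrow> 'k) \<in> car C" if "j \<in> S" for j
    using that by (auto simp: C(5) supp_space_def)
  have \<psi>\<psi>: "tensor_map \<psi> \<psi> (unit_vec (i, j)) = tensor (b i) (b j)" if "i \<in> S" "j \<in> S" for i j
    unfolding tensor_unit_vec[symmetric]
    using tensor_map_tensor[OF lin(1) lin(1) unitC unitC] that \<psi>_unit by simp
  have r_lin: "linear_map_on (car (Gamma2 C)) UNIV r"
    using D(8) by (auto simp: quadratic_form_def morphism_def one_obj_def)
  have TL: "linear_map_on (car (tprod C C)) (car (tprod U U)) (tensor_map \<psi> \<psi>)"
    by (rule tensor_map_linear[OF lin(1) lin(1) subC subC])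
  have \<psi>\<psi>_lin: "linear_map_on (car (Gamma2 C)) (car (Gamma2 U)) (tensor_map \<psi> \<psi>)"
    by (rule linear_map_on_mono[OF TL]) (use tensor_map_Gamma2[OF objC obj mor(1)] in \<open>auto simp: Gamma2_iff\<close>)
  let ?f = "\<lambda>\<zeta>. q (tensor_map \<psi> \<psi> \<zeta>) - r \<zeta>"
  have f_lin: "linear_map_on (car (Gamma2 C)) UNIV ?f"
    by (rule linear_map_on_diff[OF linear_map_on_comp[OF \<psi>\<psi>_lin q_linear] r_lin])
  have "?f Y = 0" if Y: "Y \<in> car (Gamma2 C)" for Y
  proof (rule Gamma2_coord_eq_zero[OF char D(7) f_lin _ _ Y])
    fix i j assume ij: "i \<in> S" "j \<in> S"
    let ?E = "unit_vec (i, j) :: _ \<Rightarrow> 'k"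
    have E: "?E \<in> car (tprod C C)"
      using tensor_in_tprod[OF unitC unitC, of i j] ij by (simp add: tensor_unit_vec)
    have "tensor_map \<psi> \<psi> (?E - braiding C C ?E) = tensor_map \<psi> \<psi> ?E - tensor_map \<psi> \<psi> (braiding C C ?E)"
      by (rule linear_map_on_minus[OF TL subspace_tprod E linear_map_onD(1)[OF braiding_linear[OF objC objC] E]])
    also have "\<dots> = tensor (b i) (b j) - braiding U U (tensor (b i) (b j))"
      using braiding_natural[OF objC objC obj obj mor(1) mor(1) E] \<psi>\<psi>[OF ij] by simp
    finally have "q (tensor_map \<psi> \<psi> (?E - braiding C C ?E)) () = \<beta> (b i) (b j)"
      by (simp add: \<beta>_def assoc_bilinear_def)
    also have "\<dots> = r (?E - braiding C C ?E) ()"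
      using D(5)[OF ij] by (simp add: gram_def assoc_bilinear_def)
    finally show "?f (?E - braiding C C ?E) = 0" by (simp add: fun_eq_iff)
  next
    fix j assume j: "j \<in> S - p ` X"
    then have "tensor_map \<psi> \<psi> (unit_vec (j, j)) = tensor (b j) (b j)" by (intro \<psi>\<psi>) auto
    then show "?f (unit_vec (j, j)) = 0"
      using D(6)[OF j] unfolding Q_def by (simp only:) (simp add: fun_eq_iff)
  qed
  moreover have "tensor_map \<psi> \<psi> (tensor_map \<phi> \<phi> Z) = Z" if "Z \<in> car (Gamma2 U)" for Z
  proof -
    have Z: "Z \<in> car (tprod U U)" using that by (simp add: Gamma2_iff)
    show ?thesis
      unfolding tensor_map_comp[OF lin(2,1,2,1) subsp subsp subC subC Z]
      by (rule tensor_map_ident[OF linear_map_on_comp[OF lin(2,1)] subsp \<psi>\<phi> Z])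
  qed
  ultimately have "q Z = r (tensor_map \<phi> \<phi> Z)" if "Z \<in> car (Gamma2 U)" for Z
    using tensor_map_Gamma2[OF obj objC mor(2) that] that by (metis right_minus_eq)
  then show ?thesis using iso' unfolding quadratic_equiv_def by blast
qed

end


section \<open>Splitting off standard summands\<close>

lemma card_le_span:
  fixes b :: "'j \<Rightarrow> 'i \<Rightarrow> 'k::field"
  assumes "finite S" "finite B" "b ` S \<subseteq> fs.span B"
    and ind: "\<And>z j. (\<Sum>j\<in>S. fscale (z j) (b j)) = 0 \<Longrightarrow> j \<in> S \<Longrightarrow> z j = 0"
  shows "card S \<le> card B"
proof -
  have inj: "inj_on b S"
  proof (rule inj_onI, rule ccontr)
    fix i j assume ij: "i \<in> S" "j \<in> S" "b i = b j" "i \<noteq> j"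
    \<comment> \<open>A repeated vector would give the nontrivial relation
      \<open>b i - b j = 0\<close>.\<close>
    let ?z = "\<lambda>l. (if l = i then 1 else 0) - (if l = j then 1 else 0) :: 'k"
    have "(\<Sum>l\<in>S. fscale (?z l) (b l))
        = (\<Sum>l\<in>S. (if l = i then b i else 0) - (if l = j then b j else 0))"
      by (intro sum.cong refl) (auto simp: fun_eq_iff)
    also have "\<dots> = 0"
      using ij assms(1) by (simp add: sum_subtractf)
    finally show False using ind[of ?z i] ij by simp
  qed
  have "fs.independent (b ` S)"
  proof (rule fs.independent_if_scalars_zero)
    fix f x assume f: "(\<Sum>x\<in>b ` S. fscale (f x) x) = 0" and x: "x \<in> b ` S"
    then have "(\<Sum>j\<in>S. fscale (f (b j)) (b j)) = 0"
      by (simp add: sum.reindex[OF inj])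
    then show "f x = 0" using ind[of "\<lambda>j. f (b j)"] x by blast
  qed (use assms(1) in blast)
  then show ?thesis
    using fs.independent_span_bound[OF assms(2) _ assms(3)] card_image[OF inj] by metis
qed

text \<open>\<open>card S\<close> is the dimension and \<open>card X\<close> the rank of
  \<open>t\<close>: for \<open>j\<close> in \<open>X\<close> the basis vector \<open>j\<close> is
  \<open>t\<close> applied to the basis vector \<open>p j\<close>, so \<open>f\<close> sends it into
  the image of \<open>t\<close>, which has support in \<open>X'\<close>.\<close>

lemma coord_isomorphism_card_le:
  fixes C :: "('j, 'k::field) tmod" and C' :: "('l, 'k) tmod"
  assumes "coord C S X p" "coord C' S' X' p'" "isomorphism C C' f"
  shows "card S \<le> card S' \<and> card X \<le> card X'"
proof -
  note C = coordD[OF assms(1)] and C' = coordD[OF assms(2)]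
  have lin: "linear_map_on (supp_space S) (supp_space S') f" and inj: "inj_on f (supp_space S)"
    and com: "\<And>u. u \<in> supp_space S \<Longrightarrow> f (act C u) = act C' (f u)"
    using assms(3) by (auto simp: isomorphism_def morphism_def C(5) C'(5) bij_betw_def)
  let ?b = "\<lambda>j. f (unit_vec j)"
  have uS: "(unit_vec j :: _ \<Rightarrow> 'k) \<in> supp_space S" if "j \<in> S" for j
    using that by (rule unit_vec_in_supp)
  have ind: "z j = 0" if T: "T \<subseteq> S" and z: "(\<Sum>j\<in>T. fscale (z j) (?b j)) = 0" and j: "j \<in> T" for T z j
  proof -
    let ?u = "\<Sum>j\<in>T. fscale (z j) (unit_vec j :: _ \<Rightarrow> 'k)"
    have "f ?u = 0"
      using linear_map_on_sum[OF lin subspace_supp_space, of T unit_vec z] uS T z by (simp add: subset_iff)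
    also have "\<dots> = f 0" using linear_map_on_0[OF lin subspace_supp_space] by simp
    finally have "?u = 0"
      by (intro inj_onD[OF inj]) (use uS T in \<open>auto intro!: fs.subspace_sum[OF subspace_supp_space]
        fs.subspace_scale[OF subspace_supp_space] fs.subspace_0[OF subspace_supp_space]\<close>)
    moreover have "?u = (\<lambda>i. if i \<in> T then z i else 0)"
    proof
      fix i
      have "(\<Sum>j\<in>T. z j * of_bool (i = j)) = (\<Sum>j\<in>T. if j = i then z i else 0)"
        by (rule sum.cong) auto
      then show "?u i = (if i \<in> T then z i else 0)"
        using finite_subset[OF T C(1)] by (simp add: sum_fun_apply)
    qed
    ultimately show ?thesis using j by (metis zero_fun_apply)
  qed
  have "?b ` S \<subseteq> fs.span (unit_vec ` S')"
    using linear_map_onD(1)[OF lin uS] supp_space_span[OF C'(1), where 'k = 'k] by auto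
  with C(1) C'(1) have 1: "card S \<le> card (unit_vec ` S' :: ('l \<Rightarrow> 'k) set)"
    by (intro card_le_span[where b = ?b] ind[OF order_refl]) blast+
  have "?b j \<in> supp_space X'" if j: "j \<in> X" for j
  proof -
    have pj: "p j \<in> S" using C(3) j by auto
    have "act C (unit_vec (p j)) = unit_vec j"
      using C(6)[OF uS[OF pj]] j inj_onD[OF C(4)] by (auto simp: fun_eq_iff)
    then have "?b j = act C' (f (unit_vec (p j)))" using com[OF uS[OF pj]] by simp
    then show ?thesis using C'(6)[OF linear_map_onD(1)[OF lin uS[OF pj]]]
      by (auto simp: supp_space_def)
  qed
  then have "?b ` X \<subseteq> fs.span (unit_vec ` X')"
    using supp_space_span[OF finite_subset[OF C'(2,1)], where 'k = 'k] by auto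
  with finite_subset[OF C(2,1)] finite_subset[OF C'(2,1)]
  have 2: "card X \<le> card (unit_vec ` X' :: ('l \<Rightarrow> 'k) set)"
    by (intro card_le_span[where b = ?b] ind[OF C(2)]) blast+
  show ?thesis
    using 1 2 card_image_le[OF C'(1), of "unit_vec :: _ \<Rightarrow> _ \<Rightarrow> 'k"]
      card_image_le[OF finite_subset[OF C'(2,1)], of "unit_vec :: _ \<Rightarrow> _ \<Rightarrow> 'k"] by linarith
qed

lemma isomorphism_comp:
  assumes "isomorphism U V f" "isomorphism V W g"
  shows "isomorphism U W (\<lambda>u. g (f u))"
  using assms bij_betw_trans[of f "car U" "car V" g "car W"]
    linear_map_on_comp[of "car U" "car V" f "car W" g] linear_map_onD(1)[of "car U" "car V" f]
  unfolding isomorphism_def morphism_def comp_def by auto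

lemma coord_isomorphism_card:
  assumes "coord C S X p" "coord C' S' X' p'" "isomorphism C C' f"
  shows "card S = card S'" "card X = card X'"
  using coord_isomorphism_card_le[OF assms]
    coord_isomorphism_card_le[OF assms(2,1) isomorphism_inv_into[OF coord_ver4_object[OF assms(1)]
        coord_ver4_object[OF assms(2)] assms(3)]]
  by auto

section \<open>Squares and roots over the base field\<close>

lemma char2_square_inj:
  assumes "CHAR('k::field) = 2" "(x::'k)\<^sup>2 = y\<^sup>2"
  shows "x = y"
proof -
  have "(x - y)\<^sup>2 = x\<^sup>2 + y\<^sup>2 - 2 * x * y" by (simp add: power2_eq_square algebra_simps)
  also have "\<dots> = 0" using assms(2) char2_two[OF assms(1)] char2_self_add[OF assms(1)] by simp
  finally show ?thesis by simp
qed

lemma quadratic_root: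
  fixes a b :: "'k::alg_closed_field"
  shows "\<exists>x. a * x\<^sup>2 + x + b = 0"
proof -
  \<comment> \<open>The linear coefficient 1 keeps the degree positive even when
    \<open>a = 0\<close>.\<close>
  have "degree [:b, 1, a:] > 0" by simp
  from alg_closed_imp_poly_has_root[OF this] obtain x where "poly [:b, 1, a:] x = 0" by blast
  then show ?thesis
    by (intro exI[of _ x]) (simp add: power2_eq_square algebra_simps)
qed

lemma square_root:
  fixes a :: "'k::alg_closed_field"
  obtains x where "x\<^sup>2 = a"
  using nth_root_exists[of 2 a] by auto

lemma ball_Plus: "(\<forall>j\<in>A <+> B. R j) \<longleftrightarrow> (\<forall>a\<in>A. R (Inl a)) \<and> (\<forall>b\<in>B. R (Inr b))"
  by (auto elim!: PlusE)

context nondegenerate_form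
begin

text \<open>Frames are independent, so a finite generating set of \<open>U\<close> bounds their
  size. This bound makes every splitting process stop.\<close>

lemma frame_card_bounded: "\<exists>N. \<forall>(C :: ('j, 'k) tmod) S X p r b. frame C S X p r b \<longrightarrow> card S \<le> N"
proof -
  obtain B where B: "finite B" "fs.span B = M"
    using obj by (auto simp: ver4_object_def)
  have "card S \<le> card B" if "frame C S X p r b" for C :: "('j, 'k) tmod" and S X p r b
    using frameD(2)[OF that] coordD(1)[OF frameD(7)[OF that]] B
    by (intro card_le_span[where b = b] frame_independent[OF that]) auto
  then show ?thesis by blast
qed

definition nondeg_submodule :: "('i \<Rightarrow> 'k) set \<Rightarrow> bool"
  where "nondeg_submodule V \<longleftrightarrow> fs.subspace V \<and> V \<subseteq> M \<and> (\<forall>u\<in>V. t u \<in> V) \<and>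
    (\<forall>u\<in>V. (\<forall>v\<in>V. \<beta> u v = 0) \<longrightarrow> u = 0)"

definition perp :: "('i \<Rightarrow> 'k) set \<Rightarrow> ('j \<Rightarrow> 'i \<Rightarrow> 'k) \<Rightarrow> 'j set \<Rightarrow> ('i \<Rightarrow> 'k) set"
  where "perp V b S = {u \<in> V. \<forall>j\<in>S. \<beta> u (b j) = 0}"

lemma nondeg_submoduleD:
  assumes "nondeg_submodule V"
  shows "fs.subspace V" "\<And>u. u \<in> V \<Longrightarrow> u \<in> M" "\<And>u. u \<in> V \<Longrightarrow> t u \<in> V"
    "\<And>u. u \<in> V \<Longrightarrow> (\<And>v. v \<in> V \<Longrightarrow> \<beta> u v = 0) \<Longrightarrow> u = 0"
    "\<And>u v. u \<in> V \<Longrightarrow> v \<in> V \<Longrightarrow> u + v \<in> V" "\<And>a u. u \<in> V \<Longrightarrow> fscale a u \<in> V" "0 \<in> V"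
  using assms fs.subspace_add fs.subspace_scale fs.subspace_0 by (auto simp: nondeg_submodule_def)

lemma nondeg_submodule_M: "nondeg_submodule M"
  using subsp t_in nondegD by (auto simp: nondeg_submodule_def)

text \<open>The complement is stable under \<open>t\<close> because \<open>t\<close> is self-adjoint
  and maps each frame vector to a frame vector or to 0. It is nondegenerate because each vector of
  \<open>V\<close> is a combination of the frame plus a vector of the complement.\<close>

lemma nondeg_submodule_perp:
  assumes f: "frame C S X p r b" and V: "nondeg_submodule V" and bV: "\<And>j. j \<in> S \<Longrightarrow> b j \<in> V"
  shows "nondeg_submodule (perp V b S)"
proof -
  note D = frameD[OF f] and C = coordD[OF frameD(7)[OF f]] and W = nondeg_submoduleD[OF V]
  have "fs.subspace (perp V b S)"
    using W bV by (auto simp: fs.subspace_def perp_def \<beta>_bilin)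
  moreover have "t u \<in> perp V b S" if u: "u \<in> perp V b S" for u
  proof -
    have "\<beta> (t u) (b l) = 0" if l: "l \<in> S" for l
    proof -
      have "\<beta> (t u) (b l) = \<beta> u (t (b l))"
        using \<beta>_t u D(2)[OF l] W(2) by (auto simp: perp_def)
      also have "\<dots> = 0"
      proof (cases "l \<in> p ` X")
        case True
        then obtain i where "l = p i" "i \<in> X" by blast
        then show ?thesis using D(3)[of i] u C(2) by (auto simp: perp_def)
      next
        case False
        then show ?thesis using D(4)[of l] l by simp
      qed
      finally show ?thesis .
    qed
    then show ?thesis using u W(3) by (auto simp: perp_def)
  qed
  moreover have "u = 0" if u: "u \<in> perp V b S" and ort: "\<forall>v\<in>perp V b S. \<beta> u v = 0" for u
  proof (rule W(4))
    show uV: "u \<in> V" using u by (simp add: perp_def)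
    fix v assume v: "v \<in> V"
    obtain z where z: "\<And>l. l \<in> S \<Longrightarrow> \<beta> (v - (\<Sum>j\<in>S. fscale (z j) (b j))) (b l) = 0"
      using frame_complement[OF f W(2)[OF v]] by blast
    let ?s = "\<Sum>j\<in>S. fscale (z j) (b j)"
    have s: "?s \<in> V" using bV W(6) by (intro fs.subspace_sum[OF W(1)]) auto
    then have d: "v - ?s \<in> V" using fs.subspace_diff[OF W(1) v] by blast
    then have "\<beta> u (v - ?s) = 0" using ort z by (simp add: perp_def)
    moreover have "\<beta> ?s u = 0"
      using \<beta>_sum_left[of S b u z] D(2) W(2)[OF uV] u \<beta>_sym[OF W(2)[OF uV]]
      by (simp add: perp_def)
    then have "\<beta> u ?s = 0" using \<beta>_sym W(2) uV s by metis
    moreover have "\<beta> u v = \<beta> u (v - ?s) + \<beta> u ?s"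
      using \<beta>_add_right[of u "v - ?s" ?s] W(2) uV s d by simp
    ultimately show "\<beta> u v = 0" by simp
  qed
  ultimately show ?thesis
    using W(2) by (auto simp: nondeg_submodule_def perp_def)
qed

lemma perp_case_sum: "perp V (case_sum b1 b2) (S1 <+> S2) = perp (perp V b1 S1) b2 S2"
  unfolding perp_def ball_Plus by auto

text \<open>Greedy splitting: \<open>\<C>\<close> is the invariant handed on to complements,
  \<open>fin\<close> the stopping condition, and \<open>step\<close> splits off one more copy of
  \<open>C\<close> as long as \<open>fin\<close> fails.\<close>

lemma peel:
  fixes C :: "('j, 'k) tmod"
  assumes n: "unimodular_coord C S X p r" and S: "S \<noteq> {}"
    and nondeg_submodule: "\<And>V. \<C> V \<Longrightarrow> nondeg_submodule V" and V0: "\<C> V0"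
    and step: "\<And>V. \<C> V \<Longrightarrow> \<not> fin V \<Longrightarrow> \<exists>c. frame C S X p r c \<and> c ` S \<subseteq> V \<and> \<C> (perp V c S)"
  obtains k b where "frame (copies k C) ({..<k} \<times> S) ({..<k} \<times> X) (map_prod id p) (form_copies k r) b"
    "b ` ({..<k} \<times> S) \<subseteq> V0" "\<C> (perp V0 b ({..<k} \<times> S))" "fin (perp V0 b ({..<k} \<times> S))"
proof -
  \<comment> \<open>\<open>R k b\<close> says that \<open>b\<close> consists of \<open>k\<close>
    mutually orthogonal copies inside \<open>V0\<close> whose common complement still satisfies the
    invariant.\<close>
  define R where "R k b \<longleftrightarrow> (\<forall>a<k. frame C S X p r (\<lambda>j. b (a, j))) \<and>
    (\<forall>a<k. \<forall>a'<k. a \<noteq> a' \<longrightarrow> (\<forall>i\<in>S. \<forall>j\<in>S. \<beta> (b (a, i)) (b (a', j)) = 0)) \<and>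
    b ` ({..<k} \<times> S) \<subseteq> V0 \<and> \<C> (perp V0 b ({..<k} \<times> S))" for k :: nat and b
  have frame: "frame (copies k C) ({..<k} \<times> S) ({..<k} \<times> X) (map_prod id p) (form_copies k r) b"
    if "R k b" for k b
    using that unfolding R_def by (intro frame_copies n) blast+
  have "\<exists>k b. R k b \<and> fin (perp V0 b ({..<k} \<times> S))"
  proof (rule ccontr)
    assume no: "\<not> ?thesis"
    have "\<exists>b. R k b" for k
    proof (induction k)
      case 0
      have "R 0 (\<lambda>_. 0)" using V0 by (simp add: R_def perp_def)
      then show ?case by blast
    next
      case (Suc k)
      then obtain b where b: "R k b" by blast
      let ?V = "perp V0 b ({..<k} \<times> S)"
      have CV: "\<C> ?V" using b by (simp add: R_def)
      have "\<not> fin ?V" using b no by blast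
      from step[OF CV this] obtain c where c: "frame C S X p r c" "c ` S \<subseteq> ?V" "\<C> (perp ?V c S)"
        by blast
      define b' where "b' = (\<lambda>(a, j). if a < k then b (a, j) else c j)"
      have cM: "c j \<in> M" if "j \<in> S" for j using frameD(2)[OF c(1) that] .
      have "frame C S X p r (\<lambda>j. b (a, j))" if "a < k" for a
        using b that by (simp add: R_def)
      then have bM: "b (a, j) \<in> M" if "a < k" "j \<in> S" for a j
        using frameD(2) that by metis
      have cb: "\<beta> (c i) (b (a, j)) = 0" "\<beta> (b (a, j)) (c i) = 0" if "a < k" "i \<in> S" "j \<in> S" for a i j
        using c(2) that \<beta>_sym[OF cM bM] by (auto simp: perp_def)
      have "perp V0 b' ({..<Suc k} \<times> S) = perp ?V c S"
        by (auto simp: perp_def b'_def less_Suc_eq)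
      moreover have "frame C S X p r (\<lambda>j. b' (a, j))" if "a < Suc k" for a
        using that b c(1) by (cases "a < k") (auto simp: R_def b'_def)
      moreover have "b' ` ({..<Suc k} \<times> S) \<subseteq> V0"
        using b c(2) unfolding R_def image_subset_iff by (auto simp: b'_def perp_def)
      moreover have "\<beta> (b' (a, i)) (b' (a', j)) = 0"
        if "a < Suc k" "a' < Suc k" "a \<noteq> a'" "i \<in> S" "j \<in> S" for a a' i j
        using that b cb by (auto simp: R_def b'_def less_Suc_eq)
      ultimately have "R (Suc k) b'" using c(3) by (simp add: R_def)
      then show ?case by blast
    qed
    moreover obtain N where N: "\<forall>(C :: (nat \<times> 'j, 'k) tmod) S X p r b. frame C S X p r b \<longrightarrow> card S \<le> N"
      using frame_card_bounded by blast
    \<comment> \<open>Without stopping there would be \<open>Suc N\<close> copies, hence more than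
      \<open>N\<close> frame vectors, as \<open>S\<close> is nonempty.\<close>
    ultimately obtain b where "R (Suc N) b" by blast
    from frame[OF this] have "card ({..<Suc N} \<times> S) \<le> N" using N by blast
    moreover have "finite S" using n by (auto simp: unimodular_coord_def quadratic_coord_def coord_def)
    then have "card S > 0" using S by (simp add: card_gt_0_iff)
    then have "Suc N * card S \<ge> Suc N" by (metis less_eq_Suc_le mult.right_neutral mult_le_mono2 One_nat_def)
    ultimately show False by (simp add: card_cartesian_product)
  qed
  then obtain k b where kb: "R k b" "fin (perp V0 b ({..<k} \<times> S))" by blast
  then have "b ` ({..<k} \<times> S) \<subseteq> V0" "\<C> (perp V0 b ({..<k} \<times> S))"
    by (simp_all add: R_def)
  then show ?thesis using that[OF frame[OF kb(1)]] kb(2) by simp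
qed

section \<open>The semilinear functions \<open>N\<close> and \<open>D\<close>\<close>

definition N :: "('i \<Rightarrow> 'k) \<Rightarrow> 'k" where "N u = \<beta> u u"
definition D :: "('i \<Rightarrow> 'k) \<Rightarrow> 'k" where "D u = \<beta> u (t u)"

definition semilinear :: "(('i \<Rightarrow> 'k) \<Rightarrow> 'k) \<Rightarrow> bool"
  where "semilinear F \<longleftrightarrow> (\<forall>u\<in>M. \<forall>v\<in>M. F (u + v) = F u + F v) \<and>
    (\<forall>a. \<forall>u\<in>M. F (fscale a u) = a\<^sup>2 * F u)"

lemma semilinearD:
  assumes "semilinear F"
  shows "u \<in> M \<Longrightarrow> v \<in> M \<Longrightarrow> F (u + v) = F u + F v" "u \<in> M \<Longrightarrow> F (fscale a u) = a\<^sup>2 * F u"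
  using assms by (auto simp: semilinear_def)

lemma semilinear_N: "semilinear N"
  unfolding semilinear_def N_def
proof (intro conjI ballI allI)
  fix u v assume uv: "u \<in> M" "v \<in> M"
  then have "\<beta> (u + v) (u + v) = \<beta> u u + \<beta> v v + (\<beta> u v + \<beta> v u)"
    by (simp add: \<beta>_bilin M_add)
  then show "\<beta> (u + v) (u + v) = \<beta> u u + \<beta> v v"
    by (simp only: \<beta>_sym[OF uv] self_add add_0_right)
qed (simp add: \<beta>_bilin M_scale power2_eq_square)

lemma semilinear_D: "semilinear D"
  unfolding semilinear_def D_def
proof (intro conjI ballI allI)
  fix u v assume uv: "u \<in> M" "v \<in> M"
  then have "\<beta> (u + v) (t (u + v)) = \<beta> u (t u) + \<beta> v (t v) + (\<beta> u (t v) + \<beta> v (t u))"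
    by (simp add: \<beta>_bilin M_add t_add t_in)
  moreover have "\<beta> v (t u) = \<beta> u (t v)"
    using uv \<beta>_t \<beta>_sym t_in by metis
  ultimately show "\<beta> (u + v) (t (u + v)) = \<beta> u (t u) + \<beta> v (t v)"
    by (simp only: self_add add_0_right)
qed (simp add: \<beta>_bilin M_scale power2_eq_square t_scale t_in)

lemma semilinear_lincomb: "semilinear F \<Longrightarrow> semilinear F' \<Longrightarrow> semilinear (\<lambda>u. F u - c * F' u)"
  by (auto simp: semilinear_def algebra_simps)

text \<open>The zero set of \<open>F\<close> is a subspace, and the frame together with its
  complement spans \<open>M\<close>.\<close>

lemma semilinear_frame_zero:
  assumes F: "semilinear F" and f: "frame C S X p r b"
    and b: "\<And>j. j \<in> S \<Longrightarrow> F (b j) = 0" and perp: "\<And>u. u \<in> perp M b S \<Longrightarrow> F u = 0" and u: "u \<in> M"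
  shows "F u = 0"
proof -
  note DF = semilinearD[OF F]
  obtain z where z: "\<And>l. l \<in> S \<Longrightarrow> \<beta> (u - (\<Sum>j\<in>S. fscale (z j) (b j))) (b l) = 0"
    using frame_complement[OF f u] by blast
  let ?s = "\<Sum>j\<in>S. fscale (z j) (b j)"
  have bM: "\<And>j. j \<in> S \<Longrightarrow> b j \<in> M" using frameD(2)[OF f] .
  have F0: "F 0 = 0" using DF(2)[OF M_0, of 0] by simp
  have "fs.subspace {v \<in> M. F v = 0}"
    using M_add M_scale M_0 F0 DF by (auto simp: fs.subspace_def)
  then have "?s \<in> {v \<in> M. F v = 0}"
    by (intro fs.subspace_sum) (use bM b DF M_scale in auto)
  then have s: "?s \<in> M" "F ?s = 0" by auto
  then have d: "u - ?s \<in> M" using fs.subspace_diff[OF subsp u] by blast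
  then have "F (u - ?s) = 0" using perp z by (simp add: perp_def)
  then show ?thesis using DF(1)[OF d s(1)] s(2) by simp
qed

lemma N_t: "u \<in> M \<Longrightarrow> N (t u) = 0" and D_t: "u \<in> M \<Longrightarrow> D (t u) = 0"
  by (simp_all add: N_def D_def \<beta>_tt tt t_in)

section \<open>Splitting off one standard summand\<close>

lemma partner:
  assumes V: "nondeg_submodule V" and u: "u \<in> V" "u \<noteq> 0"
  obtains v where "v \<in> V" "\<beta> u v = 1"
proof -
  obtain v where v: "v \<in> V" "\<beta> u v \<noteq> 0" using nondeg_submoduleD(4)[OF V u(1)] u(2) by blast
  then have "\<beta> u (fscale (1 / \<beta> u v) v) = 1"
    using nondeg_submoduleD(2)[OF V] u by (simp add: \<beta>_bilin)
  then show ?thesis using that nondeg_submoduleD(6)[OF V v(1)] by blast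
qed

lemma partner_t:
  assumes V: "nondeg_submodule V" and u: "u \<in> V" "t u \<noteq> 0"
  obtains v where "v \<in> V" "\<beta> u (t v) = 1"
proof -
  obtain v where v: "v \<in> V" "\<beta> (t u) v = 1" using partner[OF V nondeg_submoduleD(3)[OF V u(1)] u(2)] .
  then show ?thesis using that \<beta>_t nondeg_submoduleD(2)[OF V] u(1) by metis
qed

lemma step_hyperbolic:
  assumes V: "nondeg_submodule V" "\<forall>u\<in>V. t u = 0" and u: "u \<in> V" "u \<noteq> 0"
  shows "\<exists>c. frame (dsum one_obj one_obj) (UNIV <+> UNIV) ({} <+> {}) (map_sum id id) hyperbolic c \<and>
    c ` (UNIV <+> UNIV) \<subseteq> V \<and> nondeg_submodule (perp V c (UNIV <+> UNIV)) \<and> (\<forall>u\<in>perp V c (UNIV <+> UNIV). t u = 0)"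
proof -
  note W = nondeg_submoduleD[OF V(1)]
  obtain w where w: "w \<in> V" "\<beta> u w = 1" using partner[OF V(1) u] .
  have uw: "u \<in> M" "w \<in> M" "t u = 0" "t w = 0" using u w V(2) W by auto
  \<comment> \<open>The left side is \<open>Q (x u + w)\<close>, because
    \<open>\<beta> u w = 1\<close>.\<close>
  obtain x where x: "Q u * x\<^sup>2 + x + Q w = 0" using quadratic_root by blast
  define v' where "v' = fscale x u + w"
  have v': "v' \<in> V" "Q v' = 0" "\<beta> u v' = 1"
    using uw u w W x \<beta>_diag_ker[OF uw(1,3)] \<beta>_sym[OF uw(1,2)]
    by (auto simp: v'_def Q_add Q_scale M_scale t_scale \<beta>_bilin algebra_simps)
  \<comment> \<open>With \<open>Q v' = 0\<close> and \<open>\<beta> u v' = 1\<close> this gives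
    \<open>Q v = Q u + Q u = 0\<close>; the pairing with \<open>v'\<close> is unchanged since
    \<open>\<beta> v' v' = 0\<close>.\<close>
  define v where "v = u + fscale (Q u) v'"
  have v'M: "v' \<in> M" "t v' = 0" using v' W V(2) by auto
  have v: "v \<in> V" "Q v = 0" "\<beta> v v' = 1"
    using uw v' u W v'M \<beta>_diag_ker[OF v'M] self_add
    by (auto simp: v_def Q_add Q_scale M_scale t_scale \<beta>_bilin)
  let ?c = "case_sum (\<lambda>_::unit. v) (\<lambda>_::unit. v')"
  have f: "frame (dsum one_obj one_obj) (UNIV <+> UNIV) ({} <+> {}) (map_sum id id) hyperbolic ?c"
    using v v' W V(2) by (intro frame_hyperbolic) auto
  moreover have c: "?c ` (UNIV <+> UNIV) \<subseteq> V"
    unfolding UNIV_Plus_UNIV UNIV_sum_unit using v v' by auto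
  moreover have "nondeg_submodule (perp V ?c (UNIV <+> UNIV))"
    using nondeg_submodule_perp[OF f V(1)] c by blast
  moreover have "\<forall>u\<in>perp V ?c (UNIV <+> UNIV). t u = 0"
    using V(2) by (simp add: perp_def)
  ultimately show ?thesis by blast
qed

lemma step_2P:
  assumes V: "nondeg_submodule V" "\<forall>u\<in>V. N u = 0 \<and> D u = 0" and u: "u \<in> V" "t u \<noteq> 0"
  shows "\<exists>c. frame (dsum P_obj P_obj) (UNIV <+> UNIV) ({Px} <+> {Px}) (map_sum (\<lambda>_. Pw) (\<lambda>_. Pw)) (quad_2P 0) c \<and>
    c ` (UNIV <+> UNIV) \<subseteq> V \<and> nondeg_submodule (perp V c (UNIV <+> UNIV)) \<and>
    (\<forall>u\<in>perp V c (UNIV <+> UNIV). N u = 0 \<and> D u = 0)"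
proof -
  note W = nondeg_submoduleD[OF V(1)]
  obtain v where v: "v \<in> V" "\<beta> u (t v) = 1" using partner_t[OF V(1) u] .
  \<comment> \<open>Adding a multiple of \<open>t v\<close> keeps \<open>t w = t v\<close>; as
    \<open>\<beta> u (t v) = 1\<close>, the coefficient makes \<open>\<beta> u w\<close>
    vanish.\<close>
  define w where "w = v + fscale (\<beta> u v) (t v)"
  have uv: "u \<in> M" "v \<in> M" using u v W by auto
  have wV: "w \<in> V" using v W by (simp add: w_def)
  have w: "\<beta> u w = 0" "\<beta> u (t w) = 1"
    using uv v self_add by (simp_all add: w_def \<beta>_bilin t_in M_scale t_add t_scale tt)
  let ?c = "case_sum (case_pidx u (t u)) (case_pidx w (t w))"
  have f: "frame (dsum P_obj P_obj) (UNIV <+> UNIV) ({Px} <+> {Px}) (map_sum (\<lambda>_. Pw) (\<lambda>_. Pw)) (quad_2P 0) ?c"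
    using V(2) u(1) wV w W(2) by (intro frame_2P) (auto simp: N_def D_def)
  moreover have c: "?c ` (UNIV <+> UNIV) \<subseteq> V"
    unfolding UNIV_Plus_UNIV UNIV_sum_pidx using u wV W(3) by auto
  moreover have "nondeg_submodule (perp V ?c (UNIV <+> UNIV))"
    using nondeg_submodule_perp[OF f V(1)] c by blast
  moreover have "\<forall>u\<in>perp V ?c (UNIV <+> UNIV). N u = 0 \<and> D u = 0"
    using V(2) by (simp add: perp_def)
  ultimately show ?thesis by blast
qed

text \<open>
  The last condition says that the form \<open>\<beta> u (t v)\<close> on \<open>V\<close> is zero or not alternating; in
  characteristic \<open>2\<close> only such forms have an orthogonal basis.
\<close>

definition orthogonalizable :: "'k \<Rightarrow> ('i \<Rightarrow> 'k) set \<Rightarrow> bool"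
  where "orthogonalizable y V \<longleftrightarrow> nondeg_submodule V \<and> (\<forall>u\<in>V. N u = y * D u) \<and>
    ((\<exists>u\<in>V. D u \<noteq> 0) \<or> (\<forall>u\<in>V. t u = 0))"

lemma perp_P: "perp V (case_pidx w (t w)) UNIV = {u \<in> V. \<beta> u w = 0 \<and> \<beta> u (t w) = 0}"
  by (auto simp: perp_def all_pidx)

text \<open>
  If the complement of the first choice \<open>e\<close> is alternating and nonzero, then \<open>e + u\<close> works for any
  \<open>u\<close> in it with \<open>t u \<noteq> 0\<close>: this is the relation \<open>\<langle>1\<rangle> + H = \<langle>1\<rangle> + \<langle>1\<rangle> + \<langle>1\<rangle>\<close> for a symplectic plane \<open>H\<close>.
\<close>

lemma step_P:
  assumes V: "orthogonalizable y V" and u0: "u0 \<in> V" "t u0 \<noteq> 0"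
  obtains e where "e \<in> V" "D e = 1" "N e = y" "orthogonalizable y (perp V (case_pidx e (t e)) UNIV)"
proof -
  have gV: "nondeg_submodule V" and Ny: "\<And>u. u \<in> V \<Longrightarrow> N u = y * D u"
    using V by (auto simp: orthogonalizable_def)
  note W = nondeg_submoduleD[OF gV]
  have perp_good: "nondeg_submodule (perp V (case_pidx e (t e)) UNIV)" if "e \<in> V" "D e = 1" for e
  proof (rule nondeg_submodule_perp[OF frame_P[of e y] gV])
    show "e \<in> M" "\<beta> e (t e) = 1" "\<beta> e e = y"
      using that W(2) Ny[OF that(1)] by (auto simp: D_def N_def)
    show "case_pidx e (t e) j \<in> V" for j using that W(3) by (cases j) auto
  qed
  obtain a where a: "a \<in> V" "D a \<noteq> 0"
    using V u0 by (auto simp: orthogonalizable_def)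
  obtain x where x: "x\<^sup>2 = 1 / D a" using square_root by blast
  define e where "e = fscale x a"
  have e: "e \<in> V" "D e = 1"
    using a W x semilinearD(2)[OF semilinear_D] by (auto simp: e_def)
  let ?V1 = "perp V (case_pidx e (t e)) UNIV"
  show ?thesis
  proof (cases "(\<exists>u\<in>?V1. D u \<noteq> 0) \<or> (\<forall>u\<in>?V1. t u = 0)")
    case True
    then have "orthogonalizable y ?V1"
      using perp_good[OF e] Ny by (auto simp: orthogonalizable_def perp_def)
    then show ?thesis using that[OF e] Ny[OF e(1)] e(2) by simp
  next
    case False
    then obtain u where u: "u \<in> ?V1" "t u \<noteq> 0" and D0: "\<And>u. u \<in> ?V1 \<Longrightarrow> D u = 0" by blast
    obtain v where v: "v \<in> ?V1" "\<beta> u (t v) = 1" using partner_t[OF perp_good[OF e] u] .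
    have uv: "u \<in> V" "v \<in> V" "\<beta> u e = 0" "\<beta> v (t e) = 0" "u \<in> M" "v \<in> M" "e \<in> M"
      using u v e W(2) by (auto simp: perp_P)
    define e' where "e' = e + u"
    have e': "e' \<in> V" "D e' = 1" "e' \<in> M"
      using e uv W D0[OF u(1)] semilinearD(1)[OF semilinear_D] by (auto simp: e'_def)
    have vu: "\<beta> v (t u) = 1" using v(2) \<beta>_t \<beta>_sym uv t_in by metis
    \<comment> \<open>Both \<open>v\<close> and \<open>e'\<close> pair to 1 with
      \<open>t e'\<close>, so \<open>z0\<close> is orthogonal to it, and
      \<open>D z0 = D e' = 1\<close>. The multiple of \<open>t e'\<close> added in \<open>z\<close>
      then removes the pairing with \<open>e'\<close> without changing \<open>D\<close>.\<close>
    define z0 where "z0 = v + e'"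
    define z where "z = z0 + fscale (\<beta> z0 e') (t e')"
    have z0: "z0 \<in> V" "z0 \<in> M" "D z0 = 1"
      using W e' uv D0[OF v(1)] semilinearD(1)[OF semilinear_D] by (auto simp: z0_def)
    have "\<beta> v (t e') = 1"
      using uv vu by (simp add: e'_def t_add \<beta>_bilin t_in)
    then have z0e: "\<beta> z0 (t e') = 0"
      using e' uv self_add[of 1] by (simp add: z0_def \<beta>_bilin t_in D_def)
    have te: "\<beta> (t e') e' = 1" using e' \<beta>_t by (simp add: D_def)
    have "z \<in> V" using z0 W e' by (simp add: z_def)
    moreover have "\<beta> z e' = 0" "\<beta> z (t e') = 0"
      using z0 e' te z0e self_add by (simp_all add: z_def \<beta>_bilin t_in M_scale \<beta>_tt)
    moreover have "D z = 1"
      using z0 e' semilinearD[OF semilinear_D] D_t by (simp add: z_def M_scale t_in)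
    ultimately have "\<exists>u\<in>perp V (case_pidx e' (t e')) UNIV. D u \<noteq> 0"
      by (auto simp: perp_P)
    then have "orthogonalizable y (perp V (case_pidx e' (t e')) UNIV)"
      using perp_good[OF e'(1,2)] Ny by (auto simp: orthogonalizable_def perp_def)
    then show ?thesis using that[OF e'(1,2)] Ny[OF e'(1)] e'(2) by simp
  qed
qed

lemma peel_hyperbolic:
  assumes "nondeg_submodule V" "\<forall>u\<in>V. t u = 0"
  obtains k b where "frame (copies k (dsum one_obj one_obj)) ({..<k} \<times> (UNIV <+> UNIV)) ({..<k} \<times> ({} <+> {}))
      (map_prod id (map_sum id id)) (form_copies k hyperbolic) b"
    "b ` ({..<k} \<times> (UNIV <+> UNIV)) \<subseteq> V" "\<forall>u\<in>perp V b ({..<k} \<times> (UNIV <+> UNIV)). u = 0"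
proof (rule peel[OF unimodular_coord_hyperbolic[OF char], where \<C> = "\<lambda>V. nondeg_submodule V \<and> (\<forall>u\<in>V. t u = 0)"
      and fin = "\<lambda>V. \<forall>u\<in>V. u = 0" and ?V0.0 = V])
  show "\<exists>c. frame (dsum one_obj one_obj) (UNIV <+> UNIV) ({} <+> {}) (map_sum id id) hyperbolic c \<and>
      c ` (UNIV <+> UNIV) \<subseteq> V \<and> nondeg_submodule (perp V c (UNIV <+> UNIV)) \<and> (\<forall>u\<in>perp V c (UNIV <+> UNIV). t u = 0)"
    if "nondeg_submodule V \<and> (\<forall>u\<in>V. t u = 0)" "\<not> (\<forall>u\<in>V. u = 0)" for V
    using step_hyperbolic[of V] that by blast
qed (use assms that in auto)

lemma peel_2P:
  assumes "nondeg_submodule V" "\<forall>u\<in>V. N u = 0 \<and> D u = 0"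
  obtains k b where "frame (copies k (dsum P_obj P_obj)) ({..<k} \<times> (UNIV <+> UNIV)) ({..<k} \<times> ({Px} <+> {Px}))
      (map_prod id (map_sum (\<lambda>_. Pw) (\<lambda>_. Pw))) (form_copies k (quad_2P 0)) b"
    "b ` ({..<k} \<times> (UNIV <+> UNIV)) \<subseteq> V" "nondeg_submodule (perp V b ({..<k} \<times> (UNIV <+> UNIV)))"
    "\<forall>u\<in>perp V b ({..<k} \<times> (UNIV <+> UNIV)). t u = 0"
proof (rule peel[OF unimodular_coord_2P[OF char, of 0], where \<C> = "\<lambda>V. nondeg_submodule V \<and> (\<forall>u\<in>V. N u = 0 \<and> D u = 0)"
      and fin = "\<lambda>V. \<forall>u\<in>V. t u = 0" and ?V0.0 = V])
  show "\<exists>c. frame (dsum P_obj P_obj) (UNIV <+> UNIV) ({Px} <+> {Px}) (map_sum (\<lambda>_. Pw) (\<lambda>_. Pw)) (quad_2P 0) c \<and>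
    c ` (UNIV <+> UNIV) \<subseteq> V \<and> nondeg_submodule (perp V c (UNIV <+> UNIV)) \<and>
    (\<forall>u\<in>perp V c (UNIV <+> UNIV). N u = 0 \<and> D u = 0)"
    if "nondeg_submodule V \<and> (\<forall>u\<in>V. N u = 0 \<and> D u = 0)" "\<not> (\<forall>u\<in>V. t u = 0)" for V
    using step_2P[of V] that by blast
qed (use assms that in auto)

lemma peel_P:
  assumes "orthogonalizable y V"
  obtains k b where "frame (copies k P_obj) ({..<k} \<times> UNIV) ({..<k} \<times> {Px})
      (map_prod id (\<lambda>_. Pw)) (form_copies k (quad_P y)) b"
    "b ` ({..<k} \<times> UNIV) \<subseteq> V" "nondeg_submodule (perp V b ({..<k} \<times> UNIV))"
    "\<forall>u\<in>perp V b ({..<k} \<times> UNIV). t u = 0"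
proof (rule peel[OF unimodular_coord_P[OF char, of y], where \<C> = "orthogonalizable y"
      and fin = "\<lambda>V. \<forall>u\<in>V. t u = 0" and ?V0.0 = V])
  show "\<exists>c. frame P_obj UNIV {Px} (\<lambda>_. Pw) (quad_P y) c \<and> c ` UNIV \<subseteq> V \<and> orthogonalizable y (perp V c UNIV)"
    if V: "orthogonalizable y V" "\<not> (\<forall>u\<in>V. t u = 0)" for V
  proof -
    obtain u where "u \<in> V" "t u \<noteq> 0" using V(2) by blast
    with V(1) obtain e where e: "e \<in> V" "D e = 1" "N e = y" "orthogonalizable y (perp V (case_pidx e (t e)) UNIV)"
      by (rule step_P)
    have gV: "nondeg_submodule V" using V(1) by (simp add: orthogonalizable_def)
    have "frame P_obj UNIV {Px} (\<lambda>_. Pw) (quad_P y) (case_pidx e (t e))"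
      using e nondeg_submoduleD(2)[OF gV] by (intro frame_P) (auto simp: D_def N_def)
    moreover have "case_pidx e (t e) ` UNIV \<subseteq> V"
      using e nondeg_submoduleD(3)[OF gV] by (auto split: pidx.splits)
    ultimately show ?thesis using e(4) by blast
  qed
qed (use assms that in \<open>auto simp: orthogonalizable_def\<close>)

end


section \<open>Classification\<close>

lemma char2_square_add: "CHAR('k::field) = 2 \<Longrightarrow> (x + y)\<^sup>2 = x\<^sup>2 + (y::'k)\<^sup>2"
  by (simp add: power2_sum char2_two)

text \<open>The decomposition of \<open>U\<close> enters in two places: to factor functionals
  through \<open>t\<close>, and to count summands.\<close>

locale ver4_form = nondegenerate_form U q
  for U :: "('i, 'k::alg_closed_field) tmod" and q :: "('i, 'k) form" +
  fixes m n :: nat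
  assumes iso: "isomorphic U (dsum (copies m one_obj) (copies n P_obj))"
begin

text \<open>Since \<open>t\<close> vanishes on the complement of the frame, the complement splits
  into hyperbolic planes. Comparing dimension and rank of \<open>t\<close> with those of the given
  decomposition yields the two equations for the cardinalities.\<close>

lemma equiv_to_standardI:
  assumes f: "frame C S X p r b" and \<gamma>: "assoc_is C r \<gamma>"
    and perp: "\<forall>u\<in>perp M b S. t u = 0"
  obtains k where "equiv_to_standard U q k C \<gamma>" "2 * k + card S = m + 2 * n" "card X = n"
proof -
  note F = frameD[OF f]
  have "nondeg_submodule (perp M b S)" using nondeg_submodule_perp[OF f nondeg_submodule_M] F(2) by blast
  then obtain k h where h: "frame (copies k (dsum one_obj one_obj)) ({..<k} \<times> (UNIV <+> UNIV))
      ({..<k} \<times> ({} <+> {})) (map_prod id (map_sum id id)) (form_copies k hyperbolic) h"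
    "h ` ({..<k} \<times> (UNIV <+> UNIV)) \<subseteq> perp M b S"
    "\<forall>u\<in>perp (perp M b S) h ({..<k} \<times> (UNIV <+> UNIV)). u = 0"
    using peel_hyperbolic perp by blast
  have orth: "\<beta> (h i) (b j) = 0" if "i \<in> {..<k} \<times> (UNIV <+> UNIV)" "j \<in> S" for i j
    using h(2) that by (auto simp: perp_def)
  have hf: "frame (dsum (copies k (dsum one_obj one_obj)) C) (({..<k} \<times> (UNIV <+> UNIV)) <+> S)
      (({..<k} \<times> ({} <+> {})) <+> X) (map_sum (map_prod id (map_sum id id)) p)
      (form_sum (form_copies k hyperbolic) r) (case_sum h b)"
    by (rule frame_dsum[OF h(1) f orth])
  let ?S = "({..<k} \<times> (UNIV <+> UNIV :: (unit + unit) set)) <+> S"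
  have total: "u = 0" if "u \<in> M" "\<And>j. j \<in> ?S \<Longrightarrow> \<beta> u (case_sum h b j) = 0" for u
  proof -
    have "\<beta> u (h j) = 0" if "j \<in> {..<k} \<times> (UNIV <+> UNIV)" for j
      using \<open>\<And>j. j \<in> ?S \<Longrightarrow> _\<close>[of "Inl j"] that by simp
    moreover have "\<beta> u (b j) = 0" if "j \<in> S" for j
      using \<open>\<And>j. j \<in> ?S \<Longrightarrow> _\<close>[of "Inr j"] that by simp
    ultimately show ?thesis using h(3) that(1) by (auto simp: perp_def)
  qed
  have eq: "equiv_to_standard U q k C \<gamma>"
    unfolding equiv_to_standard_def
  proof (intro exI conjI)
    show "quadratic_equiv U q (dsum (copies k (dsum one_obj one_obj)) C) (form_sum (form_copies k hyperbolic) r)"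
      by (rule frame_quadratic_equiv[OF hf total])
  qed (use F(8) \<gamma> in \<open>auto simp: assoc_is_def\<close>)
  obtain f where "isomorphism U (dsum (copies m one_obj) (copies n P_obj)) f"
    using iso by (auto simp: isomorphic_def)
  moreover have "isomorphism (dsum (copies k (dsum one_obj one_obj)) C) U
      (\<lambda>z. \<Sum>j\<in>?S. fscale (z j) (case_sum h b j))"
    by (rule frame_isomorphism[OF hf total])
  ultimately have total_iso: "isomorphism (dsum (copies k (dsum one_obj one_obj)) C)
      (dsum (copies m one_obj) (copies n P_obj)) (\<lambda>z. f (\<Sum>j\<in>?S. fscale (z j) (case_sum h b j)))"
    by (rule isomorphism_comp[rotated])
  have "card ?S = card (({..<m} \<times> (UNIV :: unit set)) <+> ({..<n} \<times> (UNIV :: pidx set)))"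
    "card (({..<k} \<times> ({} <+> {} :: (unit + unit) set)) <+> X) = card (({..<m} \<times> ({} :: unit set)) <+> ({..<n} \<times> {Px}))"
    using coord_isomorphism_card[OF frameD(7)[OF hf]
      coord_dsum[OF coord_copies[OF coord_one] coord_copies[OF coord_P]] total_iso] .
  moreover have "finite S" "finite X"
    using coordD(1,2)[OF F(7)] finite_subset by blast+
  ultimately have "2 * k + card S = m + 2 * n" "card X = n"
    by (simp_all add: card_Plus card_cartesian_product UNIV_pidx UNIV_sum_unit)
  then show ?thesis using that eq by blast
qed

text \<open>A functional vanishing on \<open>ker t\<close> has the form
  \<open>F u = F' (t u)\<close>. If \<open>s\<close> represents \<open>F'\<close>, then
  \<open>\<beta> u (t s) = \<beta> (t u) s = F u\<close>.\<close>

lemma functional_represented_t: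
  assumes F: "\<And>u v. u \<in> M \<Longrightarrow> v \<in> M \<Longrightarrow> F (u + v) = F u + F v"
      "\<And>a u. u \<in> M \<Longrightarrow> F (fscale a u) = a * F u"
    and ker: "\<And>u. u \<in> M \<Longrightarrow> t u = 0 \<Longrightarrow> F u = 0"
  obtains s where "s \<in> M" "\<And>u. u \<in> M \<Longrightarrow> \<beta> u (t s) = F u"
proof -
  define C where "C = dsum (copies m one_obj) (copies n P_obj :: (_, 'k) tmod)"
  define S where "S = ({..<m} \<times> (UNIV :: unit set)) <+> ({..<n} \<times> (UNIV :: pidx set))"
  define X where "X = ({..<m} \<times> ({} :: unit set)) <+> ({..<n} \<times> {Px})"
  define p where "p = map_sum (map_prod (id :: nat \<Rightarrow> nat) (id :: unit \<Rightarrow> unit)) (map_prod (id :: nat \<Rightarrow> nat) (\<lambda>_ :: pidx. Pw))"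
  have co: "coord C S X p"
    unfolding C_def S_def X_def p_def
    by (rule coord_dsum[OF coord_copies[OF coord_one] coord_copies[OF coord_P]])
  note C = coordD[OF co]
  obtain f where f: "isomorphism U C f"
    using iso by (auto simp: isomorphic_def C_def)
  define g where "g = inv_into M f"
  have g: "isomorphism C U g"
    unfolding g_def by (rule isomorphism_inv_into[OF obj coord_ver4_object[OF co] f])
  have flin: "linear_map_on M (supp_space S) f" and glin: "linear_map_on (supp_space S) M g"
    and ft: "\<And>u. u \<in> M \<Longrightarrow> f (t u) = act C (f u)"
    and gt: "\<And>z. z \<in> supp_space S \<Longrightarrow> g (act C z) = t (g z)"
    and gf: "\<And>u. u \<in> M \<Longrightarrow> g (f u) = u"
    using f g by (auto simp: isomorphism_def morphism_def C(5) g_def bij_betw_def)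
  let ?b = "\<lambda>j. g (unit_vec j)"
  have uS: "(unit_vec j :: _ \<Rightarrow> 'k) \<in> supp_space S" if "j \<in> S" for j
    using that by (rule unit_vec_in_supp)
  have bM: "?b j \<in> M" if "j \<in> S" for j
    using linear_map_onD(1)[OF glin uS[OF that]] .
  have expand: "u = (\<Sum>j\<in>S. fscale (f u j) (?b j))" if u: "u \<in> M" for u
  proof -
    have "g (\<Sum>j\<in>S. fscale (f u j) (unit_vec j)) = (\<Sum>j\<in>S. fscale (f u j) (?b j))"
      by (rule linear_map_on_sum[OF glin subspace_supp_space uS])
    then show ?thesis
      using supp_space_expand[OF C(1) linear_map_onD(1)[OF flin u]] gf[OF u] by simp
  qed
  have F0: "F 0 = 0" using F(2)[OF M_0, of 0] by simp
  have Fsum: "F (\<Sum>j\<in>S. fscale (z j) (?b j)) = (\<Sum>j\<in>S. z j * F (?b j))" for z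
  proof -
    have "linear_map_on M UNIV (\<lambda>u _::unit. F u)"
      using F by (auto simp: linear_map_on_def fun_eq_iff)
    from linear_map_on_sum[OF this subsp, of S ?b z] bM show ?thesis
      by (auto simp: fun_eq_iff sum_fun_apply)
  qed
  \<comment> \<open>This moves the value of \<open>F\<close> at the basis vector \<open>p j\<close>
    to its image under \<open>t\<close>, the basis vector \<open>j\<close>, and puts 0 on the rest
    of the basis.\<close>
  define F' where "F' u = (\<Sum>j\<in>X. f u j * F (?b (p j)))" for u
  have "F' (u + v) = F' u + F' v" if "u \<in> M" "v \<in> M" for u v
    using linear_map_onD(2)[OF flin that] by (simp add: F'_def algebra_simps sum.distrib)
  moreover have "F' (fscale a u) = a * F' u" if "u \<in> M" for a u
    using linear_map_onD(3)[OF flin that] by (simp add: F'_def sum_distrib_left mult.assoc)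
  ultimately obtain s where s: "s \<in> M" "\<And>u. u \<in> M \<Longrightarrow> \<beta> u s = F' u"
    using functional_represented[of F'] by metis
  have "\<beta> u (t s) = F u" if u: "u \<in> M" for u
  proof -
    have kill: "F (?b j) = 0" if "j \<in> S - p ` X" for j
    proof (rule ker)
      show "?b j \<in> M" using bM that by blast
      have "act C (unit_vec j) = 0"
        using C(6)[OF uS] that by (auto simp: fun_eq_iff)
      then show "t (?b j) = 0"
        using gt[OF uS, of j] that linear_map_on_0[OF glin subspace_supp_space] by simp
    qed
    have "\<beta> u (t s) = F' (t u)"
      using \<beta>_t[OF u s(1)] s(2)[OF t_in[OF u]] by simp
    also have "\<dots> = (\<Sum>j\<in>X. f u (p j) * F (?b (p j)))"
      unfolding F'_def by (intro sum.cong refl) (simp add: ft[OF u] C(6)[OF linear_map_onD(1)[OF flin u]])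
    also have "\<dots> = (\<Sum>j\<in>p ` X. f u j * F (?b j))"
      by (simp add: sum.reindex[OF C(4)])
    also have "\<dots> = (\<Sum>j\<in>S. f u j * F (?b j))"
      using C(1,3) kill by (intro sum.mono_neutral_left) auto
    also have "\<dots> = F u"
      using Fsum[of "f u"] expand[OF u] by simp
    finally show ?thesis .
  qed
  then show ?thesis using that s(1) by blast
qed

text \<open>Square roots exist in \<open>'k\<close> and are unique in characteristic 2, so taking
  them pointwise turns \<open>F\<close> into a linear functional.\<close>

lemma semilinear_represented:
  assumes F: "semilinear F" and ker: "\<And>u. u \<in> M \<Longrightarrow> t u = 0 \<Longrightarrow> F u = 0"
  obtains s where "s \<in> M" "\<And>u. u \<in> M \<Longrightarrow> (\<beta> u (t s))\<^sup>2 = F u"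
proof -
  have "\<forall>u. \<exists>x. x\<^sup>2 = F u" using square_root by metis
  then obtain l where l: "\<And>u. (l u)\<^sup>2 = F u" by metis
  have "l (u + v) = l u + l v" if "u \<in> M" "v \<in> M" for u v
    using semilinearD(1)[OF F that] by - (rule char2_square_inj[OF char], simp add: l char2_square_add[OF char])
  moreover have "l (fscale a u) = a * l u" if "u \<in> M" for a u
    using semilinearD(2)[OF F that] by - (rule char2_square_inj[OF char], simp add: l power_mult_distrib)
  moreover have "l u = 0" if "u \<in> M" "t u = 0" for u
    using ker[OF that] l[of u] by simp
  ultimately obtain s where "s \<in> M" "\<And>u. u \<in> M \<Longrightarrow> \<beta> u (t s) = l u"
    by (rule functional_represented_t[of l]) blast+
  then show ?thesis using that l by simp
qed

lemma frame_PP: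
  assumes "e1 \<in> M" "e2 \<in> M" "D e1 = 1" "D e2 = 1" "N e1 = y" "N e2 = z" "\<beta> e1 e2 = 0" "\<beta> e1 (t e2) = 0"
  shows "frame (dsum P_obj P_obj) (UNIV <+> UNIV) ({Px} <+> {Px}) (map_sum (\<lambda>_. Pw) (\<lambda>_. Pw))
    (form_sum (quad_P y) (quad_P z)) (case_sum (case_pidx e1 (t e1)) (case_pidx e2 (t e2)))"
  using assms \<beta>_t[of e1 e2] \<beta>_tt[of e1 e2] t_in
  by (intro frame_dsum frame_P) (auto simp: D_def N_def split: pidx.splits)

definition perp2 :: "('i \<Rightarrow> 'k) \<Rightarrow> ('i \<Rightarrow> 'k) \<Rightarrow> ('i \<Rightarrow> 'k) set"
  where "perp2 e1 e2 = {u \<in> M. \<beta> u e1 = 0 \<and> \<beta> u (t e1) = 0 \<and> \<beta> u e2 = 0 \<and> \<beta> u (t e2) = 0}"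

lemma perp_PP:
  "perp M (case_sum (case_pidx e1 (t e1)) (case_pidx e2 (t e2))) (UNIV <+> UNIV) = perp2 e1 e2"
  unfolding perp_case_sum perp_P by (auto simp: perp2_def)

text \<open>Serves to exclude \<open>N e1 = 1\<close> when \<open>N\<close> and \<open>D\<close>
  vanish on the complement, since in the mixed case \<open>N\<close> is no multiple of
  \<open>D\<close>.\<close>

lemma N_eq_D_on_frame:
  assumes e: "e1 \<in> M" "e2 \<in> M" "D e1 = 1" "D e2 = 1" "N e1 = 1" "N e2 = 1" "\<beta> e1 e2 = 0" "\<beta> e1 (t e2) = 0"
    and "\<And>u. u \<in> perp2 e1 e2 \<Longrightarrow> N u = 0 \<and> D u = 0" "u \<in> M"
  shows "N u = 1 * D u"
proof -
  have "(\<lambda>u. N u - 1 * D u) u = 0"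
  proof (rule semilinear_frame_zero[OF semilinear_lincomb[OF semilinear_N semilinear_D] frame_PP[OF e] _ _ \<open>u \<in> M\<close>])
    fix j :: "pidx + pidx"
    have "\<forall>j. N (case_sum (case_pidx e1 (t e1)) (case_pidx e2 (t e2)) j)
      - 1 * D (case_sum (case_pidx e1 (t e1)) (case_pidx e2 (t e2)) j) = 0"
      unfolding all_sum all_pidx using e N_t D_t by simp
    then show "N (case_sum (case_pidx e1 (t e1)) (case_pidx e2 (t e2)) j)
      - 1 * D (case_sum (case_pidx e1 (t e1)) (case_pidx e2 (t e2)) j) = 0" by blast
  next
    fix v assume "v \<in> perp M (case_sum (case_pidx e1 (t e1)) (case_pidx e2 (t e2))) (UNIV <+> UNIV)"
    then show "N v - 1 * D v = 0"
      using assms(9)[of v] unfolding perp_PP by simp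
  qed
  then show ?thesis by simp
qed

text \<open>
  Modulo \<open>ker t\<close> we want \<open>s = c e\<^sub>1 + e\<^sub>2\<close> with \<open>D e\<^sub>1 = D e\<^sub>2 = 1\<close>, which forces \<open>c = \<delta> s + 1\<close>,
  where \<open>\<delta>\<^sup>2 = D\<close>.
\<close>

lemma mixed_frame:
  assumes no: "\<And>y. \<exists>u\<in>M. N u \<noteq> y * D u" and D0: "\<exists>u\<in>M. D u \<noteq> 0"
  obtains e1 e2 where "e1 \<in> M" "e2 \<in> M" "D e1 = 1" "D e2 = 1" "N e2 = 1" "\<beta> e1 e2 = 0" "\<beta> e1 (t e2) = 0"
    "orthogonalizable 0 (perp2 e1 e2)"
proof -
  note DD = semilinearD[OF semilinear_D] and NN = semilinearD[OF semilinear_N]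
  obtain s where s: "s \<in> M" and N: "\<And>u. u \<in> M \<Longrightarrow> N u = (\<beta> u (t s))\<^sup>2"
    using semilinear_represented[OF semilinear_N] \<beta>_diag_ker by (metis N_def)
  obtain d where d: "d \<in> M" and D: "\<And>u. u \<in> M \<Longrightarrow> D u = (\<beta> u (t d))\<^sup>2"
    using semilinear_represented[OF semilinear_D] by (metis D_def \<beta>_0(2))
  have mem: "t s \<in> M" "t d \<in> M" using s d t_in by auto
  define l where "l u = \<beta> u (t s)" for u
  define \<delta> where "\<delta> u = \<beta> u (t d)" for u
  have l_add: "l (u + v) = l u + l v" and \<delta>_add: "\<delta> (u + v) = \<delta> u + \<delta> v" if "u \<in> M" "v \<in> M" for u v
    using that mem by (simp_all add: l_def \<delta>_def \<beta>_bilin)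
  have l_scale: "l (fscale a u) = a * l u" and \<delta>_scale: "\<delta> (fscale a u) = a * \<delta> u" if "u \<in> M" for a u
    using that mem by (simp_all add: l_def \<delta>_def \<beta>_bilin)
  have Nl: "N u = (l u)\<^sup>2" and D\<delta>: "D u = (\<delta> u)\<^sup>2" if "u \<in> M" for u
    using that N D by (auto simp: l_def \<delta>_def)
  have ls: "l s = (\<delta> s)\<^sup>2"
    using D\<delta>[OF s] by (simp add: l_def D_def)
  \<comment> \<open>The functionals \<open>l\<close> and \<open>\<delta>\<close> are linearly
    independent, so both values can be prescribed; this choice gives
    \<open>N e = D e = 1\<close>.\<close>
  obtain e where e: "e \<in> M" "l e = 1" "\<delta> e = 1"
  proof -
    obtain a where a: "a \<in> M" "\<delta> a \<noteq> 0" using D0 D\<delta> by force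
    define u where "u = fscale (1 / \<delta> a) a"
    have u: "u \<in> M" "\<delta> u = 1" using a M_scale \<delta>_scale by (auto simp: u_def)
    obtain v where v: "v \<in> M" "l v \<noteq> l u * \<delta> v"
      using no[of "(l u)\<^sup>2"] Nl D\<delta> by (metis power_mult_distrib)
    \<comment> \<open>This moves \<open>v\<close> into the kernel of \<open>\<delta>\<close>; the
      choice of \<open>v\<close> is exactly what keeps \<open>l v'\<close> nonzero.\<close>
    define v' where "v' = v + fscale (\<delta> v) u"
    have v': "v' \<in> M" "\<delta> v' = 0" "l v' \<noteq> 0"
      using u v M_add M_scale self_add add_eq_0_iff
      by (auto simp: v'_def \<delta>_add \<delta>_scale l_add l_scale mult.commute)
    define e where "e = u + fscale ((1 + l u) / l v') v'"
    have "l e = l u + (1 + l u)"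
      using u v' M_scale by (simp add: e_def l_add l_scale)
    also have "\<dots> = (l u + l u) + 1" by (simp add: algebra_simps)
    finally have "l e = 1" by (simp only: self_add add_0_left)
    moreover have "e \<in> M" "\<delta> e = 1"
      using u v' M_add M_scale by (simp_all add: e_def \<delta>_add \<delta>_scale)
    ultimately show ?thesis using that by blast
  qed
  define c where "c = \<delta> s + 1"
  have not_ND: "\<not> (\<forall>u\<in>M. N u = 1 * D u)" using no[of 1] by blast
  show ?thesis
  proof (cases "c = 0")
    case True
    \<comment> \<open>Here \<open>s\<close> itself serves as \<open>e2\<close>. On its complement
      \<open>l\<close>, hence \<open>N\<close>, vanishes; if \<open>D\<close> vanished there too,
      \<open>N\<close> and \<open>D\<close> would coincide. So \<open>step_P\<close> with
      \<open>y = 0\<close> supplies \<open>e1\<close>.\<close>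
    then have "\<delta> s = 1" using add_eq_0_iff by (simp add: c_def)
    then have Ds: "D s = 1" "N s = 1" using ls s D\<delta> Nl by auto
    then have fs: "frame P_obj UNIV {Px} (\<lambda>_. Pw) (quad_P 1) (case_pidx s (t s))"
      using s by (intro frame_P) (auto simp: D_def N_def)
    let ?V = "perp M (case_pidx s (t s)) UNIV"
    have gV: "nondeg_submodule ?V"
      using nondeg_submodule_perp[OF fs nondeg_submodule_M] s t_in by (auto simp: all_pidx split: pidx.splits)
    have N0: "N u = 0" if "u \<in> ?V" for u
      using that Nl by (auto simp: perp_P l_def)
    have "\<exists>u\<in>?V. D u \<noteq> 0"
    proof (rule ccontr)
      assume no': "\<not> ?thesis"
      have "(\<lambda>u. N u - 1 * D u) u = 0" if u: "u \<in> M" for u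
      proof (rule semilinear_frame_zero[OF semilinear_lincomb[OF semilinear_N semilinear_D] fs _ _ u])
        fix j show "N (case_pidx s (t s) j) - 1 * D (case_pidx s (t s) j) = 0"
          using Ds N_t D_t s by (cases j) auto
      qed (use N0 no' in auto)
      then show False using not_ND by simp
    qed
    then have oV: "orthogonalizable 0 ?V" and "\<exists>u\<in>?V. t u \<noteq> 0"
      using gV N0 by (auto simp: orthogonalizable_def) (metis D_def \<beta>_0(2))
    then obtain e1 where e1: "e1 \<in> ?V" "D e1 = 1" "N e1 = 0" "orthogonalizable 0 (perp ?V (case_pidx e1 (t e1)) UNIV)"
      using step_P by blast
    have "perp ?V (case_pidx e1 (t e1)) UNIV = perp2 e1 s"
      by (auto simp: perp_P perp2_def)
    then show ?thesis
      using that[of e1 s] e1 s Ds by (auto simp: perp_P)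
  next
    case False
    have cs: "\<delta> s = c + 1" using self_add[of 1] by (simp add: c_def add.assoc)
    have lsc: "l s = c\<^sup>2 + 1" by (simp add: ls cs char2_square_add[OF char])
    \<comment> \<open>\<open>e1 = (s + e2) / c\<close> up to a multiple of \<open>t e2\<close>\<close>
    define E where "E e1 e2 \<longleftrightarrow> e1 \<in> M \<and> D e1 = 1 \<and> N e1 = c\<^sup>2 \<and> \<beta> e1 e2 = 0 \<and> \<beta> e1 (t e2) = 0 \<and>
      (\<forall>u\<in>M. \<beta> u (t e1) = (l u + \<beta> u (t e2)) / c)" for e1 e2
    \<comment> \<open>The vector \<open>e2\<close> stays a parameter because the first choice may
      have to be replaced.\<close>
    have "\<exists>e1. E e1 e2" if e2: "e2 \<in> M" "l e2 = 1" "\<delta> e2 = 1" for e2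
    proof -
      have De2: "D e2 = 1" "N e2 = 1" using e2 D\<delta> Nl by auto
      define f where "f = fscale (1 / c) (s + e2)"
      define e1 where "e1 = f + fscale (\<beta> f e2) (t e2)"
      have fM: "f \<in> M" using s e2 M_add M_scale by (simp add: f_def)
      have "\<beta> s (t e2) = 1" using e2 s \<beta>_t \<beta>_sym t_in by (metis l_def)
      then have ft: "\<beta> f (t e2) = 0"
        using e2 s De2 self_add[of 1] by (simp add: f_def \<beta>_bilin t_in M_add M_scale D_def)
      have te2: "\<beta> (t e2) e2 = 1" using De2 e2 \<beta>_t by (simp add: D_def)
      have "D f = 1"
      proof -
        \<comment> \<open>Since \<open>D s = (\<delta> s)\<^sup>2 = (c + 1)\<^sup>2\<close>, the
          value of \<open>c\<close> is what makes this 1.\<close>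
        have "D f = (1 / c)\<^sup>2 * ((c + 1)\<^sup>2 + 1)"
          using s e2 De2 D\<delta>[OF s] cs DD M_add by (simp add: f_def)
        also have "(c + 1)\<^sup>2 + 1 = c\<^sup>2"
          using self_add[of 1] by (simp add: char2_square_add[OF char] add.assoc)
        finally show ?thesis using False by (simp add: power_divide)
      qed
      moreover have "N f = c\<^sup>2"
      proof -
        have "N f = (1 / c)\<^sup>2 * ((c\<^sup>2 + 1)\<^sup>2 + 1)"
          using s e2 De2 Nl[OF s] lsc NN M_add by (simp add: f_def)
        also have "(c\<^sup>2 + 1)\<^sup>2 + 1 = c\<^sup>2 * c\<^sup>2"
          by (simp only: char2_square_add[OF char] one_power2 add.assoc self_add add_0_right
              power2_eq_square[of "c\<^sup>2"])
        finally show ?thesis using False by (simp add: power_divide power2_eq_square)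
      qed
      ultimately have "D e1 = 1" "N e1 = c\<^sup>2"
        using fM e2 DD NN D_t N_t M_scale t_in by (simp_all add: e1_def)
      moreover have "e1 \<in> M" using fM e2 M_add M_scale t_in by (simp add: e1_def)
      moreover have "\<beta> e1 e2 = 0" "\<beta> e1 (t e2) = 0"
        using fM e2 te2 ft self_add by (simp_all add: e1_def \<beta>_bilin M_scale t_in \<beta>_tt)
      moreover have "\<beta> u (t e1) = (l u + \<beta> u (t e2)) / c" if "u \<in> M" for u
      proof -
        have "t e1 = fscale (1 / c) (t s + t e2)"
          using fM s e2 M_add M_scale t_in by (simp add: e1_def f_def t_add t_scale tt)
        then show ?thesis
          using that s e2 M_add M_scale t_in by (simp add: \<beta>_bilin l_def)
      qed
      ultimately show ?thesis unfolding E_def by blast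
    qed
    note ex = this
    have good2: "nondeg_submodule (perp2 e1 e2)" and N0: "\<And>u. u \<in> perp2 e1 e2 \<Longrightarrow> l u = 0 \<and> N u = 0"
      if E: "E e1 e2" and e2: "e2 \<in> M" "l e2 = 1" "\<delta> e2 = 1" for e1 e2
    proof -
      have De2: "D e2 = 1" "N e2 = 1" using e2 D\<delta> Nl by auto
      have e1: "e1 \<in> M" "D e1 = 1" "N e1 = c\<^sup>2" "\<beta> e1 e2 = 0" "\<beta> e1 (t e2) = 0"
        using E by (auto simp: E_def)
      have f: "frame (dsum P_obj P_obj) (UNIV <+> UNIV) ({Px} <+> {Px}) (map_sum (\<lambda>_. Pw) (\<lambda>_. Pw))
          (form_sum (quad_P (c\<^sup>2)) (quad_P 1)) (case_sum (case_pidx e1 (t e1)) (case_pidx e2 (t e2)))"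
        using e1 e2 De2 by (intro frame_PP) auto
      from nondeg_submodule_perp[OF f nondeg_submodule_M] frameD(2)[OF f] show "nondeg_submodule (perp2 e1 e2)"
        unfolding perp_PP by blast
      fix u assume u: "u \<in> perp2 e1 e2"
      \<comment> \<open>The last clause of \<open>E\<close> gives
        \<open>l u = c * \<beta> u (t e1) + \<beta> u (t e2)\<close>, and both pairings vanish on
        the complement.\<close>
      then have "l u = 0" using E False by (auto simp: E_def perp2_def)
      then show "l u = 0 \<and> N u = 0" using Nl u by (simp add: perp2_def)
    qed
    obtain e1 where e1: "E e1 e" using ex[OF e] by blast
    have De: "D e = 1" "N e = 1" using e D\<delta> Nl by auto
    let ?V = "perp2 e1 e"
    note gV = good2[OF e1 e] and N0V = N0[OF e1 e]
    show ?thesis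
    proof (cases "(\<exists>u\<in>?V. D u \<noteq> 0) \<or> (\<forall>u\<in>?V. t u = 0)")
      case True
      then have "orthogonalizable 0 ?V"
        using gV N0V by (auto simp: orthogonalizable_def)
      then show ?thesis using that[of e1 e] e1 e De by (auto simp: E_def)
    next
      case False': False
      then obtain u where u: "u \<in> ?V" "t u \<noteq> 0" and DV: "\<And>u. u \<in> ?V \<Longrightarrow> D u = 0" by blast
      \<comment> \<open>For \<open>c = 1\<close> also \<open>N e1 = 1\<close>, and since
        \<open>N\<close> and \<open>D\<close> vanish on the complement, \<open>N\<close> would equal
        \<open>D\<close> on all of \<open>M\<close>.\<close>
      have "c \<noteq> 1"
        using N_eq_D_on_frame[of e1 e] e1 e De DV N0V not_ND by (force simp: E_def)
      then have c1: "(1 / c)\<^sup>2 + 1 \<noteq> 0"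
        using char2_square_inj[OF char, of "1 / c" 1] False by (auto simp: add_eq_0_iff)
      obtain v where v: "v \<in> ?V" "\<beta> u (t v) = 1" using partner_t[OF gV u] .
      have uv: "u \<in> M" "v \<in> M" "l u = 0" "l v = 0" "\<delta> u = 0"
        using u v N0V DV[OF u(1)] D\<delta>[of u] by (auto simp: perp2_def)
      have vu: "\<beta> v (t u) = 1" using v(2) \<beta>_t \<beta>_sym uv t_in by metis
      \<comment> \<open>As \<open>l u = \<delta> u = 0\<close>, the vector \<open>e'\<close> is
        normalised like \<open>e\<close> and has a partner \<open>e1'\<close> of its own.\<close>
      define e' where "e' = e + u"
      have e': "e' \<in> M" "l e' = 1" "\<delta> e' = 1"
        using e uv M_add by (simp_all add: e'_def l_add \<delta>_add)
      have De': "D e' = 1" "N e' = 1" using e' D\<delta> Nl by auto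
      obtain e1' where E': "E e1' e'" using ex[OF e'] by blast
      then have e1': "e1' \<in> M" "D e1' = 1" "\<beta> e1' e' = 0" "\<beta> e1' (t e') = 0"
        and te1': "\<And>u. u \<in> M \<Longrightarrow> \<beta> u (t e1') = (l u + \<beta> u (t e')) / c"
        by (auto simp: E_def)
      let ?V' = "perp2 e1' e'"
      have ve': "\<beta> v (t e') = 1"
        using uv v vu e by (simp add: e'_def t_add \<beta>_bilin t_in perp2_def)
      \<comment> \<open>The vector \<open>v\<close> pairs to \<open>1 / c\<close> with
        \<open>t e1'\<close> and to 1 with \<open>t e'\<close>; the two added terms cancel these
        pairings and contribute \<open>(1 / c)\<^sup>2\<close> and 1 to \<open>D\<close>.\<close>
      define w where "w = v + fscale (1 / c) e1' + e'"
      have wM: "w \<in> M" using uv e1' e' M_add M_scale by (simp add: w_def)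
      have we': "\<beta> w (t e') = 0"
        using uv e1' e' ve' De' self_add[of 1] by (simp add: w_def \<beta>_bilin M_add M_scale t_in D_def)
      have e'e1': "\<beta> e' (t e1') = 0" using e1' e' \<beta>_t \<beta>_sym t_in by metis
      have we1': "\<beta> w (t e1') = 0"
        using uv e1' e' ve' te1'[OF uv(2)] e'e1' self_add[of "1 / c"]
        by (simp add: w_def \<beta>_bilin M_add M_scale t_in) (simp add: D_def)
      have Dw: "D w = (1 / c)\<^sup>2 + 1"
        using uv e1' e' De' DV[OF v(1)] DD M_add M_scale by (simp add: w_def)
      \<comment> \<open>Corrections in the image of \<open>t\<close> remove the pairings with
        \<open>e1'\<close> and \<open>e'\<close>; they change neither \<open>D\<close> nor the
        pairings already cancelled.\<close>
      define w' where "w' = w + fscale (\<beta> w e1') (t e1') + fscale (\<beta> w e') (t e')"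
      have tb: "\<beta> (t e1') e1' = 1" "\<beta> (t e1') e' = 0" "\<beta> (t e') e1' = 0" "\<beta> (t e') e' = 1"
        using e1' e' De' \<beta>_t \<beta>_sym t_in by (metis D_def)+
      have "w' \<in> ?V'"
        using wM e1' e' tb we' we1' self_add
        by (simp add: perp2_def w'_def \<beta>_bilin M_add M_scale t_in \<beta>_tt)
      moreover have "D w' \<noteq> 0"
        using wM e1' e' Dw c1 DD D_t M_add M_scale t_in by (simp add: w'_def)
      ultimately have "orthogonalizable 0 ?V'"
        using good2[OF E' e'] N0[OF E' e'] by (auto simp: orthogonalizable_def)
      then show ?thesis using that[of e1' e'] e1' e' De' by blast
    qed
  qed
qed

section \<open>The four cases\<close>

lemma card_PP: "card (UNIV <+> UNIV :: (pidx + pidx) set) = 4" "card ({Px} <+> {Px}) = 2"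
  unfolding UNIV_Plus_UNIV UNIV_sum_pidx by (simp_all add: card_Plus)

lemma card_P: "card (UNIV :: pidx set) = 2" "card {Px} = 1"
  by (simp_all add: UNIV_pidx)

lemmas assoc_is_copies_P = assoc_is_form_copies[OF coord_P assoc_is_P[OF char]]
lemmas assoc_is_PP = assoc_is_form_sum[OF coord_P coord_P assoc_is_P[OF char] assoc_is_P[OF char]]

lemma alternating_zero_case:
  assumes "\<forall>u\<in>M. N u = 0 \<and> D u = 0"
  shows "even m \<and> even n \<and> equiv_to_standard U q (m div 2)
    (copies (n div 2) (dsum P_obj P_obj)) (form_copies (n div 2) (beta_2P 0))"
proof -
  obtain k b
    where b: "frame (copies k (dsum P_obj P_obj)) ({..<k} \<times> (UNIV <+> UNIV)) ({..<k} \<times> ({Px} <+> {Px}))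
      (map_prod id (map_sum (\<lambda>_. Pw) (\<lambda>_. Pw))) (form_copies k (quad_2P 0)) b"
    and "b ` ({..<k} \<times> (UNIV <+> UNIV)) \<subseteq> M" "nondeg_submodule (perp M b ({..<k} \<times> (UNIV <+> UNIV)))"
    and tb: "\<forall>u\<in>perp M b ({..<k} \<times> (UNIV <+> UNIV)). t u = 0"
    using peel_2P[OF nondeg_submodule_M assms] .
  obtain h where h: "equiv_to_standard U q h (copies k (dsum P_obj P_obj)) (form_copies k (beta_2P 0))"
    "2 * h + card ({..<k} \<times> (UNIV <+> UNIV :: (pidx + pidx) set)) = m + 2 * n" "card ({..<k} \<times> ({Px} <+> {Px})) = n"
    using equiv_to_standardI[OF b assoc_is_form_copies[OF coord_dsum[OF coord_P coord_P] assoc_is_2P[OF char]] tb] .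
  then have "m = 2 * h" "n = 2 * k" by (simp_all only: card_PP card_cartesian_product card_lessThan)
  then show ?thesis using h(1) by simp
qed

lemma alternating_nonzero_case:
  assumes D0: "\<forall>u\<in>M. D u = 0" and N0: "\<exists>u\<in>M. N u \<noteq> 0"
  shows "even m \<and> even n \<and> n > 0 \<and> equiv_to_standard U q (m div 2)
    (dsum (dsum P_obj P_obj) (copies ((n - 2) div 2) (dsum P_obj P_obj)))
    (form_sum (beta_2P 1) (form_copies ((n - 2) div 2) (beta_2P 0)))"
proof -
  obtain s where s: "s \<in> M" and N: "\<And>u. u \<in> M \<Longrightarrow> (\<beta> u (t s))\<^sup>2 = N u"
    using semilinear_represented[OF semilinear_N] \<beta>_diag_ker by (metis N_def)
  obtain a where a: "a \<in> M" "\<beta> a (t s) \<noteq> 0" using N0 N by force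
  define w1 where "w1 = fscale (1 / \<beta> a (t s)) a"
  have w1: "w1 \<in> M" "\<beta> w1 (t s) = 1" using a s t_in M_scale by (auto simp: w1_def \<beta>_scale_left)
  \<comment> \<open>The correction makes \<open>w2\<close> orthogonal to \<open>w1\<close> but keeps
    \<open>t w2 = t s\<close>. Hence \<open>N w2 = (D w2)\<^sup>2 = 0\<close>, and \<open>N\<close>
    vanishes on everything orthogonal to \<open>t w2\<close>.\<close>
  define w2 where "w2 = s + fscale (\<beta> w1 s) (t s)"
  have w2: "w2 \<in> M" "t w2 = t s" "\<beta> w1 w2 = 0"
    using s w1 t_in M_add M_scale self_add by (simp_all add: w2_def t_add t_scale tt \<beta>_bilin)
  have "N w2 = (D w2)\<^sup>2"
    using N[OF w2(1)] w2(2) by (simp add: D_def)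
  then have Nw2: "N w2 = 0" using D0 w2(1) by simp
  have "N w1 = 1" using N[OF w1(1)] w1(2) by simp
  then have f: "frame (dsum P_obj P_obj) (UNIV <+> UNIV) ({Px} <+> {Px}) (map_sum (\<lambda>_. Pw) (\<lambda>_. Pw)) (quad_2P 1)
    (case_sum (case_pidx w1 (t w1)) (case_pidx w2 (t w2)))" (is "frame _ ?S _ _ _ ?c")
    using w1 w2 D0 Nw2 by (intro frame_2P) (auto simp: D_def N_def)
  have gP: "nondeg_submodule (perp M ?c ?S)" using nondeg_submodule_perp[OF f nondeg_submodule_M] frameD(2)[OF f] by blast
  have zP: "\<forall>u\<in>perp M ?c ?S. N u = 0 \<and> D u = 0"
  proof
    fix u assume "u \<in> perp M ?c ?S"
    then have "u \<in> M" "\<beta> u (t w2) = 0"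
      unfolding perp_def ball_Plus using all_pidx by auto
    then show "N u = 0 \<and> D u = 0" using N[of u] D0 w2(2) by simp
  qed
  obtain k b
    where b: "frame (copies k (dsum P_obj P_obj)) ({..<k} \<times> (UNIV <+> UNIV)) ({..<k} \<times> ({Px} <+> {Px}))
      (map_prod id (map_sum (\<lambda>_. Pw) (\<lambda>_. Pw))) (form_copies k (quad_2P 0)) b"
      "b ` ({..<k} \<times> (UNIV <+> UNIV)) \<subseteq> perp M ?c ?S"
      "nondeg_submodule (perp (perp M ?c ?S) b ({..<k} \<times> (UNIV <+> UNIV)))"
      "\<forall>u\<in>perp (perp M ?c ?S) b ({..<k} \<times> (UNIV <+> UNIV)). t u = 0"
    using peel_2P[OF gP zP] .
  have "\<beta> (?c i) (b j) = 0" if "i \<in> ?S" "j \<in> {..<k} \<times> (UNIV <+> UNIV)" for i j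
    using b(2) that \<beta>_sym[OF frameD(2)[OF f] frameD(2)[OF b(1)]] by (auto simp: perp_def)
  note fb = frame_dsum[OF f b(1) this]
  obtain h where h: "equiv_to_standard U q h (dsum (dsum P_obj P_obj) (copies k (dsum P_obj P_obj)))
      (form_sum (beta_2P 1) (form_copies k (beta_2P 0)))"
    "2 * h + card (?S <+> ({..<k} \<times> (UNIV <+> UNIV :: (pidx + pidx) set))) = m + 2 * n"
    "card (({Px} <+> {Px}) <+> ({..<k} \<times> ({Px} <+> {Px}))) = n"
  proof (rule equiv_to_standardI)
    show "assoc_is (dsum (dsum P_obj P_obj) (copies k (dsum P_obj P_obj))) (form_sum (quad_2P (1::'k)) (form_copies k (quad_2P 0)))
        (form_sum (beta_2P 1) (form_copies k (beta_2P 0)))"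
      by (rule assoc_is_form_sum assoc_is_form_copies assoc_is_2P coord_dsum coord_copies coord_P char)+
    show "\<forall>u\<in>perp M (case_sum ?c b) (?S <+> ({..<k} \<times> (UNIV <+> UNIV))). t u = 0"
      using b(4) unfolding perp_case_sum .
  qed (use fb in auto)
  have "finite (UNIV <+> UNIV :: (pidx + pidx) set)" by (simp add: UNIV_sum_pidx)
  then have "m = 2 * h" "n = 2 + 2 * k"
    using h(2,3) by (simp_all only: card_PP card_Plus card_cartesian_product card_lessThan
      finite_cartesian_product finite_lessThan finite_Plus finite.intros)
  then show ?thesis using h(1) by simp
qed

lemma proportional_case:
  assumes D0: "\<exists>u\<in>M. D u \<noteq> 0" and N: "\<forall>u\<in>M. N u = y * D u"
  shows "even m \<and> n > 0 \<and> equiv_to_standard U q (m div 2) (copies n P_obj) (form_copies n (beta_P y))"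
proof -
  have oM: "orthogonalizable y M"
    using nondeg_submodule_M assms by (auto simp: orthogonalizable_def)
  obtain k b where b: "frame (copies k P_obj) ({..<k} \<times> UNIV) ({..<k} \<times> {Px})
      (map_prod id (\<lambda>_. Pw)) (form_copies k (quad_P y)) b"
    and "b ` ({..<k} \<times> UNIV) \<subseteq> M" "nondeg_submodule (perp M b ({..<k} \<times> UNIV))"
    and tb: "\<forall>u\<in>perp M b ({..<k} \<times> UNIV). t u = 0"
    using peel_P[OF oM] .
  obtain h where h: "equiv_to_standard U q h (copies k P_obj) (form_copies k (beta_P y))"
    "2 * h + card ({..<k} \<times> (UNIV :: pidx set)) = m + 2 * n" "card ({..<k} \<times> {Px}) = n"
    using equiv_to_standardI[OF b assoc_is_copies_P tb] .
  then have "m = 2 * h" "n = k" by (simp_all add: card_P card_cartesian_product)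
  \<comment> \<open>Without a copy of \<open>P\<close> the whole of \<open>M\<close> would be killed
    by \<open>t\<close>, contradicting \<open>D \<noteq> 0\<close>.\<close>
  moreover have "k > 0"
  proof (rule ccontr)
    assume "\<not> k > 0"
    then have "\<forall>u\<in>M. t u = 0" using tb by (simp add: perp_def)
    then show False using D0 by (simp add: D_def)
  qed
  ultimately show ?thesis using h(1) by simp
qed

lemma mixed_case:
  assumes no: "\<And>y. \<exists>u\<in>M. N u \<noteq> y * D u" and D0: "\<exists>u\<in>M. D u \<noteq> 0"
  shows "even m \<and> (n = 2 \<and> (\<exists>y. y \<noteq> 1 \<and>
       equiv_to_standard U q (m div 2) (dsum P_obj P_obj) (form_sum (beta_P y) (beta_P 1)))
     \<or> n \<ge> 3 \<and> (\<exists>y. equiv_to_standard U q (m div 2)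
         (dsum (dsum P_obj P_obj) (copies (n - 2) P_obj))
         (form_sum (form_sum (beta_P y) (beta_P 1)) (form_copies (n - 2) (beta_P 0)))))"
proof -
  obtain e1 e2 where e: "e1 \<in> M" "e2 \<in> M" "D e1 = 1" "D e2 = 1" "N e2 = 1" "\<beta> e1 e2 = 0" "\<beta> e1 (t e2) = 0"
    and V: "orthogonalizable 0 (perp2 e1 e2)"
    using mixed_frame[OF assms] .
  let ?c = "case_sum (case_pidx e1 (t e1)) (case_pidx e2 (t e2))" and ?S = "UNIV <+> UNIV :: (pidx + pidx) set"
  have f: "frame (dsum P_obj P_obj) ?S ({Px} <+> {Px}) (map_sum (\<lambda>_. Pw) (\<lambda>_. Pw))
    (form_sum (quad_P (N e1)) (quad_P 1)) ?c"
    using e by (intro frame_PP) auto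
  obtain k b where b: "frame (copies k P_obj) ({..<k} \<times> UNIV) ({..<k} \<times> {Px})
      (map_prod id (\<lambda>_. Pw)) (form_copies k (quad_P 0)) b"
    "b ` ({..<k} \<times> UNIV) \<subseteq> perp2 e1 e2"
    "nondeg_submodule (perp (perp2 e1 e2) b ({..<k} \<times> UNIV))"
    "\<forall>u\<in>perp (perp2 e1 e2) b ({..<k} \<times> UNIV). t u = 0"
    using peel_P[OF V] .
  have finS: "finite ?S" by (simp add: UNIV_sum_pidx)
  show ?thesis
  \<comment> \<open>Two copies of \<open>P\<close> come from \<open>e1\<close> and
    \<open>e2\<close>, so \<open>n = 2 + k\<close>; the parameter \<open>y\<close> is
    \<open>N e1\<close> in both cases.\<close>
  proof (cases "k = 0")
    case True
    then have t0: "\<forall>u\<in>perp2 e1 e2. t u = 0" using b(4) by (simp add: perp_def)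
    have "N e1 \<noteq> 1"
    proof
      assume "N e1 = 1"
      moreover have "N u = 0 \<and> D u = 0" if "u \<in> perp2 e1 e2" for u
        using V that t0 by (simp add: orthogonalizable_def D_def)
      ultimately have "\<forall>u\<in>M. N u = 1 * D u" using N_eq_D_on_frame[of e1 e2] e by blast
      then show False using no[of 1] by blast
    qed
    moreover obtain h where h: "equiv_to_standard U q h (dsum P_obj P_obj) (form_sum (beta_P (N e1)) (beta_P 1))"
      "2 * h + card ?S = m + 2 * n" "card ({Px} <+> {Px}) = n"
      using equiv_to_standardI[OF f assoc_is_PP] t0 unfolding perp_PP by blast
    moreover have "n = 2" using h(3) by (simp only: card_PP)
    moreover from this have "m = 2 * h" using h(2) by (simp only: card_PP)
    ultimately show ?thesis by auto
  next
    case False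
    have "\<beta> (?c i) (b j) = 0" if "i \<in> ?S" "j \<in> {..<k} \<times> UNIV" for i j
      using b(2) that \<beta>_sym[OF frameD(2)[OF f] frameD(2)[OF b(1)]]
      unfolding perp_PP[symmetric] by (auto simp: perp_def)
    note fb = frame_dsum[OF f b(1) this]
    obtain h where h: "equiv_to_standard U q h (dsum (dsum P_obj P_obj) (copies k P_obj))
        (form_sum (form_sum (beta_P (N e1)) (beta_P 1)) (form_copies k (beta_P 0)))"
      "2 * h + card (?S <+> ({..<k} \<times> (UNIV :: pidx set))) = m + 2 * n"
      "card (({Px} <+> {Px}) <+> ({..<k} \<times> {Px})) = n"
    proof (rule equiv_to_standardI)
      show "assoc_is (dsum (dsum P_obj P_obj) (copies k P_obj))
          (form_sum (form_sum (quad_P (N e1)) (quad_P 1)) (form_copies k (quad_P 0)))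
          (form_sum (form_sum (beta_P (N e1)) (beta_P 1)) (form_copies k (beta_P 0)))"
        by (rule assoc_is_form_sum[OF coord_dsum[OF coord_P coord_P] coord_copies[OF coord_P]
            assoc_is_PP assoc_is_copies_P])
      show "\<forall>u\<in>perp M (case_sum ?c b) (?S <+> ({..<k} \<times> UNIV)). t u = 0"
        using b(4) unfolding perp_case_sum perp_PP[unfolded perp_case_sum] .
    qed (use fb in auto)
    have "finite (UNIV :: pidx set)" by (simp add: UNIV_pidx)
    then have "m = 2 * h" "n = 2 + k"
      using h(2,3) finS by (simp_all only: card_PP card_P card_Plus card_cartesian_product card_lessThan
        finite_cartesian_product finite_lessThan finite_Plus finite.intros)
    then show ?thesis using h(1) False by auto
  qed
qed

end

theorem lemma4p28:
  fixes U :: "('i, 'k::alg_closed_field) tmod"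
    and q :: "('i, 'k) form"
    and m n :: nat
  assumes "CHAR('k) = 2"
    and "ver4_object U"
    and "isomorphic U (dsum (copies m one_obj) (copies n P_obj))"
    and "quadratic_form U q"
    and "nondegenerate_quadratic U q"
  shows "even m \<and>
    (even n \<and>
       equiv_to_standard U q (m div 2)
         (copies (n div 2) (dsum P_obj P_obj))
         (form_copies (n div 2) (beta_2P 0))
     \<or> even n \<and> n > 0 \<and>
       equiv_to_standard U q (m div 2)
         (dsum (dsum P_obj P_obj) (copies ((n - 2) div 2) (dsum P_obj P_obj)))
         (form_sum (beta_2P 1) (form_copies ((n - 2) div 2) (beta_2P 0)))
     \<or> n = 2 \<and> (\<exists>y. y \<noteq> 1 \<and>
       equiv_to_standard U q (m div 2)
         (dsum P_obj P_obj)
         (form_sum (beta_P y) (beta_P 1)))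
     \<or> n \<ge> 3 \<and> (\<exists>y.
       equiv_to_standard U q (m div 2)
         (dsum (dsum P_obj P_obj) (copies (n - 2) P_obj))
         (form_sum (form_sum (beta_P y) (beta_P 1)) (form_copies (n - 2) (beta_P 0))))
     \<or> n > 0 \<and> (\<exists>y.
       equiv_to_standard U q (m div 2)
         (copies n P_obj)
         (form_copies n (beta_P y))))"
proof -
  interpret ver4_form U q m n
    using assms by unfold_locales
  consider "\<forall>u\<in>M. N u = 0 \<and> D u = 0" | "\<forall>u\<in>M. D u = 0" "\<exists>u\<in>M. N u \<noteq> 0"
    | y where "\<exists>u\<in>M. D u \<noteq> 0" "\<forall>u\<in>M. N u = y * D u"
    | "\<exists>u\<in>M. D u \<noteq> 0" "\<And>y. \<exists>u\<in>M. N u \<noteq> y * D u"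
    by blast
  then show ?thesis
  proof cases
    case 1
    show ?thesis using alternating_zero_case[OF 1] by argo
  next
    case 2
    show ?thesis using alternating_nonzero_case[OF 2] by argo
  next
    case 3
    show ?thesis using proportional_case[OF 3] by blast
  next
    case 4
    show ?thesis using mixed_case[OF 4(2,1)] by argo
  qed
qed

end
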